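(* Let $(M,\xi)$ be a contact 3-manifold endowed with a sub-Riemannian metric. Then $M$ is nowhere Lipschitz semilocally simply connected: for every point $p\in M$ and every open neighborhood $U\subset M$ of $p$, the homomorphism $\pi_1^{\mathrm{Lip}}(U,p)\to\pi_1^{\mathrm{Lip}}(M,p)$ induced by the inclusion $U\hookrightarrow M$ is not the trivial map.
   Context: A contact 3-manifold $(M,\xi)$ is a smooth 3-manifold $M$ with a smooth rank-2 distribution $\xi\subset TM$ that is locally the kernel of a 1-form $\alpha$ with $\alpha\wedge d\alpha$ nowhere zero. Endowing it with a sub-Riemannian metric means fixing a smoothly varying inner product on the fibers of $\xi$ and equipping $M$ with the associated Carnot–Carathéodory distance, i.e. the distance between two points is the infimum of the lengths of piecewise smooth (equivalently, absolutely continuous) curves tangent to $\xi$ joining them (understood as $\infty$ for points in different components). All paths and loops are Lipschitz with domain $I=[0,1]$. $I\times I$ carries the $L^1$ metric. Two paths $\gamma,\gamma'$ in a metric space $M$ with the same initial points and the same end points are homotopic rel endpoints if there is a Lipschitz map $H:I\times I\to M$ with $H|_{I\times\{0\}}=\gamma$, $H|_{I\times\{1\}}=\gamma'$, $H|_{\{0\}\times I}\equiv\gamma(0)$, $H|_{\{1\}\times I}\equiv\gamma(1)$; $[\gamma]$ denotes the class of $\gamma$. The first Lipschitz homotopy group $\pi_1^{\mathrm{Lip}}(M,p)$ is the set of classes of loops based at $p$ with group operation given by concatenation. A based Lipschitz map $f$ induces the homomorphism $[\alpha]\mapsto[f\circ\alpha]$. A subset $U\subset M$ carries the restricted metric. A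 metric space $M$ is Lipschitz semilocally simply connected if every $p\in M$ has an open neighborhood $U$ such that the inclusion-induced map $\pi_1^{\mathrm{Lip}}(U,p)\to\pi_1^{\mathrm{Lip}}(M,p)$ is trivial. *)

theory Defs
  imports "HOL-Analysis.Analysis" "HOL-Algebra.Group"
begin

section \<open>Smooth manifolds\<close>

(* Derivatives are taken within S.  This is used only for S open, or S a relatively open subset of a
   nondegenerate compact interval (one-sided derivatives at the end points); there derivatives are
   unique, so the existentially quantified f' is the derivative of f on S. *)
primrec Ck_on :: "nat \<Rightarrow> 'a::real_normed_vector set \<Rightarrow> ('a \<Rightarrow> 'b::real_normed_vector) \<Rightarrow> bool" where
  "Ck_on 0 S f \<longleftrightarrow> continuous_on S f"
| "Ck_on (Suc k) S f \<longleftrightarrow>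
     (\<exists>f'. (\<forall>x\<in>S. (f has_derivative f' x) (at x within S)) \<and> (\<forall>v. Ck_on k S (\<lambda>x. f' x v)))"

definition smooth_on :: "'a::real_normed_vector set \<Rightarrow> ('a \<Rightarrow> 'b::real_normed_vector) \<Rightarrow> bool" where
  "smooth_on S f \<longleftrightarrow> (\<forall>k. Ck_on k S f)"

type_synonym 'a chart = "'a set \<times> ('a \<Rightarrow> real^3)"

abbreviation chart_inv :: "'a chart \<Rightarrow> real^3 \<Rightarrow> 'a" where
  "chart_inv c \<equiv> inv_into (fst c) (snd c)"

definition transition :: "'a chart \<Rightarrow> 'a chart \<Rightarrow> real^3 \<Rightarrow> real^3" where
  "transition c c' = snd c' \<circ> chart_inv c"

(* The manifold is the whole type 'a, with its Hausdorff second countable topology. *)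
definition smooth_atlas :: "'a::{t2_space,second_countable_topology} chart set \<Rightarrow> bool" where
  "smooth_atlas A \<longleftrightarrow>
     (\<Union>c\<in>A. fst c) = UNIV \<and>
     (\<forall>c\<in>A. open (fst c) \<and> open (snd c ` fst c) \<and>
        homeomorphism (fst c) (snd c ` fst c) (snd c) (chart_inv c)) \<and>
     (\<forall>c\<in>A. \<forall>c'\<in>A. smooth_on (snd c ` (fst c \<inter> fst c')) (transition c c'))"

definition charts_at :: "'a chart set \<Rightarrow> 'a \<Rightarrow> 'a chart set" where
  "charts_at A p = {c\<in>A. p \<in> fst c}"

(* A tangent vector at p is a family of coordinate vectors, one for each chart around p, transforming
   by the derivatives of the coordinate changes (and 0 at all other indices); the vector space
   operations are pointwise. *)
type_synonym 'a tvector = "'a chart \<Rightarrow> real^3"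

definition tangent_space :: "'a chart set \<Rightarrow> 'a \<Rightarrow> 'a tvector set" where
  "tangent_space A p =
     {v. (\<forall>c. c \<notin> charts_at A p \<longrightarrow> v c = 0) \<and>
         (\<forall>c\<in>charts_at A p. \<forall>c'\<in>charts_at A p.
            v c' = frechet_derivative (transition c c') (at (snd c p)) (v c))}"

definition lincomb :: "real \<Rightarrow> 'a tvector \<Rightarrow> real \<Rightarrow> 'a tvector \<Rightarrow> 'a tvector" where
  "lincomb a u b v = (\<lambda>c. a *\<^sub>R u c + b *\<^sub>R v c)"

(* for c in charts_at A p: the tangent vector at p with coordinate vector u in the chart c *)
definition tvec :: "'a chart set \<Rightarrow> 'a chart \<Rightarrow> 'a \<Rightarrow> real^3 \<Rightarrow> 'a tvector" where
  "tvec A c p u = (\<lambda>c'. if c' \<in> charts_at A p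
     then frechet_derivative (transition c c') (at (snd c p)) u else 0)"

definition smooth_fun :: "'a chart set \<Rightarrow> 'a set \<Rightarrow> ('a \<Rightarrow> real) \<Rightarrow> bool" where
  "smooth_fun A W f \<longleftrightarrow> (\<forall>c\<in>A. smooth_on (snd c ` (fst c \<inter> W)) (f \<circ> chart_inv c))"

definition smooth_vector_field :: "'a chart set \<Rightarrow> 'a set \<Rightarrow> ('a \<Rightarrow> 'a tvector) \<Rightarrow> bool" where
  "smooth_vector_field A W X \<longleftrightarrow>
     (\<forall>q\<in>W. X q \<in> tangent_space A q) \<and>
     (\<forall>c\<in>A. smooth_on (snd c ` (fst c \<inter> W)) (\<lambda>x. X (chart_inv c x) c))"


section \<open>Contact structures\<close>

(* coordinate expression of the 1-form \<alpha> in the chart c, evaluated at the point x on the vector u *)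
definition form_coord ::
    "'a chart set \<Rightarrow> 'a chart \<Rightarrow> ('a \<Rightarrow> 'a tvector \<Rightarrow> real) \<Rightarrow> real^3 \<Rightarrow> real^3 \<Rightarrow> real" where
  "form_coord A c \<alpha> x u = \<alpha> (chart_inv c x) (tvec A c (chart_inv c x) u)"

definition smooth_one_form ::
    "'a chart set \<Rightarrow> 'a set \<Rightarrow> ('a \<Rightarrow> 'a tvector \<Rightarrow> real) \<Rightarrow> bool" where
  "smooth_one_form A W \<alpha> \<longleftrightarrow>
     (\<forall>c\<in>A. (\<forall>x\<in>snd c ` (fst c \<inter> W). linear (form_coord A c \<alpha> x)) \<and>
            (\<forall>u. smooth_on (snd c ` (fst c \<inter> W)) (\<lambda>x. form_coord A c \<alpha> x u)))"

(* d\<alpha>(u,v) = u(\<alpha>(v)) - v(\<alpha>(u)) - \<alpha>([u,v]) for the commuting constant fields u, v of R^3 *)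
definition ext_deriv :: "(real^3 \<Rightarrow> real^3 \<Rightarrow> real) \<Rightarrow> real^3 \<Rightarrow> real^3 \<Rightarrow> real^3 \<Rightarrow> real" where
  "ext_deriv a x u v =
     frechet_derivative (\<lambda>y. a y v) (at x) u - frechet_derivative (\<lambda>y. a y u) (at x) v"

(* wedge product of a linear form with an alternating bilinear form *)
definition wedge :: "('b \<Rightarrow> real) \<Rightarrow> ('b \<Rightarrow> 'b \<Rightarrow> real) \<Rightarrow> 'b \<Rightarrow> 'b \<Rightarrow> 'b \<Rightarrow> real" where
  "wedge a b u v w = a u * b v w + a v * b w u + a w * b u v"

definition contact_form ::
    "'a chart set \<Rightarrow> 'a set \<Rightarrow> ('a \<Rightarrow> 'a tvector \<Rightarrow> real) \<Rightarrow> bool" where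
  "contact_form A W \<alpha> \<longleftrightarrow>
     smooth_one_form A W \<alpha> \<and>
     (\<forall>c\<in>A. \<forall>x\<in>snd c ` (fst c \<inter> W).
        \<exists>u v w. wedge (form_coord A c \<alpha> x) (ext_deriv (form_coord A c \<alpha>) x) u v w \<noteq> 0)"

definition smooth_rank2_distribution ::
    "'a::topological_space chart set \<Rightarrow> ('a \<Rightarrow> 'a tvector set) \<Rightarrow> bool" where
  "smooth_rank2_distribution A \<xi> \<longleftrightarrow>
     (\<forall>p. \<exists>W X Y. open W \<and> p \<in> W \<and> smooth_vector_field A W X \<and> smooth_vector_field A W Y \<and>
        (\<forall>q\<in>W. (\<forall>a b. lincomb a (X q) b (Y q) = (\<lambda>_. 0) \<longrightarrow> a = 0 \<and> b = 0) \<and>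
                \<xi> q = {lincomb a (X q) b (Y q) | a b. True}))"

definition contact_structure ::
    "'a::topological_space chart set \<Rightarrow> ('a \<Rightarrow> 'a tvector set) \<Rightarrow> bool" where
  "contact_structure A \<xi> \<longleftrightarrow>
     smooth_rank2_distribution A \<xi> \<and>
     (\<forall>p. \<exists>W \<alpha>. open W \<and> p \<in> W \<and> contact_form A W \<alpha> \<and>
        (\<forall>q\<in>W. \<xi> q = {v\<in>tangent_space A q. \<alpha> q v = 0}))"


section \<open>Sub-Riemannian metrics and the Carnot--Caratheodory distance\<close>

definition sub_riemannian_metric ::
    "'a::topological_space chart set \<Rightarrow> ('a \<Rightarrow> 'a tvector set)
      \<Rightarrow> ('a \<Rightarrow> 'a tvector \<Rightarrow> 'a tvector \<Rightarrow> real) \<Rightarrow> bool" where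
  "sub_riemannian_metric A \<xi> g \<longleftrightarrow>
     (\<forall>p. \<forall>u\<in>\<xi> p. \<forall>v\<in>\<xi> p. g p u v = g p v u) \<and>
     (\<forall>p. \<forall>u\<in>\<xi> p. \<forall>v\<in>\<xi> p. \<forall>w\<in>\<xi> p. \<forall>a b.
        g p (lincomb a u b v) w = a * g p u w + b * g p v w) \<and>
     (\<forall>p. \<forall>u\<in>\<xi> p. u \<noteq> (\<lambda>_. 0) \<longrightarrow> g p u u > 0) \<and>
     (\<forall>W X Y. open W \<and> smooth_vector_field A W X \<and> smooth_vector_field A W Y \<and>
        (\<forall>q\<in>W. X q \<in> \<xi> q \<and> Y q \<in> \<xi> q) \<longrightarrow> smooth_fun A W (\<lambda>q. g q (X q) (Y q)))"

definition smooth_curve ::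
    "'a::topological_space chart set \<Rightarrow> real set \<Rightarrow> (real \<Rightarrow> 'a) \<Rightarrow> bool" where
  "smooth_curve A J \<gamma> \<longleftrightarrow>
     continuous_on J \<gamma> \<and> (\<forall>c\<in>A. smooth_on (J \<inter> \<gamma> -` fst c) (snd c \<circ> \<gamma>))"

definition velocity :: "'a chart set \<Rightarrow> real set \<Rightarrow> (real \<Rightarrow> 'a) \<Rightarrow> real \<Rightarrow> 'a tvector" where
  "velocity A J \<gamma> t =
     (\<lambda>c. if c \<in> charts_at A (\<gamma> t) then vector_derivative (snd c \<circ> \<gamma>) (at t within J) else 0)"

(* piecewise smooth curves on [0,1] tangent to \<xi> *)
definition horizontal_curve ::
    "'a::topological_space chart set \<Rightarrow> ('a \<Rightarrow> 'a tvector set) \<Rightarrow> (real \<Rightarrow> 'a) \<Rightarrow> bool" where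
  "horizontal_curve A \<xi> \<gamma> \<longleftrightarrow>
     (\<exists>n \<tau>. \<tau> 0 = 0 \<and> \<tau> n = 1 \<and>
        (\<forall>i<n. \<tau> i < \<tau> (Suc i) \<and>
           smooth_curve A {\<tau> i..\<tau> (Suc i)} \<gamma> \<and>
           (\<forall>t\<in>{\<tau> i..\<tau> (Suc i)}. velocity A {\<tau> i..\<tau> (Suc i)} \<gamma> t \<in> \<xi> (\<gamma> t))))"

(* For a piecewise smooth curve the integrand is undetermined only at the finitely many break
   points. *)
definition curve_length ::
    "'a chart set \<Rightarrow> ('a \<Rightarrow> 'a tvector \<Rightarrow> 'a tvector \<Rightarrow> real) \<Rightarrow> (real \<Rightarrow> 'a) \<Rightarrow> real" where
  "curve_length A g \<gamma> =
     integral {0..1} (\<lambda>t. sqrt (g (\<gamma> t) (velocity A {0..1} \<gamma> t) (velocity A {0..1} \<gamma> t)))"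

definition cc_dist ::
    "'a::topological_space chart set \<Rightarrow> ('a \<Rightarrow> 'a tvector set)
      \<Rightarrow> ('a \<Rightarrow> 'a tvector \<Rightarrow> 'a tvector \<Rightarrow> real) \<Rightarrow> 'a \<Rightarrow> 'a \<Rightarrow> ennreal" where
  "cc_dist A \<xi> g p q =
     (INF \<gamma>\<in>{\<gamma>. horizontal_curve A \<xi> \<gamma> \<and> \<gamma> 0 = p \<and> \<gamma> 1 = q}. ennreal (curve_length A g \<gamma>))"


section \<open>The first Lipschitz homotopy group\<close>

(* Metrics are given by distance functions with values in [0,\<infinity>]; a subset S of a metric space
   carries the restriction of the same function d. *)
definition lipschitz_map ::
    "'b set \<Rightarrow> ('b \<Rightarrow> 'b \<Rightarrow> ennreal) \<Rightarrow> 'a set \<Rightarrow> ('a \<Rightarrow> 'a \<Rightarrow> ennreal) \<Rightarrow> ('b \<Rightarrow> 'a) \<Rightarrow> bool" where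
  "lipschitz_map X dX S d f \<longleftrightarrow>
     f ` X \<subseteq> S \<and> (\<exists>L::real\<ge>0. \<forall>x\<in>X. \<forall>y\<in>X. d (f x) (f y) \<le> ennreal L * dX x y)"

definition lip_path :: "('a \<Rightarrow> 'a \<Rightarrow> ennreal) \<Rightarrow> 'a set \<Rightarrow> (real \<Rightarrow> 'a) \<Rightarrow> bool" where
  "lip_path d S \<gamma> \<longleftrightarrow> lipschitz_map {0..1} (\<lambda>s t. ennreal \<bar>s - t\<bar>) S d \<gamma>"

definition lip_loop :: "('a \<Rightarrow> 'a \<Rightarrow> ennreal) \<Rightarrow> 'a set \<Rightarrow> 'a \<Rightarrow> (real \<Rightarrow> 'a) \<Rightarrow> bool" where
  "lip_loop d S p \<gamma> \<longleftrightarrow> lip_path d S \<gamma> \<and> \<gamma> 0 = p \<and> \<gamma> 1 = p"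

definition l1_dist :: "real \<times> real \<Rightarrow> real \<times> real \<Rightarrow> ennreal" where
  "l1_dist x y = ennreal (\<bar>fst x - fst y\<bar> + \<bar>snd x - snd y\<bar>)"

(* The conditions force both paths to be Lipschitz in S and to have the same end points. *)
definition lip_homotopic ::
    "('a \<Rightarrow> 'a \<Rightarrow> ennreal) \<Rightarrow> 'a set \<Rightarrow> (real \<Rightarrow> 'a) \<Rightarrow> (real \<Rightarrow> 'a) \<Rightarrow> bool" where
  "lip_homotopic d S \<gamma> \<gamma>' \<longleftrightarrow>
     (\<exists>H. lipschitz_map ({0..1} \<times> {0..1}) l1_dist S d H \<and>
        (\<forall>s\<in>{0..1}. H (s, 0) = \<gamma> s \<and> H (s, 1) = \<gamma>' s) \<and>
        (\<forall>t\<in>{0..1}. H (0, t) = \<gamma> 0 \<and> H (1, t) = \<gamma> 1))"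

(* Paths are functions on the reals of which only the restriction to [0,1] matters. *)
definition lip_class :: "('a \<Rightarrow> 'a \<Rightarrow> ennreal) \<Rightarrow> 'a set \<Rightarrow> (real \<Rightarrow> 'a) \<Rightarrow> (real \<Rightarrow> 'a) set" where
  "lip_class d S \<gamma> = {\<gamma>'. lip_homotopic d S \<gamma> \<gamma>'}"

definition lip_pi1 ::
    "('a::topological_space \<Rightarrow> 'a \<Rightarrow> ennreal) \<Rightarrow> 'a set \<Rightarrow> 'a \<Rightarrow> (real \<Rightarrow> 'a) set monoid" where
  "lip_pi1 d S p =
     \<lparr>carrier = {lip_class d S \<gamma> | \<gamma>. lip_loop d S p \<gamma>},
      mult = (\<lambda>a b. \<Union>\<alpha>\<in>a. \<Union>\<beta>\<in>b. lip_class d S (\<alpha> +++ \<beta>)),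
      one = lip_class d S (\<lambda>_. p)\<rparr>"

(* the map [\<alpha>] \<mapsto> [f \<circ> \<alpha>] into the group of the space S with distance d *)
definition lip_pi1_map ::
    "('b \<Rightarrow> 'b \<Rightarrow> ennreal) \<Rightarrow> 'b set \<Rightarrow> ('a \<Rightarrow> 'b) \<Rightarrow> (real \<Rightarrow> 'a) set \<Rightarrow> (real \<Rightarrow> 'b) set" where
  "lip_pi1_map d S f a = (\<Union>\<alpha>\<in>a. lip_class d S (f \<circ> \<alpha>))"

definition trivial_map :: "('c, 'm) monoid_scheme \<Rightarrow> ('d, 'n) monoid_scheme \<Rightarrow> ('c \<Rightarrow> 'd) \<Rightarrow> bool" where
  "trivial_map G H h \<longleftrightarrow> (\<forall>x\<in>carrier G. h x = \<one>\<^bsub>H\<^esub>)"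

end

theory Submission
  imports Defs
begin

text \<open>A loop is shown to be essential by integrating a 1-form over it.  Near p choose coordinates (x, y, z) in
which \<xi> is the kernel of dz - P dx - Q dy, with horizontal frame X = d/dx + P d/dz and
Y = d/dy + Q d/dz; the contact condition says that D = XQ - YP does not vanish.  Let h be a function
supported in the chart.  Horizontal curves do not see the contact form, so that on them h dx may be
replaced by the Rumin form h dx - f (dz - P dx - Q dy) with f = Yh / D, where f is chosen to make the
exterior derivative vanish on \<xi>.

Two points at Carnot--Caratheodory distance \<epsilon> differ by a horizontal vector of length O(\<epsilon>), up to an
error O(\<epsilon>^2) (cc_dist_horizontally_close).  Therefore the integral of the Rumin form over the boundary of
a triangle of size \<epsilon> is O(\<epsilon>^3), one order better than the area of the triangle (rumin_edge_triangle).  A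
Lipschitz null homotopy of a loop, sampled on a grid of mesh 1/n, consists of 2n^2 such triangles of size
O(1/n).  The interior edges cancel, so that the sum of the form over the n edges of the loop is O(1/n)
(lipschitz_nullhomotopy_edge_sum), and the integral over the loop is 0.  Only the values of the homotopy at
grid points enter: the form is replaced throughout by its trapezoidal values on pairs of points, and no
derivative of the homotopy is taken.  The support of h makes the form vanish on the triangles outside the
chart, so the homotopy may wander through all of M.

It remains to find, arbitrarily close to p, a horizontal loop with a nonzero integral.  Lift the planar closed
curves r (t - t^3, l (1 - t^2) + t^3 - t^5) to solutions of z' = P x' + Q y'.  The height that such a lift gains
is a nonzero multiple of r^2 l plus O(r^3), because the planar curve encloses an area proportional to l.
It changes sign for l in [-1, 1], so that some l closes the lift (closed_contact_loop_exists).  The integral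
of x y dx is r^3 times a nonzero constant that does not depend on l (loop_moment_total), and h = x y near p.\<close>

section \<open>Calculus of C^k maps\<close>

lemma lipschitz_on_real_bound:
  fixes f :: "'v::real_normed_vector \<Rightarrow> real"
  assumes "C-lipschitz_on B f" "v \<in> B" "w \<in> B"
  shows "\<bar>f w - f v\<bar> \<le> C * norm (w - v)"
  using lipschitz_onD[OF assms(1,3,2)] by (simp add: dist_real_def dist_norm)

lemma Ck_on_cong:
  assumes "Ck_on k S f" "\<And>x. x \<in> S \<Longrightarrow> f x = g x"
  shows "Ck_on k S g"
proof (cases k)
  case 0
  then show ?thesis using assms continuous_on_cong by (metis Ck_on.simps(1))
next
  case (Suc j)
  then obtain f' where "\<And>x. x \<in> S \<Longrightarrow> (f has_derivative f' x) (at x within S)" "\<And>v. Ck_on j S (\<lambda>x. f' x v)"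
    using assms(1) by auto
  moreover then have "(g has_derivative f' x) (at x within S)" if "x \<in> S" for x
    using has_derivative_transform[of x S g f "f' x"] assms(2) that by auto
  ultimately show ?thesis using Suc by auto
qed

lemma Ck_on_SucD: "Ck_on (Suc k) S f \<Longrightarrow> Ck_on k S f"
proof (induction k arbitrary: f)
  case 0
  then show ?case
    by (auto simp: continuous_on_eq_continuous_within intro: has_derivative_continuous)
next
  case (Suc k)
  then obtain f' where f': "\<And>x. x \<in> S \<Longrightarrow> (f has_derivative f' x) (at x within S)" "\<And>v. Ck_on (Suc k) S (\<lambda>x. f' x v)"
    unfolding Ck_on.simps(2)[of "Suc k"] by auto
  show ?case unfolding Ck_on.simps(2)[of k]
  proof (intro exI[of _ f'] conjI ballI allI)
    show "(f has_derivative f' x) (at x within S)" if "x \<in> S" for x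
      using f' that by blast
    show "Ck_on k S (\<lambda>x. f' x v)" for v
      by (rule Suc.IH) (rule f')
  qed
qed

lemma Ck_on_continuous: "Ck_on k S f \<Longrightarrow> continuous_on S f"
  by (induction k) (use Ck_on_SucD in auto)

lemma Ck_on_subset: "Ck_on k S f \<Longrightarrow> T \<subseteq> S \<Longrightarrow> Ck_on k T f"
proof (induction k arbitrary: f)
  case 0
  then show ?case using continuous_on_subset by auto
next
  case (Suc k)
  then obtain f' where "\<And>x. x \<in> S \<Longrightarrow> (f has_derivative f' x) (at x within S)" "\<And>v. Ck_on k S (\<lambda>x. f' x v)"
    by auto
  then show ?case using Suc has_derivative_subset by (simp, blast)
qed

lemma Ck_on_const: "Ck_on k S (\<lambda>_. c)"
proof (induction k arbitrary: c)
  case (Suc k)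
  then show ?case by (auto intro!: exI[of _ "\<lambda>_ _. 0"])
qed auto

lemma Ck_on_bounded_linear: 
  assumes "bounded_linear L" shows "Ck_on k S L"
proof (cases k)
  case 0
  then show ?thesis using assms linear_continuous_on by auto
next
  case (Suc j)
  then show ?thesis using assms bounded_linear_imp_has_derivative Ck_on_const
    by (auto intro!: exI[of _ "\<lambda>_. L"])
qed

lemma Ck_on_bounded_linear_compose:
  assumes L: "bounded_linear L" shows "Ck_on k S f \<Longrightarrow> Ck_on k S (\<lambda>x. L (f x))"
proof (induction k arbitrary: f)
  case 0
  then show ?case using bounded_linear.continuous_on[OF L] by auto
next
  case (Suc k)
  then obtain f' where f': "\<And>x. x \<in> S \<Longrightarrow> (f has_derivative f' x) (at x within S)" "\<And>v. Ck_on k S (\<lambda>x. f' x v)"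
    by auto
  show ?case unfolding Ck_on.simps
    using bounded_linear.has_derivative[OF L f'(1)] Suc.IH[OF f'(2)]
    by (intro exI[of _ "\<lambda>x v. L (f' x v)"]) auto
qed

lemma Ck_on_add: "Ck_on k S f \<Longrightarrow> Ck_on k S g \<Longrightarrow> Ck_on k S (\<lambda>x. f x + g x)"
proof (induction k arbitrary: f g)
  case 0
  then show ?case by (auto intro: continuous_on_add)
next
  case (Suc k)
  obtain f' where f': "\<And>x. x \<in> S \<Longrightarrow> (f has_derivative f' x) (at x within S)" "\<And>v. Ck_on k S (\<lambda>x. f' x v)"
    using Suc.prems(1) by auto
  obtain g' where g': "\<And>x. x \<in> S \<Longrightarrow> (g has_derivative g' x) (at x within S)" "\<And>v. Ck_on k S (\<lambda>x. g' x v)"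
    using Suc.prems(2) by auto
  show ?case unfolding Ck_on.simps
    using has_derivative_add[OF f'(1) g'(1)] Suc.IH[OF f'(2) g'(2)]
    by (intro exI[of _ "\<lambda>x v. f' x v + g' x v"]) auto
qed

lemma Ck_on_sum: "(\<And>i. i \<in> I \<Longrightarrow> Ck_on k S (f i)) \<Longrightarrow> Ck_on k S (\<lambda>x. \<Sum>i\<in>I. f i x)"
  by (induction I rule: infinite_finite_induct) (auto intro: Ck_on_const Ck_on_add)

lemma Ck_on_uminus: "Ck_on k S f \<Longrightarrow> Ck_on k S (\<lambda>x. - f x)"
  by (rule Ck_on_bounded_linear_compose) (auto intro: bounded_linear_minus bounded_linear_ident)

lemma Ck_on_diff: "Ck_on k S f \<Longrightarrow> Ck_on k S g \<Longrightarrow> Ck_on k S (\<lambda>x. f x - g x)"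
  using Ck_on_add[OF _ Ck_on_uminus] by fastforce

lemma Ck_on_scaleR:
  "Ck_on k S f \<Longrightarrow> Ck_on k S g \<Longrightarrow> Ck_on k S (\<lambda>x. f x *\<^sub>R g x)"
proof (induction k arbitrary: f g)
  case 0
  then show ?case by (auto intro: continuous_on_scaleR)
next
  case (Suc k)
  obtain f' where f': "\<And>x. x \<in> S \<Longrightarrow> (f has_derivative f' x) (at x within S)" "\<And>v. Ck_on k S (\<lambda>x. f' x v)"
    using Suc.prems(1) by auto
  obtain g' where g': "\<And>x. x \<in> S \<Longrightarrow> (g has_derivative g' x) (at x within S)" "\<And>v. Ck_on k S (\<lambda>x. g' x v)"
    using Suc.prems(2) by auto
  show ?case unfolding Ck_on.simps
    using has_derivative_scaleR[OF f'(1) g'(1)] 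
      Ck_on_add[OF Suc.IH[OF Ck_on_SucD[OF Suc.prems(1)] g'(2)] Suc.IH[OF f'(2) Ck_on_SucD[OF Suc.prems(2)]]]
    by (intro exI[of _ "\<lambda>x v. f x *\<^sub>R g' x v + f' x v *\<^sub>R g x"]) auto
qed

lemma Ck_on_mult: "Ck_on k S f \<Longrightarrow> Ck_on k S g \<Longrightarrow> Ck_on k S (\<lambda>x. f x * (g x::real))"
  using Ck_on_scaleR[of k S f g] by simp

lemma Ck_on_inverse:
  assumes nz: "\<And>x. x \<in> S \<Longrightarrow> f x \<noteq> 0"
  shows "Ck_on k S f \<Longrightarrow> Ck_on k S (\<lambda>x. 1 / (f x :: real))"
proof (induction k)
  case 0
  then show ?case using nz by (auto intro!: continuous_on_divide continuous_on_const)
next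
  case (Suc k)
  obtain f' where f': "\<And>x. x \<in> S \<Longrightarrow> (f has_derivative f' x) (at x within S)" "\<And>v. Ck_on k S (\<lambda>x. f' x v)"
    using Suc.prems(1) by auto
  have IH: "Ck_on k S (\<lambda>x. 1 / f x)"
    using Suc.IH Ck_on_SucD[OF Suc.prems] by auto
  show ?case unfolding Ck_on.simps
  proof (intro exI[of _ "\<lambda>x v. - (f' x v * ((1 / f x) * (1 / f x)))"] conjI ballI allI)
    show "((\<lambda>x. 1 / f x) has_derivative (\<lambda>v. - (f' x v * (1 / f x * (1 / f x))))) (at x within S)" if "x \<in> S" for x
    proof -
      have "- (inverse (f x) * f' x v * inverse (f x)) = - (f' x v * (1 / f x * (1 / f x)))" for v
        by (simp add: divide_inverse)
      then show ?thesis
        using Deriv.has_derivative_inverse[OF nz[OF that] f'(1)[OF that]] by (simp add: inverse_eq_divide)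
    qed
    show "Ck_on k S (\<lambda>x. - (f' x v * (1 / f x * (1 / f x))))" for v
      by (intro Ck_on_uminus Ck_on_mult f'(2) IH)
  qed
qed

text \<open>A basis of the middle space turns the chain rule into a finite sum of products of functions whose
regularity is known by induction.\<close>

lemma Ck_on_compose:
  fixes X :: "'a::real_normed_vector \<Rightarrow> 'b::euclidean_space"
  assumes "X ` S \<subseteq> T"
  shows "Ck_on k S X \<Longrightarrow> Ck_on k T F \<Longrightarrow> Ck_on k S (\<lambda>x. F (X x))"
proof (induction k arbitrary: F)
  case 0
  then show ?case using assms continuous_on_compose2 by auto
next
  case (Suc k)
  obtain X' where X': "\<And>x. x \<in> S \<Longrightarrow> (X has_derivative X' x) (at x within S)" "\<And>v. Ck_on k S (\<lambda>x. X' x v)"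
    using Suc.prems(1) by auto
  obtain F' where F': "\<And>x. x \<in> T \<Longrightarrow> (F has_derivative F' x) (at x within T)" "\<And>v. Ck_on k T (\<lambda>x. F' x v)"
    using Suc.prems(2) by auto
  let ?D = "\<lambda>x v. \<Sum>b\<in>Basis. (X' x v \<bullet> b) *\<^sub>R F' (X x) b"
  show ?case unfolding Ck_on.simps
  proof (intro exI[of _ ?D] conjI ballI allI)
    fix x assume x: "x \<in> S"
    have XT: "X x \<in> T" using assms x by auto
    have lin: "linear (F' (X x))"
      using F'(1)[OF XT] has_derivative_linear by blast
    have D: "?D x v = F' (X x) (X' x v)" for v
      by (subst (2) euclidean_representation[of "X' x v", symmetric])
        (simp add: linear_sum[OF lin] linear_cmul[OF lin])
    have "((\<lambda>x. F (X x)) has_derivative (\<lambda>v. F' (X x) (X' x v))) (at x within S)"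
      using has_derivative_in_compose2[OF F'(1) assms x X'(1)[OF x]] by auto
    then show "((\<lambda>x. F (X x)) has_derivative ?D x) (at x within S)"
      by (simp only: D)
  next
    fix v
    show "Ck_on k S (\<lambda>x. ?D x v)"
    proof (intro Ck_on_sum Ck_on_scaleR)
      show "Ck_on k S (\<lambda>x. X' x v \<bullet> b)" for b
        using Ck_on_bounded_linear_compose[OF bounded_linear_inner_left X'(2)] .
      show "Ck_on k S (\<lambda>x. F' (X x) b)" for b
        using Suc.IH[OF Ck_on_SucD[OF Suc.prems(1)] F'(2)] .
    qed
  qed
qed

lemma Ck_on_open_derivative:
  assumes "Ck_on (Suc k) S f" "open S"
  shows "x \<in> S \<Longrightarrow> (f has_derivative frechet_derivative f (at x)) (at x)"
    and "Ck_on k S (\<lambda>x. frechet_derivative f (at x) v)"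
proof -
  obtain f' where f': "\<And>x. x \<in> S \<Longrightarrow> (f has_derivative f' x) (at x within S)" "\<And>v. Ck_on k S (\<lambda>x. f' x v)"
    using assms by auto
  have d: "(f has_derivative f' x) (at x)" if "x \<in> S" for x
    using f'(1)[OF that] at_within_open[OF that \<open>open S\<close>] by simp
  then have e: "f' x = frechet_derivative f (at x)" if "x \<in> S" for x
    using frechet_derivative_at that by blast
  show "x \<in> S \<Longrightarrow> (f has_derivative frechet_derivative f (at x)) (at x)"
    using d e by auto
  show "Ck_on k S (\<lambda>x. frechet_derivative f (at x) v)"
    by (rule Ck_on_cong[OF f'(2)[of v]]) (simp add: e)
qed

lemma Ck_on_Suc_vector_derivative:
  fixes f :: "real \<Rightarrow> 'a::real_normed_vector"
  assumes "\<And>t. t \<in> J \<Longrightarrow> (f has_vector_derivative f' t) (at t within J)" "Ck_on k J f'"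
  shows "Ck_on (Suc k) J f"
  unfolding Ck_on.simps
proof (intro exI[of _ "\<lambda>t v. v *\<^sub>R f' t"] conjI ballI allI)
  show "(f has_derivative (\<lambda>v. v *\<^sub>R f' t)) (at t within J)" if "t \<in> J" for t
    using assms(1)[OF that] by (simp add: has_vector_derivative_def)
  show "Ck_on k J (\<lambda>t. v *\<^sub>R f' t)" for v
    by (intro Ck_on_scaleR Ck_on_const assms(2))
qed

lemma smooth_onD: "smooth_on S f \<Longrightarrow> Ck_on k S f"
  by (simp add: smooth_on_def)

lemma smooth_on_imp_continuous: "smooth_on S f \<Longrightarrow> continuous_on S f"
  using Ck_on_continuous smooth_onD by blast

text \<open>Bootstrapping: if the derivative of z is as regular as z itself, then z gains derivatives without end.\<close>

lemma smooth_on_vector_ode: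
  fixes z :: "real \<Rightarrow> 'a::real_normed_vector"
  assumes "\<And>t. t \<in> J \<Longrightarrow> (z has_vector_derivative G t) (at t within J)"
    and "\<And>k. Ck_on k J z \<Longrightarrow> Ck_on k J G"
  shows "smooth_on J z"
  unfolding smooth_on_def
proof
  fix k show "Ck_on k J z"
  proof (induction k)
    case 0
    then show ?case
      using has_vector_derivative_continuous[OF assms(1)] by (simp add: continuous_on_eq_continuous_within)
  next
    case (Suc k)
    then show ?case using Ck_on_Suc_vector_derivative[OF assms(1) assms(2)] by blast
  qed
qed

lemma Ck_on_power: "Ck_on k S f \<Longrightarrow> Ck_on k S (\<lambda>x. (f x :: real) ^ n)"
  by (induction n) (simp_all add: Ck_on_const Ck_on_mult)

section \<open>Horizontal first-order expansions\<close>

text \<open>Boundedness is included because it makes the class closed under products.\<close>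

definition bounded_lipschitz_on :: "'v::real_normed_vector set \<Rightarrow> ('v \<Rightarrow> real) \<Rightarrow> bool" where
  "bounded_lipschitz_on B g \<longleftrightarrow>
     (\<exists>C\<ge>0. \<forall>v\<in>B. \<bar>g v\<bar> \<le> C \<and> (\<forall>w\<in>B. \<bar>g w - g v\<bar> \<le> C * norm (w - v)))"

lemma bounded_lipschitz_onI:
  assumes "\<And>v. v \<in> B \<Longrightarrow> \<bar>g v\<bar> \<le> C"
    and "\<And>v w. v \<in> B \<Longrightarrow> w \<in> B \<Longrightarrow> \<bar>g w - g v\<bar> \<le> D * norm (w - v)"
  shows "bounded_lipschitz_on B g"
proof -
  let ?M = "max (max C D) 0"
  have "\<bar>g w - g v\<bar> \<le> ?M * norm (w - v)" if "v \<in> B" "w \<in> B" for v w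
    by (rule order_trans[OF assms(2)[OF that]]) (intro mult_right_mono, auto)
  moreover have "\<bar>g v\<bar> \<le> ?M" if "v \<in> B" for v
    using assms(1)[OF that] by simp
  ultimately show ?thesis
    unfolding bounded_lipschitz_on_def by (intro exI[of _ ?M]) auto
qed

lemma bounded_lipschitz_onE:
  assumes "bounded_lipschitz_on B g"
  obtains C where "C \<ge> 0" "\<And>v. v \<in> B \<Longrightarrow> \<bar>g v\<bar> \<le> C"
    "\<And>v w. v \<in> B \<Longrightarrow> w \<in> B \<Longrightarrow> \<bar>g w - g v\<bar> \<le> C * norm (w - v)"
  using assms unfolding bounded_lipschitz_on_def by blast

lemma bounded_lipschitz_on_const: "bounded_lipschitz_on B (\<lambda>_. c)"
  by (rule bounded_lipschitz_onI[where C = "\<bar>c\<bar>" and D = 0]) auto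

lemma bounded_lipschitz_on_add:
  assumes "bounded_lipschitz_on B g" "bounded_lipschitz_on B h"
  shows "bounded_lipschitz_on B (\<lambda>v. g v + h v)"
proof -
  obtain C where C: "C \<ge> 0" "\<And>v. v \<in> B \<Longrightarrow> \<bar>g v\<bar> \<le> C"
    "\<And>v w. v \<in> B \<Longrightarrow> w \<in> B \<Longrightarrow> \<bar>g w - g v\<bar> \<le> C * norm (w - v)"
    using assms(1) by (rule bounded_lipschitz_onE) blast
  obtain D where D: "D \<ge> 0" "\<And>v. v \<in> B \<Longrightarrow> \<bar>h v\<bar> \<le> D"
    "\<And>v w. v \<in> B \<Longrightarrow> w \<in> B \<Longrightarrow> \<bar>h w - h v\<bar> \<le> D * norm (w - v)"
    using assms(2) by (rule bounded_lipschitz_onE) blast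
  show ?thesis
  proof (rule bounded_lipschitz_onI[where C = "C + D" and D = "C + D"])
    show "\<bar>g v + h v\<bar> \<le> C + D" if "v \<in> B" for v
      using C(2)[OF that] D(2)[OF that] by linarith
    show "\<bar>(g w + h w) - (g v + h v)\<bar> \<le> (C + D) * norm (w - v)" if "v \<in> B" "w \<in> B" for v w
      using C(3)[OF that] D(3)[OF that] by (simp add: distrib_right)
  qed
qed

lemma bounded_lipschitz_on_mult:
  assumes "bounded_lipschitz_on B g" "bounded_lipschitz_on B h"
  shows "bounded_lipschitz_on B (\<lambda>v. g v * h v)"
proof -
  obtain C where C: "C \<ge> 0" "\<And>v. v \<in> B \<Longrightarrow> \<bar>g v\<bar> \<le> C"
    "\<And>v w. v \<in> B \<Longrightarrow> w \<in> B \<Longrightarrow> \<bar>g w - g v\<bar> \<le> C * norm (w - v)"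
    using assms(1) by (rule bounded_lipschitz_onE) blast
  obtain D where D: "D \<ge> 0" "\<And>v. v \<in> B \<Longrightarrow> \<bar>h v\<bar> \<le> D"
    "\<And>v w. v \<in> B \<Longrightarrow> w \<in> B \<Longrightarrow> \<bar>h w - h v\<bar> \<le> D * norm (w - v)"
    using assms(2) by (rule bounded_lipschitz_onE) blast
  show ?thesis
  proof (rule bounded_lipschitz_onI[where C = "C * D" and D = "2 * C * D"])
    show "\<bar>g v * h v\<bar> \<le> C * D" if "v \<in> B" for v
      using C D that by (simp add: abs_mult mult_mono)
    show "\<bar>g w * h w - g v * h v\<bar> \<le> 2 * C * D * norm (w - v)" if "v \<in> B" "w \<in> B" for v w
    proof -
      have "g w * h w - g v * h v = (g w - g v) * h w + g v * (h w - h v)"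
        by (simp add: algebra_simps)
      also have "\<bar>\<dots>\<bar> \<le> \<bar>g w - g v\<bar> * \<bar>h w\<bar> + \<bar>g v\<bar> * \<bar>h w - h v\<bar>"
        by (metis abs_mult abs_triangle_ineq)
      also have "\<dots> \<le> (C * norm (w - v)) * D + C * (D * norm (w - v))"
        using C D that by (intro add_mono mult_mono) auto
      finally show ?thesis by (simp add: algebra_simps)
    qed
  qed
qed

lemma bounded_lipschitz_on_uminus:
  "bounded_lipschitz_on B g \<Longrightarrow> bounded_lipschitz_on B (\<lambda>v. - g v)"
  using bounded_lipschitz_on_mult[OF bounded_lipschitz_on_const[of B "-1"]] by simp

lemma bounded_lipschitz_on_diff:
  assumes "bounded_lipschitz_on B g" "bounded_lipschitz_on B h"
  shows "bounded_lipschitz_on B (\<lambda>v. g v - h v)"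
  using bounded_lipschitz_on_add[OF assms(1) bounded_lipschitz_on_uminus[OF assms(2)]] by simp

lemma bounded_lipschitz_on_max0:
  assumes "bounded_lipschitz_on B g"
  shows "bounded_lipschitz_on B (\<lambda>v. max 0 (g v))"
proof -
  obtain C where C: "C \<ge> 0" "\<And>v. v \<in> B \<Longrightarrow> \<bar>g v\<bar> \<le> C"
    "\<And>v w. v \<in> B \<Longrightarrow> w \<in> B \<Longrightarrow> \<bar>g w - g v\<bar> \<le> C * norm (w - v)"
    using assms(1) by (rule bounded_lipschitz_onE) blast
  show ?thesis
  proof (rule bounded_lipschitz_onI[where C = C and D = C])
    show "\<bar>max 0 (g v)\<bar> \<le> C" if "v \<in> B" for v
      using C(2)[OF that] by linarith
    show "\<bar>max 0 (g w) - max 0 (g v)\<bar> \<le> C * norm (w - v)" if "v \<in> B" "w \<in> B" for v w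
      using C(3)[OF that] by linarith
  qed
qed

lemma bounded_lipschitz_on_inverse:
  assumes "bounded_lipschitz_on B g" and "c > 0" and c: "\<And>v. v \<in> B \<Longrightarrow> c \<le> \<bar>g v\<bar>"
  shows "bounded_lipschitz_on B (\<lambda>v. 1 / g v)"
proof -
  obtain C where C: "C \<ge> 0" "\<And>v. v \<in> B \<Longrightarrow> \<bar>g v\<bar> \<le> C"
    "\<And>v w. v \<in> B \<Longrightarrow> w \<in> B \<Longrightarrow> \<bar>g w - g v\<bar> \<le> C * norm (w - v)"
    using assms(1) by (rule bounded_lipschitz_onE) blast
  show ?thesis
  proof (rule bounded_lipschitz_onI[where C = "1 / c" and D = "C / (c * c)"])
    show "\<bar>1 / g v\<bar> \<le> 1 / c" if "v \<in> B" for v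
      using c[OF that] \<open>c > 0\<close> by (simp add: frac_le)
    show "\<bar>1 / g w - 1 / g v\<bar> \<le> C / (c * c) * norm (w - v)" if "v \<in> B" "w \<in> B" for v w
    proof -
      have nz: "g v \<noteq> 0" "g w \<noteq> 0"
        using c[OF that(1)] c[OF that(2)] \<open>c > 0\<close> by auto
      have "1 / g w - 1 / g v = - (g w - g v) / (g w * g v)"
        using nz by (simp add: field_simps)
      then have "\<bar>1 / g w - 1 / g v\<bar> = \<bar>g w - g v\<bar> / (\<bar>g w\<bar> * \<bar>g v\<bar>)"
        by (simp only: abs_divide abs_mult abs_minus_cancel)
      also have "\<dots> \<le> (C * norm (w - v)) / (c * c)"
        using C(3)[OF that] c that \<open>c > 0\<close> by (intro frac_le mult_mono) auto
      finally show ?thesis by simp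
    qed
  qed
qed

text \<open>The box estimate for points at small Carnot--Caratheodory distance: the displacement from v to w has size
\<epsilon>, but its component transversal to the plane dz = P dx + Q dy at v has size \<epsilon>^2.\<close>

definition horizontally_close :: "(real^3 \<Rightarrow> real) \<Rightarrow> (real^3 \<Rightarrow> real) \<Rightarrow> real \<Rightarrow> real^3 \<Rightarrow> real^3 \<Rightarrow> bool" where
  "horizontally_close P Q \<epsilon> v w \<longleftrightarrow>
     norm (w - v) \<le> \<epsilon> \<and> \<bar>w$3 - v$3 - P v * (w$1 - v$1) - Q v * (w$2 - v$2)\<bar> \<le> \<epsilon>\<^sup>2"

text \<open>Here gX and gY are the derivatives of g along X = d/dx + P d/dz and Y = d/dy + Q d/dz.  Between horizontally
close points the derivative of g in the z-direction contributes only to the error.\<close>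

definition horizontal_jet ::
    "(real^3 \<Rightarrow> real) \<Rightarrow> (real^3 \<Rightarrow> real) \<Rightarrow> (real^3) set \<Rightarrow> (real^3 \<Rightarrow> real) \<Rightarrow> (real^3 \<Rightarrow> real) \<Rightarrow> (real^3 \<Rightarrow> real) \<Rightarrow> bool"
  where
  "horizontal_jet P Q B g gX gY \<longleftrightarrow>
     bounded_lipschitz_on B g \<and> bounded_lipschitz_on B gX \<and> bounded_lipschitz_on B gY \<and>
     (\<exists>C\<ge>0. \<forall>v\<in>B. \<forall>w\<in>B. \<forall>\<epsilon>. 0 < \<epsilon> \<longrightarrow> \<epsilon> \<le> 1 \<longrightarrow> horizontally_close P Q \<epsilon> v w \<longrightarrow>
        \<bar>g w - g v - gX v * (w$1 - v$1) - gY v * (w$2 - v$2)\<bar> \<le> C * \<epsilon>\<^sup>2)"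

lemma horizontal_jetI:
  assumes "bounded_lipschitz_on B g" "bounded_lipschitz_on B gX" "bounded_lipschitz_on B gY" "C \<ge> 0"
    and "\<And>v w \<epsilon>. v \<in> B \<Longrightarrow> w \<in> B \<Longrightarrow> 0 < \<epsilon> \<Longrightarrow> \<epsilon> \<le> 1 \<Longrightarrow> horizontally_close P Q \<epsilon> v w \<Longrightarrow>
      \<bar>g w - g v - gX v * (w$1 - v$1) - gY v * (w$2 - v$2)\<bar> \<le> C * \<epsilon>\<^sup>2"
  shows "horizontal_jet P Q B g gX gY"
  using assms unfolding horizontal_jet_def by (intro conjI exI[of _ C] ballI allI impI) blast+

lemma horizontal_jetE:
  assumes "horizontal_jet P Q B g gX gY"
  obtains C where "C \<ge> 0"
    "\<And>v w \<epsilon>. v \<in> B \<Longrightarrow> w \<in> B \<Longrightarrow> 0 < \<epsilon> \<Longrightarrow> \<epsilon> \<le> 1 \<Longrightarrow> horizontally_close P Q \<epsilon> v w \<Longrightarrow>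
      \<bar>g w - g v - gX v * (w$1 - v$1) - gY v * (w$2 - v$2)\<bar> \<le> C * \<epsilon>\<^sup>2"
  using assms unfolding horizontal_jet_def by blast

lemma horizontal_jet_bounded:
  assumes "horizontal_jet P Q B g gX gY"
  shows "bounded_lipschitz_on B g" "bounded_lipschitz_on B gX" "bounded_lipschitz_on B gY"
  using assms unfolding horizontal_jet_def by auto

lemma nth_diff_le_norm: "\<bar>(w::real^3)$i - v$i\<bar> \<le> norm (w - v)"
  by (metis component_le_norm_cart vector_minus_component)

lemma horizontal_jet_1:
  assumes "bounded B"
  shows "horizontal_jet P Q B (\<lambda>v. v$1) (\<lambda>_. 1) (\<lambda>_. 0)"
proof (rule horizontal_jetI[where C = 0])
  obtain R where R: "\<And>v. v \<in> B \<Longrightarrow> norm v \<le> R"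
    using assms bounded_iff by metis
  show "bounded_lipschitz_on B (\<lambda>v. v$1)"
    by (rule bounded_lipschitz_onI[where C = R and D = 1])
       (auto intro: order_trans[OF component_le_norm_cart R] nth_diff_le_norm)
qed (auto intro: bounded_lipschitz_on_const)

lemma horizontal_jet_2:
  assumes "bounded B"
  shows "horizontal_jet P Q B (\<lambda>v. v$2) (\<lambda>_. 0) (\<lambda>_. 1)"
proof (rule horizontal_jetI[where C = 0])
  obtain R where R: "\<And>v. v \<in> B \<Longrightarrow> norm v \<le> R"
    using assms bounded_iff by metis
  show "bounded_lipschitz_on B (\<lambda>v. v$2)"
    by (rule bounded_lipschitz_onI[where C = R and D = 1])
       (auto intro: order_trans[OF component_le_norm_cart R] nth_diff_le_norm)
qed (auto intro: bounded_lipschitz_on_const)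

lemma horizontal_jet_3:
  assumes "bounded B" "bounded_lipschitz_on B P" "bounded_lipschitz_on B Q"
  shows "horizontal_jet P Q B (\<lambda>v. v$3) P Q"
proof (rule horizontal_jetI[where C = 1])
  obtain R where R: "\<And>v. v \<in> B \<Longrightarrow> norm v \<le> R"
    using assms bounded_iff by metis
  show "bounded_lipschitz_on B (\<lambda>v. v$3)"
    by (rule bounded_lipschitz_onI[where C = R and D = 1])
       (auto intro: order_trans[OF component_le_norm_cart R] nth_diff_le_norm)
qed (auto simp: assms horizontally_close_def)

lemma horizontal_jet_const: "horizontal_jet P Q B (\<lambda>v. c) (\<lambda>_. 0) (\<lambda>_. 0)"
  by (rule horizontal_jetI[where C = 0]) (auto intro: bounded_lipschitz_on_const)

lemma horizontal_jet_add:
  assumes "horizontal_jet P Q B g gX gY" "horizontal_jet P Q B h hX hY"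
  shows "horizontal_jet P Q B (\<lambda>v. g v + h v) (\<lambda>v. gX v + hX v) (\<lambda>v. gY v + hY v)"
proof -
  obtain C where C: "C \<ge> 0" "\<And>v w \<epsilon>. v \<in> B \<Longrightarrow> w \<in> B \<Longrightarrow> 0 < \<epsilon> \<Longrightarrow> \<epsilon> \<le> 1 \<Longrightarrow> horizontally_close P Q \<epsilon> v w \<Longrightarrow>
      \<bar>g w - g v - gX v * (w$1 - v$1) - gY v * (w$2 - v$2)\<bar> \<le> C * \<epsilon>\<^sup>2"
    using assms(1) by (rule horizontal_jetE) blast
  obtain D where D: "D \<ge> 0" "\<And>v w \<epsilon>. v \<in> B \<Longrightarrow> w \<in> B \<Longrightarrow> 0 < \<epsilon> \<Longrightarrow> \<epsilon> \<le> 1 \<Longrightarrow> horizontally_close P Q \<epsilon> v w \<Longrightarrow>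
      \<bar>h w - h v - hX v * (w$1 - v$1) - hY v * (w$2 - v$2)\<bar> \<le> D * \<epsilon>\<^sup>2"
    using assms(2) by (rule horizontal_jetE) blast
  show ?thesis
  proof (rule horizontal_jetI[where C = "C + D"])
    fix v w \<epsilon> assume *: "v \<in> B" "w \<in> B" "0 < (\<epsilon>::real)" "\<epsilon> \<le> 1" "horizontally_close P Q \<epsilon> v w"
    have "\<bar>(g w + h w) - (g v + h v) - (gX v + hX v) * (w$1 - v$1) - (gY v + hY v) * (w$2 - v$2)\<bar>
       = \<bar>(g w - g v - gX v * (w$1 - v$1) - gY v * (w$2 - v$2)) +
          (h w - h v - hX v * (w$1 - v$1) - hY v * (w$2 - v$2))\<bar>"
      by (simp add: algebra_simps)
    also have "\<dots> \<le> C * \<epsilon>\<^sup>2 + D * \<epsilon>\<^sup>2"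
      using C(2)[OF *] D(2)[OF *] by linarith
    finally show "\<bar>(g w + h w) - (g v + h v) - (gX v + hX v) * (w$1 - v$1) - (gY v + hY v) * (w$2 - v$2)\<bar>
       \<le> (C + D) * \<epsilon>\<^sup>2" by (simp add: distrib_right)
  qed (use assms C(1) D(1) in \<open>auto intro: bounded_lipschitz_on_add horizontal_jet_bounded\<close>)
qed

lemma horizontal_jet_mult:
  assumes g: "horizontal_jet P Q B g gX gY" and h: "horizontal_jet P Q B h hX hY"
  shows "horizontal_jet P Q B (\<lambda>v. g v * h v) (\<lambda>v. gX v * h v + g v * hX v) (\<lambda>v. gY v * h v + g v * hY v)"
proof -
  obtain C where C: "C \<ge> 0" "\<And>v w \<epsilon>. v \<in> B \<Longrightarrow> w \<in> B \<Longrightarrow> 0 < \<epsilon> \<Longrightarrow> \<epsilon> \<le> 1 \<Longrightarrow> horizontally_close P Q \<epsilon> v w \<Longrightarrow>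
      \<bar>g w - g v - gX v * (w$1 - v$1) - gY v * (w$2 - v$2)\<bar> \<le> C * \<epsilon>\<^sup>2"
    using assms(1) by (rule horizontal_jetE) blast
  obtain D where D: "D \<ge> 0" "\<And>v w \<epsilon>. v \<in> B \<Longrightarrow> w \<in> B \<Longrightarrow> 0 < \<epsilon> \<Longrightarrow> \<epsilon> \<le> 1 \<Longrightarrow> horizontally_close P Q \<epsilon> v w \<Longrightarrow>
      \<bar>h w - h v - hX v * (w$1 - v$1) - hY v * (w$2 - v$2)\<bar> \<le> D * \<epsilon>\<^sup>2"
    using assms(2) by (rule horizontal_jetE) blast
  obtain G where G: "G \<ge> 0" "\<And>v. v \<in> B \<Longrightarrow> \<bar>g v\<bar> \<le> G"
    "\<And>v w. v \<in> B \<Longrightarrow> w \<in> B \<Longrightarrow> \<bar>g w - g v\<bar> \<le> G * norm (w - v)"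
    using horizontal_jet_bounded(1)[OF g] by (rule bounded_lipschitz_onE) blast
  obtain H where H: "H \<ge> 0" "\<And>v. v \<in> B \<Longrightarrow> \<bar>h v\<bar> \<le> H"
    "\<And>v w. v \<in> B \<Longrightarrow> w \<in> B \<Longrightarrow> \<bar>h w - h v\<bar> \<le> H * norm (w - v)"
    using horizontal_jet_bounded(1)[OF h] by (rule bounded_lipschitz_onE) blast
  show ?thesis
  proof (rule horizontal_jetI[where C = "C * H + G * D + G * H"])
    fix v w \<epsilon> assume *: "v \<in> B" "w \<in> B" "0 < (\<epsilon>::real)" "\<epsilon> \<le> 1" "horizontally_close P Q \<epsilon> v w"
    let ?dg = "g w - g v - gX v * (w$1 - v$1) - gY v * (w$2 - v$2)"
    let ?dh = "h w - h v - hX v * (w$1 - v$1) - hY v * (w$2 - v$2)"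
    have n: "norm (w - v) \<le> \<epsilon>"
      using *(5) by (simp add: horizontally_close_def)
    have dg: "\<bar>g w - g v\<bar> \<le> G * \<epsilon>"
      using G(3)[OF *(1,2)] mult_left_mono[OF n G(1)] by linarith
    have dh: "\<bar>h w - h v\<bar> \<le> H * \<epsilon>"
      using H(3)[OF *(1,2)] mult_left_mono[OF n H(1)] by linarith
    have "\<bar>g w * h w - g v * h v - (gX v * h v + g v * hX v) * (w$1 - v$1) - (gY v * h v + g v * hY v) * (w$2 - v$2)\<bar>
       = \<bar>?dg * h v + g v * ?dh + (g w - g v) * (h w - h v)\<bar>"
      by (simp add: algebra_simps)
    also have "\<dots> \<le> \<bar>?dg * h v\<bar> + \<bar>g v * ?dh\<bar> + \<bar>(g w - g v) * (h w - h v)\<bar>"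
      by linarith
    also have "\<dots> \<le> (C * \<epsilon>\<^sup>2) * H + G * (D * \<epsilon>\<^sup>2) + (G * \<epsilon>) * (H * \<epsilon>)"
      unfolding abs_mult using C(1) D(1) G(1) H(1) *(3) C(2)[OF *] D(2)[OF *] G(2)[OF *(1)] H(2)[OF *(1)] dg dh
      by (intro add_mono mult_mono) auto
    finally show "\<bar>g w * h w - g v * h v - (gX v * h v + g v * hX v) * (w$1 - v$1) - (gY v * h v + g v * hY v) * (w$2 - v$2)\<bar>
       \<le> (C * H + G * D + G * H) * \<epsilon>\<^sup>2" by (simp add: algebra_simps power2_eq_square)
  qed (use C(1) D(1) G(1) H(1) horizontal_jet_bounded[OF g] horizontal_jet_bounded[OF h] in
      \<open>auto intro: bounded_lipschitz_on_add bounded_lipschitz_on_mult\<close>)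
qed

text \<open>The square of the positive part has a Lipschitz derivative.  This is all the regularity that the cutoff
functions below must have.\<close>

lemma max0_square_taylor: "\<bar>(max 0 b)\<^sup>2 - (max 0 a)\<^sup>2 - 2 * max 0 a * (b - a)\<bar> \<le> (b - a)\<^sup>2" for a b :: real
proof -
  consider "a \<ge> 0" "b \<ge> 0" | "a \<ge> 0" "b \<le> 0" | "a \<le> 0" "b \<ge> 0" | "a \<le> 0" "b \<le> 0" by linarith
  then show ?thesis
  proof cases
    case 1
    have e: "(max 0 b)\<^sup>2 - (max 0 a)\<^sup>2 - 2 * max 0 a * (b - a) = (b - a)\<^sup>2"
      using 1 by (simp add: max_def power2_eq_square algebra_simps)
    show ?thesis unfolding e by simp
  next
    case 2
    then have "a * b \<le> 0" by (simp add: mult_nonneg_nonpos)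
    have e: "(max 0 b)\<^sup>2 - (max 0 a)\<^sup>2 - 2 * max 0 a * (b - a) = a\<^sup>2 - 2 * (a * b)"
      using 2 by (simp add: max_def power2_eq_square algebra_simps)
    have "\<bar>a\<^sup>2 - 2 * (a * b)\<bar> = a\<^sup>2 - 2 * (a * b)"
      using \<open>a * b \<le> 0\<close> zero_le_power2[of a] by (simp only: abs_of_nonneg)
    then show ?thesis unfolding e by (simp add: power2_diff)
  next
    case 3
    then have "a * b \<le> 0" by (simp add: mult_nonpos_nonneg)
    have e: "(max 0 b)\<^sup>2 - (max 0 a)\<^sup>2 - 2 * max 0 a * (b - a) = b\<^sup>2"
      using 3 by (simp add: max_def power2_eq_square algebra_simps)
    have "2 * b * a \<le> a\<^sup>2"
      using \<open>a * b \<le> 0\<close> zero_le_power2[of a] mult.commute[of a b] by linarith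
    then show ?thesis unfolding e by (simp add: power2_diff)
  next
    case 4 then show ?thesis by (simp add: max_def)
  qed
qed

lemma horizontal_jet_max0_square:
  assumes g: "horizontal_jet P Q B g gX gY"
  shows "horizontal_jet P Q B (\<lambda>v. (max 0 (g v))\<^sup>2) (\<lambda>v. 2 * max 0 (g v) * gX v) (\<lambda>v. 2 * max 0 (g v) * gY v)"
proof -
  obtain C where C: "C \<ge> 0" "\<And>v w \<epsilon>. v \<in> B \<Longrightarrow> w \<in> B \<Longrightarrow> 0 < \<epsilon> \<Longrightarrow> \<epsilon> \<le> 1 \<Longrightarrow> horizontally_close P Q \<epsilon> v w \<Longrightarrow>
      \<bar>g w - g v - gX v * (w$1 - v$1) - gY v * (w$2 - v$2)\<bar> \<le> C * \<epsilon>\<^sup>2"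
    using assms(1) by (rule horizontal_jetE) blast
  obtain G where G: "G \<ge> 0" "\<And>v. v \<in> B \<Longrightarrow> \<bar>g v\<bar> \<le> G"
    "\<And>v w. v \<in> B \<Longrightarrow> w \<in> B \<Longrightarrow> \<bar>g w - g v\<bar> \<le> G * norm (w - v)"
    using horizontal_jet_bounded(1)[OF g] by (rule bounded_lipschitz_onE) blast
  have bl: "bounded_lipschitz_on B (\<lambda>v. max 0 (g v))"
    by (rule bounded_lipschitz_on_max0[OF horizontal_jet_bounded(1)[OF g]])
  show ?thesis
  proof (rule horizontal_jetI[where C = "G * G + 2 * G * C"])
    fix v w \<epsilon> assume *: "v \<in> B" "w \<in> B" "0 < (\<epsilon>::real)" "\<epsilon> \<le> 1" "horizontally_close P Q \<epsilon> v w"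
    let ?dg = "g w - g v - gX v * (w$1 - v$1) - gY v * (w$2 - v$2)"
    let ?T = "(max 0 (g w))\<^sup>2 - (max 0 (g v))\<^sup>2 - 2 * max 0 (g v) * (g w - g v)"
    have n: "norm (w - v) \<le> \<epsilon>"
      using *(5) by (simp add: horizontally_close_def)
    have dg: "\<bar>g w - g v\<bar> \<le> G * \<epsilon>"
      using G(3)[OF *(1,2)] mult_left_mono[OF n G(1)] by linarith
    have "\<bar>(max 0 (g w))\<^sup>2 - (max 0 (g v))\<^sup>2 - 2 * max 0 (g v) * gX v * (w$1 - v$1) - 2 * max 0 (g v) * gY v * (w$2 - v$2)\<bar>
       = \<bar>?T + 2 * max 0 (g v) * ?dg\<bar>"
      by (simp add: algebra_simps)
    also have "\<dots> \<le> \<bar>?T\<bar> + 2 * \<bar>max 0 (g v)\<bar> * \<bar>?dg\<bar>"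
      by (rule order_trans[OF abs_triangle_ineq]) (simp add: abs_mult)
    also have "\<dots> \<le> (G * \<epsilon>)\<^sup>2 + 2 * G * (C * \<epsilon>\<^sup>2)"
    proof (intro add_mono mult_mono)
      show "\<bar>?T\<bar> \<le> (G * \<epsilon>)\<^sup>2"
        by (rule order_trans[OF max0_square_taylor]) (use dg abs_le_square_iff G(1) *(3) in fastforce)
      show "\<bar>max 0 (g v)\<bar> \<le> G" using G(2)[OF *(1)] by linarith
    qed (use C(2)[OF *] G in auto)
    finally show "\<bar>(max 0 (g w))\<^sup>2 - (max 0 (g v))\<^sup>2 - 2 * max 0 (g v) * gX v * (w$1 - v$1) - 2 * max 0 (g v) * gY v * (w$2 - v$2)\<bar>
       \<le> (G * G + 2 * G * C) * \<epsilon>\<^sup>2"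
      by (simp add: algebra_simps power2_eq_square)
  next
    show "bounded_lipschitz_on B (\<lambda>v. (max 0 (g v))\<^sup>2)"
      using bounded_lipschitz_on_mult[OF bl bl] by (simp add: power2_eq_square)
  qed (use C(1) G(1) bl horizontal_jet_bounded[OF g] in
      \<open>auto intro!: bounded_lipschitz_on_mult bounded_lipschitz_on_const\<close>)
qed

section \<open>The discrete Rumin form\<close>

text \<open>The trapezoidal value of the integral of h du from v to w.\<close>

definition trapezoid :: "('b \<Rightarrow> real) \<Rightarrow> ('b \<Rightarrow> real) \<Rightarrow> 'b \<Rightarrow> 'b \<Rightarrow> real" where
  "trapezoid h u v w = (h v + h w) / 2 * (u w - u v)"

text \<open>Stokes for the triangle, without error term: the sum is the signed area of its image in the (h, u)-plane.\<close>

lemma trapezoid_triangle: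
  "trapezoid h u a b + trapezoid h u b c + trapezoid h u c a =
     ((h b - h a) * (u c - u a) - (h c - h a) * (u b - u a)) / 2"
  by (simp add: trapezoid_def field_simps)

text \<open>The trapezoidal value of the integral of the contact form dz - P dx - Q dy from v to w.\<close>

definition contact_edge :: "(real^3 \<Rightarrow> real) \<Rightarrow> (real^3 \<Rightarrow> real) \<Rightarrow> real^3 \<Rightarrow> real^3 \<Rightarrow> real" where
  "contact_edge P Q v w = w$3 - v$3 - trapezoid P (\<lambda>v. v$1) v w - trapezoid Q (\<lambda>v. v$2) v w"

text \<open>The trapezoidal value of the integral of h dx - f (dz - P dx - Q dy) from v to w.\<close>

definition rumin_edge ::
    "(real^3 \<Rightarrow> real) \<Rightarrow> (real^3 \<Rightarrow> real) \<Rightarrow> (real^3 \<Rightarrow> real) \<Rightarrow> (real^3 \<Rightarrow> real) \<Rightarrow> real^3 \<Rightarrow> real^3 \<Rightarrow> real" where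
  "rumin_edge P Q h f v w = trapezoid h (\<lambda>v. v$1) v w - (f v + f w) / 2 * contact_edge P Q v w"

lemma rumin_edge_swap: "rumin_edge P Q h f w v = - rumin_edge P Q h f v w"
  by (simp add: rumin_edge_def contact_edge_def trapezoid_def field_simps)

lemma rumin_edge_vanishing: "h v = 0 \<Longrightarrow> h w = 0 \<Longrightarrow> f v = 0 \<Longrightarrow> f w = 0 \<Longrightarrow> rumin_edge P Q h f v w = 0"
  by (simp add: rumin_edge_def trapezoid_def)

lemma contact_edge_bound:
  assumes "bounded_lipschitz_on B P" "bounded_lipschitz_on B Q"
  shows "\<exists>C\<ge>0. \<forall>v\<in>B. \<forall>w\<in>B. \<forall>\<epsilon>>0. horizontally_close P Q \<epsilon> v w \<longrightarrow> \<bar>contact_edge P Q v w\<bar> \<le> C * \<epsilon>\<^sup>2"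
proof -
  obtain C where C: "C \<ge> 0" "\<And>v w. v \<in> B \<Longrightarrow> w \<in> B \<Longrightarrow> \<bar>P w - P v\<bar> \<le> C * norm (w - v)"
    using assms(1) by (rule bounded_lipschitz_onE) blast
  obtain D where D: "D \<ge> 0" "\<And>v w. v \<in> B \<Longrightarrow> w \<in> B \<Longrightarrow> \<bar>Q w - Q v\<bar> \<le> D * norm (w - v)"
    using assms(2) by (rule bounded_lipschitz_onE) blast
  have "\<bar>contact_edge P Q v w\<bar> \<le> (1 + C + D) * \<epsilon>\<^sup>2"
    if vw: "v \<in> B" "w \<in> B" and "\<epsilon> > 0" and hz: "horizontally_close P Q \<epsilon> v w" for v w \<epsilon>
  proof -
    let ?z = "w$3 - v$3 - P v * (w$1 - v$1) - Q v * (w$2 - v$2)"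
    have n: "norm (w - v) \<le> \<epsilon>" and z: "\<bar>?z\<bar> \<le> \<epsilon>\<^sup>2"
      using hz by (auto simp: horizontally_close_def)
    have d: "\<bar>w$1 - v$1\<bar> \<le> \<epsilon>" "\<bar>w$2 - v$2\<bar> \<le> \<epsilon>"
      using nth_diff_le_norm order_trans n by blast+
    have p: "\<bar>P w - P v\<bar> \<le> C * \<epsilon>" "\<bar>Q w - Q v\<bar> \<le> D * \<epsilon>"
      using order_trans[OF C(2)[OF vw] mult_left_mono[OF n C(1)]]
        order_trans[OF D(2)[OF vw] mult_left_mono[OF n D(1)]] by auto
    have "contact_edge P Q v w = ?z - (P w - P v) * (w$1 - v$1) / 2 - (Q w - Q v) * (w$2 - v$2) / 2"
      by (simp add: contact_edge_def trapezoid_def field_simps)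
    moreover have "\<bar>(P w - P v) * (w$1 - v$1)\<bar> \<le> (C * \<epsilon>) * \<epsilon>" "\<bar>(Q w - Q v) * (w$2 - v$2)\<bar> \<le> (D * \<epsilon>) * \<epsilon>"
      unfolding abs_mult using p d C(1) D(1) \<open>\<epsilon> > 0\<close> by (auto intro!: mult_mono)
    ultimately have "\<bar>contact_edge P Q v w\<bar> \<le> \<epsilon>\<^sup>2 + C * \<epsilon> * \<epsilon> / 2 + D * \<epsilon> * \<epsilon> / 2"
      using z by (simp only: abs_le_iff) linarith
    also have "\<dots> \<le> \<epsilon>\<^sup>2 + C * \<epsilon> * \<epsilon> + D * \<epsilon> * \<epsilon>"
      using C(1) D(1) \<open>\<epsilon> > 0\<close> by (simp add: field_simps)
    finally show ?thesis by (simp add: power2_eq_square algebra_simps)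
  qed
  then show ?thesis
    using C(1) D(1) by (intro exI[of _ "1 + C + D"]) auto
qed

text \<open>With dg1 and dg2 the increments of g along two horizontal vectors, and u a linear function of x and y:
the area in the (g, u)-plane is, to leading order, that in the (x, y)-plane multiplied by the Jacobian
Xg Yu - Yg Xu.\<close>

lemma area_taylor:
  fixes dg1 dg2 gX gY x1 x2 y1 y2 C \<epsilon> :: real
  assumes "\<bar>dg1 - gX * x1 - gY * y1\<bar> \<le> C * \<epsilon>\<^sup>2" "\<bar>dg2 - gX * x2 - gY * y2\<bar> \<le> C * \<epsilon>\<^sup>2"
    and u: "\<bar>ux * x1 + uy * y1\<bar> \<le> \<epsilon>" "\<bar>ux * x2 + uy * y2\<bar> \<le> \<epsilon>" and "C \<ge> 0" "\<epsilon> > 0"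
  shows "\<bar>dg1 * (ux * x2 + uy * y2) - dg2 * (ux * x1 + uy * y1) - (gX * uy - gY * ux) * (x1 * y2 - x2 * y1)\<bar> \<le> 2 * C * \<epsilon>^3"
proof -
  let ?r1 = "dg1 - gX * x1 - gY * y1" and ?r2 = "dg2 - gX * x2 - gY * y2"
  have "dg1 * (ux * x2 + uy * y2) - dg2 * (ux * x1 + uy * y1) - (gX * uy - gY * ux) * (x1 * y2 - x2 * y1)
      = ?r1 * (ux * x2 + uy * y2) - ?r2 * (ux * x1 + uy * y1)"
    by (simp add: algebra_simps)
  moreover have "\<bar>?r1 * (ux * x2 + uy * y2)\<bar> \<le> (C * \<epsilon>\<^sup>2) * \<epsilon>" "\<bar>?r2 * (ux * x1 + uy * y1)\<bar> \<le> (C * \<epsilon>\<^sup>2) * \<epsilon>"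
    unfolding abs_mult using assms by (auto intro!: mult_mono)
  ultimately show ?thesis
    by (simp add: power2_eq_square power3_eq_cube)
qed

text \<open>To leading order both h dx and the contact form contribute a multiple of the (x, y)-area of the triangle to
the sum over its boundary, with the factors - Yh / 2 and - (XQ - YP) / 2.  The equation for f cancels them.  Besides the
Taylor errors there remain products of the variation of f, of order \<epsilon>, with the values of the contact form on
the edges, of order \<epsilon>^2.\<close>

lemma rumin_edge_triangle:
  assumes B: "bounded_lipschitz_on B f"
    and P: "horizontal_jet P Q B P PX PY" and Q: "horizontal_jet P Q B Q QX QY"
    and h: "horizontal_jet P Q B h hX hY"
    and f: "\<And>v. v \<in> B \<Longrightarrow> f v * (QX v - PY v) = hY v"
  shows "\<exists>K\<ge>0. \<forall>\<epsilon>. 0 < \<epsilon> \<longrightarrow> \<epsilon> \<le> 1 \<longrightarrow> (\<forall>a\<in>B. \<forall>b\<in>B. \<forall>c\<in>B.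
           horizontally_close P Q \<epsilon> a b \<longrightarrow> horizontally_close P Q \<epsilon> a c \<longrightarrow>
           horizontally_close P Q \<epsilon> b c \<longrightarrow>
           \<bar>rumin_edge P Q h f a b + rumin_edge P Q h f b c + rumin_edge P Q h f c a\<bar> \<le> K * \<epsilon>^3)"
proof -
  obtain F where F: "F \<ge> 0" "\<And>v. v \<in> B \<Longrightarrow> \<bar>f v\<bar> \<le> F"
    "\<And>v w. v \<in> B \<Longrightarrow> w \<in> B \<Longrightarrow> \<bar>f w - f v\<bar> \<le> F * norm (w - v)"
    using B by (rule bounded_lipschitz_onE) blast
  obtain A where A: "A \<ge> 0" "\<And>v w \<epsilon>. v \<in> B \<Longrightarrow> w \<in> B \<Longrightarrow> \<epsilon> > 0 \<Longrightarrow> horizontally_close P Q \<epsilon> v w \<Longrightarrow>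
       \<bar>contact_edge P Q v w\<bar> \<le> A * \<epsilon>\<^sup>2"
    using contact_edge_bound[OF horizontal_jet_bounded(1)[OF P] horizontal_jet_bounded(1)[OF Q]] by blast
  obtain CP where CP: "CP \<ge> 0" "\<And>v w \<epsilon>. v \<in> B \<Longrightarrow> w \<in> B \<Longrightarrow> 0 < \<epsilon> \<Longrightarrow> \<epsilon> \<le> 1 \<Longrightarrow> horizontally_close P Q \<epsilon> v w \<Longrightarrow>
      \<bar>P w - P v - PX v * (w$1 - v$1) - PY v * (w$2 - v$2)\<bar> \<le> CP * \<epsilon>\<^sup>2"
    using P by (rule horizontal_jetE) blast
  obtain CQ where CQ: "CQ \<ge> 0" "\<And>v w \<epsilon>. v \<in> B \<Longrightarrow> w \<in> B \<Longrightarrow> 0 < \<epsilon> \<Longrightarrow> \<epsilon> \<le> 1 \<Longrightarrow> horizontally_close P Q \<epsilon> v w \<Longrightarrow>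
      \<bar>Q w - Q v - QX v * (w$1 - v$1) - QY v * (w$2 - v$2)\<bar> \<le> CQ * \<epsilon>\<^sup>2"
    using Q by (rule horizontal_jetE) blast
  obtain Ch where Ch: "Ch \<ge> 0" "\<And>v w \<epsilon>. v \<in> B \<Longrightarrow> w \<in> B \<Longrightarrow> 0 < \<epsilon> \<Longrightarrow> \<epsilon> \<le> 1 \<Longrightarrow> horizontally_close P Q \<epsilon> v w \<Longrightarrow>
      \<bar>h w - h v - hX v * (w$1 - v$1) - hY v * (w$2 - v$2)\<bar> \<le> Ch * \<epsilon>\<^sup>2"
    using h by (rule horizontal_jetE) blast
  define K where "K = Ch + F * (CP + CQ) + 3 * F * A"
  have "\<bar>rumin_edge P Q h f a b + rumin_edge P Q h f b c + rumin_edge P Q h f c a\<bar> \<le> K * \<epsilon>^3"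
    if eps: "0 < \<epsilon>" "\<epsilon> \<le> 1" and abc: "a \<in> B" "b \<in> B" "c \<in> B"
      and hz: "horizontally_close P Q \<epsilon> a b" "horizontally_close P Q \<epsilon> a c" "horizontally_close P Q \<epsilon> b c"
    for \<epsilon> a b c
  proof -
    let ?x1 = "b$1 - a$1" and ?x2 = "c$1 - a$1" and ?y1 = "b$2 - a$2" and ?y2 = "c$2 - a$2"
    let ?J = "?x1 * ?y2 - ?x2 * ?y1"
    have n: "norm (b - a) \<le> \<epsilon>" "norm (c - a) \<le> \<epsilon>" "norm (c - b) \<le> \<epsilon>"
      using hz by (auto simp: horizontally_close_def)
    have d: "\<bar>?x1\<bar> \<le> \<epsilon>" "\<bar>?x2\<bar> \<le> \<epsilon>" "\<bar>?y1\<bar> \<le> \<epsilon>" "\<bar>?y2\<bar> \<le> \<epsilon>"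
      using nth_diff_le_norm order_trans n by blast+
    define SH where "SH = (h b - h a) * ?x2 - (h c - h a) * ?x1"
    define SP where "SP = (P b - P a) * ?x2 - (P c - P a) * ?x1"
    define SQ where "SQ = (Q b - Q a) * ?y2 - (Q c - Q a) * ?y1"
    have SH: "\<bar>SH + hY a * ?J\<bar> \<le> 2 * Ch * \<epsilon>^3"
      using area_taylor[where ux = 1 and uy = 0, OF Ch(2)[OF abc(1,2) eps hz(1)] Ch(2)[OF abc(1,3) eps hz(2)]] d eps Ch(1)
      by (simp add: SH_def)
    have SP: "\<bar>SP + PY a * ?J\<bar> \<le> 2 * CP * \<epsilon>^3"
      using area_taylor[where ux = 1 and uy = 0, OF CP(2)[OF abc(1,2) eps hz(1)] CP(2)[OF abc(1,3) eps hz(2)]] d eps CP(1)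
      by (simp add: SP_def)
    have SQ: "\<bar>SQ - QX a * ?J\<bar> \<le> 2 * CQ * \<epsilon>^3"
      using area_taylor[where ux = 0 and uy = 1, OF CQ(2)[OF abc(1,2) eps hz(1)] CQ(2)[OF abc(1,3) eps hz(2)]] d eps CQ(1)
      by (simp add: SQ_def)
    have anti: "contact_edge P Q c a = - contact_edge P Q a c"
      by (simp add: contact_edge_def trapezoid_def field_simps)
    have S1: "trapezoid h (\<lambda>v. v$1) a b + trapezoid h (\<lambda>v. v$1) b c + trapezoid h (\<lambda>v. v$1) c a = SH / 2"
      unfolding trapezoid_triangle SH_def by simp
    have S2: "contact_edge P Q a b + contact_edge P Q b c + contact_edge P Q c a = - (SP + SQ) / 2"
      using trapezoid_triangle[of P "\<lambda>v. v$1" a b c] trapezoid_triangle[of Q "\<lambda>v. v$2" a b c]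
      unfolding contact_edge_def SP_def SQ_def by (simp add: field_simps)
    \<comment> \<open>the last summand, the total coefficient of the area ?J, is 0\<close>
    have "SH / 2 + f a * (SP + SQ) / 2
        = (SH + hY a * ?J) / 2 + f a * (SP + PY a * ?J) / 2 + f a * (SQ - QX a * ?J) / 2
          + (f a * (QX a - PY a) - hY a) * ?J / 2"
      by (simp add: field_simps)
    also have "\<dots> = (SH + hY a * ?J) / 2 + f a * (SP + PY a * ?J) / 2 + f a * (SQ - QX a * ?J) / 2"
      using f[OF abc(1)] by simp
    finally have M: "SH / 2 + f a * (SP + SQ) / 2
        = (SH + hY a * ?J) / 2 + f a * (SP + PY a * ?J) / 2 + f a * (SQ - QX a * ?J) / 2" .
    have fP: "\<bar>f a * (SP + PY a * ?J)\<bar> \<le> F * (2 * CP * \<epsilon>^3)"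
      unfolding abs_mult using F(2)[OF abc(1)] SP F(1) by (intro mult_mono) auto
    have fQ: "\<bar>f a * (SQ - QX a * ?J)\<bar> \<le> F * (2 * CQ * \<epsilon>^3)"
      unfolding abs_mult using F(2)[OF abc(1)] SQ F(1) by (intro mult_mono) auto
    have half: "\<bar>s / 2 + t / 2 + u / 2\<bar> \<le> (x + y + z) / 2" if "\<bar>s\<bar> \<le> x" "\<bar>t\<bar> \<le> y" "\<bar>u\<bar> \<le> z" for s t u x y z :: real
      using abs_triangle_ineq[of "s / 2 + t / 2" "u / 2"] abs_triangle_ineq[of "s / 2" "t / 2"] that by simp
    have M': "\<bar>SH / 2 + f a * (SP + SQ) / 2\<bar> \<le> (Ch + F * CP + F * CQ) * \<epsilon>^3"
      unfolding M by (rule order_trans[OF half[OF SH fP fQ]]) (simp add: field_simps)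
    have fl: "\<bar>f b - f a\<bar> \<le> F * \<epsilon>" "\<bar>f c - f a\<bar> \<le> F * \<epsilon>"
      using order_trans[OF F(3) mult_left_mono[OF _ F(1)]] abc n by blast+
    have r1: "\<bar>(f b - f a) * contact_edge P Q a b\<bar> \<le> (F * \<epsilon>) * (A * \<epsilon>\<^sup>2)"
      unfolding abs_mult using fl A(2)[OF abc(1,2) eps(1) hz(1)] F(1) A(1) eps by (intro mult_mono) auto
    have r2: "\<bar>(f b - f a + (f c - f a)) * contact_edge P Q b c\<bar> \<le> (2 * F * \<epsilon>) * (A * \<epsilon>\<^sup>2)"
      unfolding abs_mult using fl A(2)[OF abc(2,3) eps(1) hz(3)] F(1) A(1) eps by (intro mult_mono) auto
    have r3: "\<bar>(f c - f a) * contact_edge P Q a c\<bar> \<le> (F * \<epsilon>) * (A * \<epsilon>\<^sup>2)"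
      unfolding abs_mult using fl A(2)[OF abc(1,3) eps(1) hz(2)] F(1) A(1) eps by (intro mult_mono) auto
    have "rumin_edge P Q h f a b + rumin_edge P Q h f b c + rumin_edge P Q h f c a
       = (trapezoid h (\<lambda>v. v$1) a b + trapezoid h (\<lambda>v. v$1) b c + trapezoid h (\<lambda>v. v$1) c a)
         - f a * (contact_edge P Q a b + contact_edge P Q b c + contact_edge P Q c a)
         - ((f b - f a) * contact_edge P Q a b + (f b - f a + (f c - f a)) * contact_edge P Q b c
            - (f c - f a) * contact_edge P Q a c) / 2"
      unfolding rumin_edge_def anti by (simp add: field_simps)
    also have "\<dots> = (SH / 2 + f a * (SP + SQ) / 2)
         - ((f b - f a) * contact_edge P Q a b + (f b - f a + (f c - f a)) * contact_edge P Q b c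
            - (f c - f a) * contact_edge P Q a c) / 2"
      unfolding S1 S2 by (simp add: field_simps)
    finally have E: "rumin_edge P Q h f a b + rumin_edge P Q h f b c + rumin_edge P Q h f c a
       = (SH / 2 + f a * (SP + SQ) / 2)
         - ((f b - f a) * contact_edge P Q a b + (f b - f a + (f c - f a)) * contact_edge P Q b c
            - (f c - f a) * contact_edge P Q a c) / 2" .
    have rest: "\<bar>m - (s + t - u) / 2\<bar> \<le> w + (x + y + z) / 2"
      if "\<bar>m\<bar> \<le> w" "\<bar>s\<bar> \<le> x" "\<bar>t\<bar> \<le> y" "\<bar>u\<bar> \<le> z" for m w s t u x y z :: real
    proof -
      have "\<bar>s + t - u\<bar> \<le> x + y + z"
        using abs_triangle_ineq4[of "s + t" u] abs_triangle_ineq[of s t] that(2-4) by simp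
      then have "\<bar>(s + t - u) / 2\<bar> \<le> (x + y + z) / 2"
        by simp
      then show ?thesis
        using abs_triangle_ineq4[of m "(s + t - u) / 2"] that(1) by linarith
    qed
    have "\<bar>rumin_edge P Q h f a b + rumin_edge P Q h f b c + rumin_edge P Q h f c a\<bar>
       \<le> (Ch + F * CP + F * CQ) * \<epsilon>^3 + ((F * \<epsilon>) * (A * \<epsilon>\<^sup>2) + (2 * F * \<epsilon>) * (A * \<epsilon>\<^sup>2) + (F * \<epsilon>) * (A * \<epsilon>\<^sup>2)) / 2"
      unfolding E by (rule rest[OF M' r1 r2 r3])
    also have "\<dots> \<le> K * \<epsilon>^3"
      using F(1) A(1) eps by (simp add: K_def algebra_simps power2_eq_square power3_eq_cube)
    finally show ?thesis .
  qed
  moreover have "K \<ge> 0"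
    using F(1) A(1) CP(1) CQ(1) Ch(1) by (simp add: K_def)
  ultimately show ?thesis by blast
qed

lemma norm_cart3_square: "(norm (v::real^3))\<^sup>2 = v$1 * v$1 + v$2 * v$2 + v$3 * v$3"
  by (simp add: norm_vec_def L2_set_def sum_3 power2_eq_square)

text \<open>The cutoff function is m (1 - m (|v|^2 / \<rho>^2 - 1)), where m is the square of the positive part: the inner m
is 0 for |v| \<le> \<rho> and at least 1 for |v| \<ge> 2 \<rho>.  Since the derivative of m vanishes together with m, the
derivative hY, and with it f, has the same support as h.\<close>

lemma cutoff_pair_exists:
  assumes "\<rho> > 0" "bounded B"
    and P: "horizontal_jet P Q B P PX PY" and Q: "horizontal_jet P Q B Q QX QY"
    and D: "c > 0" "\<And>v. v \<in> B \<Longrightarrow> c \<le> \<bar>QX v - PY v\<bar>"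
  obtains h f hX hY where
    "horizontal_jet P Q B h hX hY" "bounded_lipschitz_on B f"
    "\<And>v. v \<in> B \<Longrightarrow> f v * (QX v - PY v) = hY v"
    "\<And>v. norm v \<le> \<rho> \<Longrightarrow> h v = v$1 * v$2"
    "\<And>v. norm v \<ge> 2 * \<rho> \<Longrightarrow> h v = 0 \<and> f v = 0"
proof -
  let ?\<tau> = "\<lambda>v::real^3. (v$1 * v$1 + v$2 * v$2 + v$3 * v$3) * (1 / \<rho>\<^sup>2) + (-1)"
  let ?\<chi> = "\<lambda>v. 1 + (-1) * (max 0 (?\<tau> v))\<^sup>2"
  note j1 = horizontal_jet_1[OF \<open>bounded B\<close>, of P Q]
  note j2 = horizontal_jet_2[OF \<open>bounded B\<close>, of P Q]
  note j3 = horizontal_jet_3[OF \<open>bounded B\<close> horizontal_jet_bounded(1)[OF P] horizontal_jet_bounded(1)[OF Q]]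
  note jtau = horizontal_jet_add[OF horizontal_jet_mult[OF horizontal_jet_add[OF horizontal_jet_add[OF
      horizontal_jet_mult[OF j1 j1] horizontal_jet_mult[OF j2 j2]] horizontal_jet_mult[OF j3 j3]]
      horizontal_jet_const[where c = "1 / \<rho>\<^sup>2"]] horizontal_jet_const[where c = "-1"]]
  note jchi = horizontal_jet_add[OF horizontal_jet_const[where c = 1]
      horizontal_jet_mult[OF horizontal_jet_const[where c = "-1"] horizontal_jet_max0_square[OF jtau]]]
  obtain cX cY where chi: "horizontal_jet P Q B ?\<chi> cX cY"
    using jchi by blast
  let ?h = "\<lambda>v. (max 0 (?\<chi> v))\<^sup>2 * (v$1 * v$2)"
  let ?hX = "\<lambda>v. 2 * max 0 (?\<chi> v) * cX v * (v$1 * v$2) + (max 0 (?\<chi> v))\<^sup>2 * (1 * v$2 + v$1 * 0)"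
  let ?hY = "\<lambda>v. 2 * max 0 (?\<chi> v) * cY v * (v$1 * v$2) + (max 0 (?\<chi> v))\<^sup>2 * (0 * v$2 + v$1 * 1)"
  let ?f = "\<lambda>v. ?hY v * (1 / (QX v - PY v))"
  have h: "horizontal_jet P Q B ?h ?hX ?hY"
    by (rule horizontal_jet_mult[OF horizontal_jet_max0_square[OF chi] horizontal_jet_mult[OF j1 j2]])
  show thesis
  proof (rule that[of ?h ?hX ?hY ?f])
    show "horizontal_jet P Q B ?h ?hX ?hY" by (rule h)
    show "bounded_lipschitz_on B ?f"
      using bounded_lipschitz_on_mult[OF horizontal_jet_bounded(3)[OF h] bounded_lipschitz_on_inverse[OF
        bounded_lipschitz_on_diff[OF horizontal_jet_bounded(2)[OF Q] horizontal_jet_bounded(3)[OF P]] D]] .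
    show "?f v * (QX v - PY v) = ?hY v" if "v \<in> B" for v
      using D(1) D(2)[OF that] by simp
    show "?h v = v$1 * v$2" if "norm v \<le> \<rho>" for v
    proof -
      have "(norm v)\<^sup>2 \<le> \<rho>\<^sup>2" using that by (simp add: power_mono)
      then have "(norm v)\<^sup>2 * (1 / \<rho>\<^sup>2) \<le> 1" using \<open>\<rho> > 0\<close> by simp
      then have "max 0 (?\<tau> v) = 0" unfolding norm_cart3_square by simp
      then show ?thesis by simp
    qed
    show "?h v = 0 \<and> ?f v = 0" if "norm v \<ge> 2 * \<rho>" for v
    proof -
      have "(2 * \<rho>)\<^sup>2 \<le> (norm v)\<^sup>2" using that \<open>\<rho> > 0\<close> by (intro power_mono) auto
      then have "4 \<le> (norm v)\<^sup>2 * (1 / \<rho>\<^sup>2)" using \<open>\<rho> > 0\<close> by (simp add: field_simps)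
      then have "?\<tau> v \<ge> 1" unfolding norm_cart3_square by linarith
      then have "1 \<le> (max 0 (?\<tau> v))\<^sup>2" using power_mono[of 1 "max 0 (?\<tau> v)" 2] by simp
      then have "max 0 (?\<chi> v) = 0" by simp
      then show ?thesis by simp
    qed
  qed
qed

section \<open>Lipschitz null homotopies\<close>

lemma grid_sum_telescope:
  fixes h v :: "nat \<Rightarrow> nat \<Rightarrow> real"
  shows "(\<Sum>i<N. \<Sum>j<N. h i j + v (Suc i) j - h i (Suc j) - v i j)
       = (\<Sum>i<N. h i 0 - h i N) + (\<Sum>j<N. v N j - v 0 j)"
proof -
  have "(\<Sum>i<N. \<Sum>j<N. h i j + v (Suc i) j - h i (Suc j) - v i j)
      = (\<Sum>i<N. \<Sum>j<N. h i j - h i (Suc j)) + (\<Sum>i<N. \<Sum>j<N. v (Suc i) j - v i j)"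
    unfolding sum.distrib[symmetric] by (intro sum.cong refl) simp
  also have "(\<Sum>i<N. \<Sum>j<N. v (Suc i) j - v i j) = (\<Sum>j<N. \<Sum>i<N. v (Suc i) j - v i j)"
    by (rule sum.swap)
  also have "(\<Sum>i<N. \<Sum>j<N. h i j - h i (Suc j)) = (\<Sum>i<N. h i 0 - h i N)"
    by (simp add: sum_lessThan_telescope')
  also have "(\<Sum>j<N. \<Sum>i<N. v (Suc i) j - v i j) = (\<Sum>j<N. v N j - v 0 j)"
    using sum_lessThan_telescope[of "\<lambda>i. v i _"] by (intro sum.cong refl) simp
  finally show ?thesis .
qed

text \<open>Each square of an n by n grid is cut into two triangles; E is antisymmetric, so interior edges cancel.
Three sides of the square are mapped to p, where E vanishes, and the fourth is the loop.  The 2 n^2 triangles of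
size O(1/n) contribute O(n^{-3}) each.\<close>

lemma lipschitz_nullhomotopy_edge_sum:
  fixes E :: "'a \<Rightarrow> 'a \<Rightarrow> real" and d :: "'a \<Rightarrow> 'a \<Rightarrow> ennreal"
  assumes anti: "\<And>p q. E q p = - E p q"
    and tri: "\<And>\<epsilon> a b c. 0 < \<epsilon> \<Longrightarrow> \<epsilon> \<le> \<epsilon>0 \<Longrightarrow> (\<forall>x\<in>{a,b,c}. \<forall>y\<in>{a,b,c}. d x y < ennreal \<epsilon>) \<Longrightarrow>
           \<bar>E a b + E b c + E c a\<bar> \<le> K * \<epsilon>^3"
    and "\<epsilon>0 > 0"
    and hom: "lip_homotopic d S (\<lambda>_. p) \<gamma>" and "\<gamma> 0 = p" "\<gamma> 1 = p"
  shows "\<exists>C N0. \<forall>N\<ge>N0. \<bar>\<Sum>i<N. E (\<gamma> (real i / real N)) (\<gamma> (real (Suc i) / real N))\<bar> \<le> C / real N"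
proof -
  obtain H where H: "lipschitz_map ({0..1} \<times> {0..1}) l1_dist S d H"
    and bottom: "\<And>s. s \<in> {0..1} \<Longrightarrow> H (s, 0) = p" and top: "\<And>s. s \<in> {0..1} \<Longrightarrow> H (s, 1) = \<gamma> s"
    and sides: "\<And>t. t \<in> {0..1} \<Longrightarrow> H (0, t) = p" "\<And>t. t \<in> {0..1} \<Longrightarrow> H (1, t) = p"
    using hom unfolding lip_homotopic_def by auto
  obtain L where L: "L \<ge> 0" "\<And>x y. x \<in> {0..1} \<times> {0..1} \<Longrightarrow> y \<in> {0..1} \<times> {0..1} \<Longrightarrow> d (H x) (H y) \<le> ennreal L * l1_dist x y"
    using H unfolding lipschitz_map_def by auto
  have E0: "E q q = 0" for q
    using anti[of q q] by simp
  \<comment> \<open>the vertices of a triangle are at distance at most 2 L / N, which is less than (2 L + 1) / N\<close>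
  define N0 where "N0 = nat \<lceil>(2 * L + 1) / \<epsilon>0\<rceil> + 1"
  define C where "C = 2 * K * (2 * L + 1)^3"
  have "\<bar>\<Sum>i<N. E (\<gamma> (real i / real N)) (\<gamma> (real (Suc i) / real N))\<bar> \<le> C / real N" if "N \<ge> N0" for N
  proof -
    have N: "N > 0" using that by (simp add: N0_def)
    define \<epsilon> where "\<epsilon> = (2 * L + 1) / real N"
    have eps: "\<epsilon> > 0" using L(1) N by (simp add: \<epsilon>_def)
    have "(2 * L + 1) / \<epsilon>0 \<le> real N"
      using that unfolding N0_def by linarith
    then have eps0: "\<epsilon> \<le> \<epsilon>0"
      using \<open>\<epsilon>0 > 0\<close> N by (simp add: \<epsilon>_def field_simps)
    define G where "G i j = H (real i / real N, real j / real N)" for i j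
    have close: "d (G i j) (G i' j') < ennreal \<epsilon>"
      if "i \<le> N" "j \<le> N" "i' \<le> N" "j' \<le> N" "\<bar>real i - real i'\<bar> \<le> 1" "\<bar>real j - real j'\<bar> \<le> 1" for i j i' j'
    proof -
      have mem: "(real i / real N, real j / real N) \<in> {0..1} \<times> {0..1}" "(real i' / real N, real j' / real N) \<in> {0..1} \<times> {0..1}"
        using that N by auto
      have "\<bar>real i / real N - real i' / real N\<bar> \<le> 1 / real N" "\<bar>real j / real N - real j' / real N\<bar> \<le> 1 / real N"
        using that N by (simp_all add: divide_right_mono flip: diff_divide_distrib)
      then have "\<bar>real i / real N - real i' / real N\<bar> + \<bar>real j / real N - real j' / real N\<bar> \<le> 2 / real N"
        by simp
      then have "L * (\<bar>real i / real N - real i' / real N\<bar> + \<bar>real j / real N - real j' / real N\<bar>) \<le> L * (2 / real N)"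
        by (rule mult_left_mono) (rule L(1))
      also have "\<dots> < \<epsilon>" using N by (simp add: \<epsilon>_def divide_strict_right_mono)
      finally have lt: "L * (\<bar>real i / real N - real i' / real N\<bar> + \<bar>real j / real N - real j' / real N\<bar>) < \<epsilon>" .
      have "d (G i j) (G i' j') \<le> ennreal (L * (\<bar>real i / real N - real i' / real N\<bar> + \<bar>real j / real N - real j' / real N\<bar>))"
        using L(2)[OF mem] L(1) by (simp add: G_def l1_dist_def ennreal_mult)
      also have "\<dots> < ennreal \<epsilon>"
        using lt L(1) by (intro ennreal_lessI) (use eps in auto)
      finally show ?thesis .
    qed
    let ?h = "\<lambda>i j. E (G i j) (G (Suc i) j)" and ?v = "\<lambda>i j. E (G i j) (G i (Suc j))"
    have sq: "\<bar>?h i j + ?v (Suc i) j - ?h i (Suc j) - ?v i j\<bar> \<le> 2 * (K * \<epsilon>^3)" if "i < N" "j < N" for i j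
    proof -
      have t1: "\<bar>E (G i j) (G (Suc i) j) + E (G (Suc i) j) (G (Suc i) (Suc j)) + E (G (Suc i) (Suc j)) (G i j)\<bar> \<le> K * \<epsilon>^3"
        by (rule tri[OF eps eps0]) (use that in \<open>simp add: close\<close>)
      have t2: "\<bar>E (G i j) (G (Suc i) (Suc j)) + E (G (Suc i) (Suc j)) (G i (Suc j)) + E (G i (Suc j)) (G i j)\<bar> \<le> K * \<epsilon>^3"
        by (rule tri[OF eps eps0]) (use that in \<open>simp add: close\<close>)
      show ?thesis
        using t1 t2 anti[of "G i j" "G (Suc i) (Suc j)"] anti[of "G i (Suc j)" "G (Suc i) (Suc j)"] anti[of "G i j" "G i (Suc j)"]
        by linarith
    qed
    have "\<bar>\<Sum>i<N. \<Sum>j<N. ?h i j + ?v (Suc i) j - ?h i (Suc j) - ?v i j\<bar> \<le> (\<Sum>i<N. \<Sum>j<N. 2 * (K * \<epsilon>^3))"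
    proof (rule order_trans[OF sum_abs], rule sum_mono)
      fix i assume i: "i \<in> {..<N}"
      show "\<bar>\<Sum>j<N. ?h i j + ?v (Suc i) j - ?h i (Suc j) - ?v i j\<bar> \<le> (\<Sum>j<N. 2 * (K * \<epsilon>^3))"
        by (rule order_trans[OF sum_abs], rule sum_mono) (use i sq in auto)
    qed
    also have "\<dots> = C / real N"
      using N by (simp add: C_def \<epsilon>_def power3_eq_cube field_simps)
    finally have bound: "\<bar>(\<Sum>i<N. ?h i 0 - ?h i N) + (\<Sum>j<N. ?v N j - ?v 0 j)\<bar> \<le> C / real N"
      unfolding grid_sum_telescope[where h = ?h and v = ?v] .
    have "?h i 0 = 0" if "i < N" for i
      using that by (simp add: G_def bottom E0)
    moreover have "?h i N = E (\<gamma> (real i / real N)) (\<gamma> (real (Suc i) / real N))" if "i < N" for i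
      using that top[of "real i / real N"] top[of "real (Suc i) / real N"] by (simp add: G_def)
    moreover have "?v N j = 0" "?v 0 j = 0" if "j < N" for j
      using that by (simp_all add: G_def sides E0)
    ultimately have "(\<Sum>i<N. ?h i 0 - ?h i N) + (\<Sum>j<N. ?v N j - ?v 0 j)
      = - (\<Sum>i<N. E (\<gamma> (real i / real N)) (\<gamma> (real (Suc i) / real N)))"
      by (simp add: sum_negf)
    then show ?thesis using bound by simp
  qed
  then show ?thesis by blast
qed

text \<open>The class of \<gamma> in U contains \<gamma>, by the constant homotopy.  So \<gamma> belongs to the image of this class, which is
the class of the constant loop.\<close>

lemma trivial_map_imp_nullhomotopic:
  assumes "trivial_map (lip_pi1 d U p) (lip_pi1 d UNIV p) (lip_pi1_map d UNIV (\<lambda>x. x))"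
    and \<gamma>: "lip_loop d U p \<gamma>"
  shows "lip_homotopic d UNIV (\<lambda>_. p) \<gamma>"
proof -
  have path: "lip_path d U \<gamma>"
    using \<gamma> by (simp add: lip_loop_def)
  have refl: "lip_homotopic d T \<gamma> \<gamma>" if "U \<subseteq> T" for T
  proof -
    obtain L where L: "L \<ge> 0" "\<And>x y. x \<in> {0..1} \<Longrightarrow> y \<in> {0..1} \<Longrightarrow> d (\<gamma> x) (\<gamma> y) \<le> ennreal L * ennreal \<bar>x - y\<bar>"
      and im: "\<gamma> ` {0..1} \<subseteq> U"
      using path unfolding lip_path_def lipschitz_map_def by auto
    have "d (\<gamma> (fst x)) (\<gamma> (fst y)) \<le> ennreal L * l1_dist x y" if "x \<in> {0..1} \<times> {0..1}" "y \<in> {0..1} \<times> {0..1}" for x y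
    proof -
      have "d (\<gamma> (fst x)) (\<gamma> (fst y)) \<le> ennreal L * ennreal \<bar>fst x - fst y\<bar>"
        using L(2) that by auto
      also have "\<dots> \<le> ennreal L * l1_dist x y"
        unfolding l1_dist_def by (intro mult_left_mono ennreal_leI) auto
      finally show ?thesis .
    qed
    then have "lipschitz_map ({0..1} \<times> {0..1}) l1_dist T d (\<lambda>x. \<gamma> (fst x))"
      unfolding lipschitz_map_def using im \<open>U \<subseteq> T\<close> L(1) by (intro conjI exI[of _ L]) (auto simp: image_subset_iff subset_iff)
    then show ?thesis
      unfolding lip_homotopic_def by (intro exI[of _ "\<lambda>x. \<gamma> (fst x)"]) auto
  qed
  have "lip_class d U \<gamma> \<in> carrier (lip_pi1 d U p)"
    using \<gamma> by (auto simp: lip_pi1_def)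
  then have "lip_pi1_map d UNIV (\<lambda>x. x) (lip_class d U \<gamma>) = lip_class d UNIV (\<lambda>_. p)"
    using assms(1) by (auto simp: trivial_map_def lip_pi1_def)
  moreover have "\<gamma> \<in> lip_pi1_map d UNIV (\<lambda>x. x) (lip_class d U \<gamma>)"
    using refl by (auto simp: lip_pi1_map_def lip_class_def o_def)
  ultimately show ?thesis
    by (simp add: lip_class_def)
qed

section \<open>A closed horizontal lift of a planar figure eight\<close>

lemma interval_derivative_bound:
  fixes f :: "real \<Rightarrow> real"
  assumes "\<And>t. t \<in> {a..b} \<Longrightarrow> (f has_vector_derivative f' t) (at t within {a..b})"
    and "\<And>t. t \<in> {a..b} \<Longrightarrow> \<bar>f' t\<bar> \<le> B" "s \<in> {a..b}" "t \<in> {a..b}"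
  shows "\<bar>f t - f s\<bar> \<le> B * \<bar>t - s\<bar>"
proof -
  have "norm (f t - f s) \<le> B * norm (t - s)"
  proof (rule differentiable_bound[where S = "{a..b}" and f' = "\<lambda>t v. v *\<^sub>R f' t"])
    show "onorm (\<lambda>v. v *\<^sub>R f' x) \<le> B" if "x \<in> {a..b}" for x
    proof (rule onorm_le)
      fix v
      show "norm (v *\<^sub>R f' x) \<le> B * norm v"
        using mult_right_mono[OF assms(2)[OF that] abs_ge_zero[of v]] by (simp add: abs_mult mult.commute)
    qed
  qed (use assms in \<open>auto simp: has_vector_derivative_def\<close>)
  then show ?thesis by simp
qed

text \<open>The integral operator is a contraction on the continuous functions with values in [-\<delta>, \<delta>].  Functions on [-1, 1]
are represented by functions on the line that are constant outside this interval, which makes the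
space of bounded continuous functions available.\<close>

lemma picard_lindelof_scalar:
  fixes G :: "real \<Rightarrow> real \<Rightarrow> real"
  assumes cont: "continuous_on ({-1..1} \<times> {-\<delta>..\<delta>}) (\<lambda>(t, z). G t z)" and "\<delta> \<ge> 0"
    and bound: "\<And>t z. t \<in> {-1..1} \<Longrightarrow> z \<in> {-\<delta>..\<delta>} \<Longrightarrow> \<bar>G t z\<bar> \<le> \<delta> / 2"
    and lip: "\<And>t z z'. t \<in> {-1..1} \<Longrightarrow> z \<in> {-\<delta>..\<delta>} \<Longrightarrow> z' \<in> {-\<delta>..\<delta>} \<Longrightarrow> \<bar>G t z - G t z'\<bar> \<le> 1/4 * \<bar>z - z'\<bar>"
  shows "\<exists>z. z (-1) = 0 \<and> (\<forall>t\<in>{-1..1}. \<bar>z t\<bar> \<le> \<delta> \<and> (z has_vector_derivative G t (z t)) (at t within {-1..1}))"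
proof -
  define cl :: "real \<Rightarrow> real" where "cl t = max (-1) (min 1 t)" for t
  have cl: "cl t \<in> {-1..1}" "t \<in> {-1..1} \<Longrightarrow> cl t = t" for t
    by (auto simp: cl_def)
  define S :: "(real \<Rightarrow>\<^sub>C real) set" where "S = PiC UNIV (\<lambda>_. {-\<delta>..\<delta>})"
  have S: "f \<in> S \<longleftrightarrow> (\<forall>t. apply_bcontfun f t \<in> {-\<delta>..\<delta>})" for f
    by (simp add: S_def mem_PiC_iff Pi_iff)
  define I where "I f t = integral {-1..t} (\<lambda>s. G s (apply_bcontfun f s))" for f :: "real \<Rightarrow>\<^sub>C real" and t
  have contG: "continuous_on {-1..1} (\<lambda>s. G s (apply_bcontfun f s))" if "f \<in> S" for f
  proof -
    have "continuous_on {-1..1} (\<lambda>s. (s, apply_bcontfun f s))"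
      by (intro continuous_on_Pair continuous_on_id continuous_on_apply_bcontfun)
    moreover have "(\<lambda>s. (s, apply_bcontfun f s)) ` {-1..1} \<subseteq> {-1..1} \<times> {-\<delta>..\<delta>}"
      using that by (auto simp only: S)
    ultimately show ?thesis
      using continuous_on_compose2[OF cont] by fastforce
  qed
  have dI: "(I f has_vector_derivative G t (apply_bcontfun f t)) (at t within {-1..1})" if "f \<in> S" "t \<in> {-1..1}" for f t
    unfolding I_def by (rule integral_has_vector_derivative[OF contG[OF that(1)] that(2)])
  have I0: "I f (-1) = 0" for f
    by (simp add: I_def)
  have contI: "continuous_on UNIV (\<lambda>t. I f (cl t))" if "f \<in> S" for f
  proof (rule continuous_on_compose2[of "{-1..1}" "I f"])
    show "continuous_on {-1..1} (I f)"
      using has_vector_derivative_continuous[OF dI[OF that]] by (simp add: continuous_on_eq_continuous_within)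
  qed (auto simp: cl_def intro!: continuous_intros)
  have bI: "\<bar>I f t\<bar> \<le> \<delta>" if "f \<in> S" "t \<in> {-1..1}" for f t
  proof -
    have "\<bar>I f t - I f (-1)\<bar> \<le> \<delta> / 2 * \<bar>t - (-1)\<bar>"
      by (rule interval_derivative_bound[OF dI[OF that(1)]]) (use bound S that in auto)
    also have "\<dots> \<le> \<delta> / 2 * 2"
      using that(2) \<open>\<delta> \<ge> 0\<close> by (intro mult_left_mono) auto
    finally show ?thesis by (simp add: I0)
  qed
  have inb: "(\<lambda>t. I f (cl t)) \<in> bcontfun" if "f \<in> S" for f
    by (rule bcontfun_normI[OF contI[OF that]]) (use bI[OF that cl(1)] in auto)
  define T where "T f = Bcontfun (\<lambda>t. I f (cl t))" for f
  have T: "apply_bcontfun (T f) t = I f (cl t)" if "f \<in> S" for f t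
    unfolding T_def by (simp add: Bcontfun_inverse[OF inb[OF that]])
  have "\<exists>!f\<in>S. T f = f"
  proof (rule Banach_fix[where c = "1/2"])
    show "complete S"
      unfolding S_def complete_eq_closed by (rule closed_PiC) auto
    show "S \<noteq> {}"
      using S[of "const_bcontfun 0"] \<open>\<delta> \<ge> 0\<close> by (auto simp: const_bcontfun.rep_eq)
    show "T ` S \<subseteq> S"
    proof (rule image_subsetI)
      fix f assume f: "f \<in> S"
      have "I f (cl t) \<in> {-\<delta>..\<delta>}" for t
        using bI[OF f cl(1), of t] by (simp add: abs_le_iff)
      then show "T f \<in> S" using f by (simp add: S T)
    qed
    show "dist (T f) (T g) \<le> 1/2 * dist f g" if "f \<in> S" "g \<in> S" for f g
    proof (rule dist_bound)
      fix t
      have *: "((\<lambda>t. I f t - I g t) has_vector_derivative G t (apply_bcontfun f t) - G t (apply_bcontfun g t)) (at t within {-1..1})"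
        if "t \<in> {-1..1}" for t
        by (intro derivative_intros dI \<open>f \<in> S\<close> \<open>g \<in> S\<close> that)
      have **: "\<bar>G t (apply_bcontfun f t) - G t (apply_bcontfun g t)\<bar> \<le> 1/4 * dist f g" if t: "t \<in> {-1..1}" for t
      proof -
        have "\<bar>G t (apply_bcontfun f t) - G t (apply_bcontfun g t)\<bar> \<le> 1/4 * \<bar>apply_bcontfun f t - apply_bcontfun g t\<bar>"
          using lip[OF t] S \<open>f \<in> S\<close> \<open>g \<in> S\<close> by blast
        then show ?thesis using dist_bounded[of f t g] by (simp add: dist_real_def)
      qed
      have "\<bar>(I f (cl t) - I g (cl t)) - (I f (-1) - I g (-1))\<bar> \<le> 1/4 * dist f g * \<bar>cl t - (-1)\<bar>"
        by (rule interval_derivative_bound[OF * **]) (use cl in auto)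
      also have "\<dots> \<le> 1/4 * dist f g * 2"
        by (rule mult_left_mono) (use cl(1)[of t] in auto)
      finally show "dist (apply_bcontfun (T f) t) (apply_bcontfun (T g) t) \<le> 1/2 * dist f g"
        by (simp add: T that dist_real_def I0)
    qed
  qed auto
  then obtain f where f: "f \<in> S" "T f = f" by blast
  have fixp: "apply_bcontfun f t = I f t" if "t \<in> {-1..1}" for t
    using T[OF f(1), of t] f(2) cl(2)[OF that] by simp
  show ?thesis
  proof (intro exI[of _ "I f"] conjI ballI)
    fix t :: real assume t: "t \<in> {-1..1}"
    show "\<bar>I f t\<bar> \<le> \<delta>" by (rule bI[OF f(1) t])
    show "(I f has_vector_derivative G t (I f t)) (at t within {-1..1})"
      using dI[OF f(1) t] unfolding fixp[OF t] .
  qed (rule I0)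
qed

text \<open>At a maximum m of |z1 - z2| the difference is the integral of G1 z1 - G2 z2 over an interval of length at most 2,
which is at most half the maximum plus 2 \<eta>.\<close>

lemma ode_solutions_close:
  fixes G1 G2 :: "real \<Rightarrow> real \<Rightarrow> real"
  assumes z1: "z1 (-1) = z2 (-1)" "\<And>t. t \<in> {-1..1} \<Longrightarrow> z1 t \<in> {-\<delta>..\<delta>}" "\<And>t. t \<in> {-1..1} \<Longrightarrow> (z1 has_vector_derivative G1 t (z1 t)) (at t within {-1..1})"
    and z2: "\<And>t. t \<in> {-1..1} \<Longrightarrow> z2 t \<in> {-\<delta>..\<delta>}" "\<And>t. t \<in> {-1..1} \<Longrightarrow> (z2 has_vector_derivative G2 t (z2 t)) (at t within {-1..1})"
    and lip: "\<And>t z z'. t \<in> {-1..1} \<Longrightarrow> z \<in> {-\<delta>..\<delta>} \<Longrightarrow> z' \<in> {-\<delta>..\<delta>} \<Longrightarrow> \<bar>G1 t z - G1 t z'\<bar> \<le> 1/4 * \<bar>z - z'\<bar>"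
    and close: "\<And>t z. t \<in> {-1..1} \<Longrightarrow> z \<in> {-\<delta>..\<delta>} \<Longrightarrow> \<bar>G1 t z - G2 t z\<bar> \<le> \<eta>"
    and t: "t \<in> {-1..1}"
  shows "\<bar>z1 t - z2 t\<bar> \<le> 4 * \<eta>"
proof -
  have d: "((\<lambda>t. z1 t - z2 t) has_vector_derivative G1 t (z1 t) - G2 t (z2 t)) (at t within {-1..1})" if "t \<in> {-1..1}" for t
    by (intro derivative_intros z1 z2 that)
  have "continuous_on {-1..1} (\<lambda>t. \<bar>z1 t - z2 t\<bar>)"
    using has_vector_derivative_continuous[OF d] by (intro continuous_on_rabs) (simp add: continuous_on_eq_continuous_within)
  then obtain m where m: "m \<in> {-1..1}" "\<And>t. t \<in> {-1..1} \<Longrightarrow> \<bar>z1 t - z2 t\<bar> \<le> \<bar>z1 m - z2 m\<bar>"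
    using continuous_attains_sup[of "{-1..1::real}" "\<lambda>t. \<bar>z1 t - z2 t\<bar>"] by auto
  let ?M = "\<bar>z1 m - z2 m\<bar>"
  have b: "\<bar>G1 t (z1 t) - G2 t (z2 t)\<bar> \<le> 1/4 * ?M + \<eta>" if t: "t \<in> {-1..1}" for t
    using lip[OF t z1(2)[OF t] z2(1)[OF t]] close[OF t z2(1)[OF t]] m(2)[OF t]
      abs_triangle_ineq[of "G1 t (z1 t) - G1 t (z2 t)" "G1 t (z2 t) - G2 t (z2 t)"] by simp
  have "\<bar>(z1 m - z2 m) - (z1 (-1) - z2 (-1))\<bar> \<le> (1/4 * ?M + \<eta>) * \<bar>m - (-1)\<bar>"
    by (rule interval_derivative_bound[OF d b]) (use m in auto)
  also have "\<dots> \<le> (1/4 * ?M + \<eta>) * 2"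
    by (rule mult_left_mono) (use m b[OF m(1)] in auto)
  finally have "?M \<le> 4 * \<eta>" using z1(1) by simp
  then show ?thesis using m(2)[OF t] by linarith
qed

definition vec3 :: "real \<Rightarrow> real \<Rightarrow> real \<Rightarrow> real^3" where
  "vec3 x y z = x *\<^sub>R axis 1 1 + y *\<^sub>R axis 2 1 + z *\<^sub>R axis 3 1"

lemma vec3_nth [simp]: "vec3 x y z $ 1 = x" "vec3 x y z $ 2 = y" "vec3 x y z $ 3 = z"
  by (auto simp: vec3_def axis_def)

lemma norm_vec3_le: "norm (vec3 x y z) \<le> \<bar>x\<bar> + \<bar>y\<bar> + \<bar>z\<bar>"
  using norm_le_l1_cart[of "vec3 x y z"] by (simp add: sum_3)

lemma vec3_diff: "vec3 x y z - vec3 x' y' z' = vec3 (x - x') (y - y') (z - z')"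
  by (simp add: vec3_def algebra_simps)

lemma continuous_on_vec3 [continuous_intros]:
  "continuous_on S f \<Longrightarrow> continuous_on S g \<Longrightarrow> continuous_on S h \<Longrightarrow> continuous_on S (\<lambda>x. vec3 (f x) (g x) (h x))"
  unfolding vec3_def by (intro continuous_intros)

lemma abs_sum_of_products_le: "\<bar>a * b + c * d\<bar> \<le> \<bar>a\<bar> * \<bar>b\<bar> + \<bar>c\<bar> * \<bar>d\<bar>" for a b c d :: real
  using abs_triangle_ineq[of "a * b" "c * d"] by (simp add: abs_mult)

text \<open>The curve (loop_x, loop_y l) on [-1, 1] is closed.  For l = 0 both coordinates are odd and the signed
area enclosed is 0; the even term l (1 - t^2) makes the area proportional to l.\<close>

definition loop_x :: "real \<Rightarrow> real" where "loop_x t = t - t^3"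
definition loop_y :: "real \<Rightarrow> real \<Rightarrow> real" where "loop_y l t = l * (1 - t^2) + t^3 - t^5"
definition loop_x' :: "real \<Rightarrow> real" where "loop_x' t = 1 - 3 * t^2"
definition loop_y' :: "real \<Rightarrow> real \<Rightarrow> real" where "loop_y' l t = - 2 * l * t + 3 * t^2 - 5 * t^4"

lemma loop_derivatives:
  "(loop_x has_real_derivative loop_x' t) (at t within S)"
  "(loop_y l has_real_derivative loop_y' l t) (at t within S)"
  unfolding loop_x_def[abs_def] loop_y_def[abs_def] loop_x'_def loop_y'_def
  by (auto intro!: derivative_eq_intros)

lemma loop_ends: "loop_x 1 = 0" "loop_x (-1) = 0" "loop_y l 1 = 0" "loop_y l (-1) = 0"
  by (simp_all add: loop_x_def loop_y_def)

lemma loop_bounds: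
  assumes t: "t \<in> {-1..1}" and l: "\<bar>l\<bar> \<le> 1"
  shows "\<bar>loop_x t\<bar> \<le> 2" "\<bar>loop_y l t\<bar> \<le> 3" "\<bar>loop_x' t\<bar> \<le> 4" "\<bar>loop_y' l t\<bar> \<le> 10"
proof -
  have pow: "\<bar>t^n\<bar> \<le> 1" for n
    using t by (simp add: power_abs power_le_one abs_le_iff)
  have t1: "\<bar>t\<bar> \<le> 1" using t by auto
  have sq: "0 \<le> t^2" "t^2 \<le> 1" using pow[of 2] by auto
  have "\<bar>l * (1 - t^2)\<bar> \<le> 1 * 1"
    unfolding abs_mult using l sq by (intro mult_mono) auto
  then show "\<bar>loop_y l t\<bar> \<le> 3"
    using pow[of 3] pow[of 5] by (simp add: loop_y_def)
  have "\<bar>l * t\<bar> \<le> 1 * 1"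
    unfolding abs_mult using l t1 by (intro mult_mono) auto
  then have lt: "l * t \<le> 1" "-1 \<le> l * t" by (auto simp: abs_le_iff)
  have "0 \<le> t^4" "t^4 \<le> 1" using pow[of 4] by auto
  then have "-2 * (l * t) + 3 * t^2 - 5 * t^4 \<le> 10" "- 10 \<le> -2 * (l * t) + 3 * t^2 - 5 * t^4"
    using sq lt by linarith+
  then show "\<bar>loop_y' l t\<bar> \<le> 10"
    unfolding loop_y'_def by (simp add: abs_le_iff mult.assoc)
  show "\<bar>loop_x t\<bar> \<le> 2"
    using pow[of 3] t1 by (simp add: loop_x_def)
  show "\<bar>loop_x' t\<bar> \<le> 4"
    unfolding loop_x'_def using sq by linarith
qed

lemma loop_y_diff:
  assumes t: "t \<in> {-1..1}"
  shows "\<bar>loop_y l t - loop_y m t\<bar> \<le> \<bar>l - m\<bar>" "\<bar>loop_y' l t - loop_y' m t\<bar> \<le> 2 * \<bar>l - m\<bar>"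
proof -
  have t1: "\<bar>t\<bar> \<le> 1" using t by auto
  then have sq: "0 \<le> t^2" "t^2 \<le> 1" by (auto simp: abs_square_le_1)
  have "loop_y l t - loop_y m t = (l - m) * (1 - t^2)" "loop_y' l t - loop_y' m t = -2 * ((l - m) * t)"
    by (simp_all add: loop_y_def loop_y'_def algebra_simps)
  moreover have "\<bar>(l - m) * (1 - t^2)\<bar> \<le> \<bar>l - m\<bar> * 1" "\<bar>(l - m) * t\<bar> \<le> \<bar>l - m\<bar> * 1"
    unfolding abs_mult using t1 sq by (intro mult_left_mono; simp)+
  ultimately show "\<bar>loop_y l t - loop_y m t\<bar> \<le> \<bar>l - m\<bar>" "\<bar>loop_y' l t - loop_y' m t\<bar> \<le> 2 * \<bar>l - m\<bar>"
    by (simp_all add: abs_mult)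
qed

text \<open>A primitive of y x' along the curve.\<close>

definition loop_area :: "real \<Rightarrow> real \<Rightarrow> real" where
  "loop_area l t = l * (t - 4 * t^3 / 3 + 3 * t^5 / 5) + t^4 / 4 - 2 * t^6 / 3 + 3 * t^8 / 8"

text \<open>A primitive of x y x' along the curve.  Its increment over [-1, 1] is the same for all l, as the term that
contains l is even.\<close>

definition loop_moment :: "real \<Rightarrow> real \<Rightarrow> real" where
  "loop_moment l t = l * (t^2 / 2 - 5 * t^4 / 4 + 7 * t^6 / 6 - 3 * t^8 / 8) + t^5 / 5 - 5 * t^7 / 7 + 7 * t^9 / 9 - 3 * t^11 / 11"

lemma loop_area_derivative: "(loop_area l has_real_derivative loop_y l t * loop_x' t) (at t within S)"
  unfolding loop_area_def[abs_def] loop_y_def loop_x'_def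
  by (rule derivative_eq_intros refl | simp)+ (simp add: field_simps power_numeral_reduce)

lemma loop_moment_derivative: "(loop_moment l has_real_derivative loop_x t * loop_y l t * loop_x' t) (at t within S)"
  unfolding loop_moment_def[abs_def] loop_y_def loop_x'_def loop_x_def
  by (rule derivative_eq_intros refl | simp)+ (simp add: field_simps power_numeral_reduce)

lemma loop_area_total: "loop_area l 1 - loop_area l (-1) = 8 / 15 * l"
  by (simp add: loop_area_def field_simps)

lemma loop_moment_total: "loop_moment l 1 - loop_moment l (-1) = - 64 / 3465"
  by (simp add: loop_moment_def field_simps)

text \<open>The lift with parameter l starts at height 0 and ends at a height within O(r^3) of
(8/15) r^2 l (p2 - q1): the quadratic terms p1 x x' + q2 y y' are exact, and p2 y x' + q1 x y' integrates to
p2 - q1 times the integral of y x', which is (8/15) l.  For small r the end heights for l = 1 and l = -1 have opposite signs, and the end height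
depends continuously on l.\<close>

lemma closed_contact_loop_exists:
  fixes P Q :: "real^3 \<Rightarrow> real"
  assumes "R > 0" "\<delta> > 0"
    and P: "C-lipschitz_on (cball 0 R) P" and Q: "C-lipschitz_on (cball 0 R) Q"
    and tP: "\<And>v. v \<in> cball 0 R \<Longrightarrow> \<bar>P v - (p1 * v$1 + p2 * v$2 + p3 * v$3)\<bar> \<le> C * (norm v)\<^sup>2"
    and tQ: "\<And>v. v \<in> cball 0 R \<Longrightarrow> \<bar>Q v - (q1 * v$1 + q2 * v$2 + q3 * v$3)\<bar> \<le> C * (norm v)\<^sup>2"
    and p3: "\<bar>p3\<bar> \<le> C" and q3: "\<bar>q3\<bar> \<le> C" and twist: "p2 \<noteq> q1"
  obtains r l z where "0 < r" "r \<le> \<delta>" "10 * r \<le> R" "\<bar>l\<bar> \<le> 1" "z (-1) = 0" "z 1 = (0::real)"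
    "\<forall>t\<in>{-1..1}. \<bar>z t\<bar> \<le> r"
    "\<forall>t\<in>{-1..1}. (z has_vector_derivative
        P (vec3 (r * loop_x t) (r * loop_y l t) (z t)) * (r * loop_x' t)
      + Q (vec3 (r * loop_x t) (r * loop_y l t) (z t)) * (r * loop_y' l t)) (at t within {-1..1})"
proof -
  have "C \<ge> 0" by (rule lipschitz_on_nonneg[OF P])
  note lipP = lipschitz_on_real_bound[OF P] and lipQ = lipschitz_on_real_bound[OF Q]
  define k where "k = p2 - q1"
  have k: "k \<noteq> 0" using twist by (simp add: k_def)
  define C' where "C' = 14 * (280 * C * C + 100 * C)"
  have C': "C' \<ge> 0" using \<open>C \<ge> 0\<close> by (simp add: C'_def)
  define a where "a = \<bar>k\<bar> * (8 / 15)"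
  have a: "a > 0" using k by (simp add: a_def)
  \<comment> \<open>the third bound makes the integral operator a contraction on functions with values in [-r, r];
    the last one makes the error 2 C' r^3 smaller than the leading term of the height at l = 1\<close>
  define r where "r = min \<delta> (min (R / 10) (min (1 / (280 * (C + 1))) (a / (2 * C' + 1))))"
  have r: "r > 0" "r \<le> \<delta>" "r \<le> R / 10" "r \<le> 1 / (280 * (C + 1))" "r \<le> a / (2 * C' + 1)"
  proof -
    have "0 < 1 / (280 * (C + 1))" "0 < a / (2 * C' + 1)"
      using \<open>C \<ge> 0\<close> a C' by simp_all
    then show "r > 0"
      unfolding r_def min_less_iff_conj using \<open>R > 0\<close> \<open>\<delta> > 0\<close> by simp
    show "r \<le> \<delta>" "r \<le> R / 10" "r \<le> 1 / (280 * (C + 1))" "r \<le> a / (2 * C' + 1)"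
      unfolding r_def by (simp_all only: min_le_iff_disj order_refl simp_thms)
  qed
  have rC: "280 * C * r \<le> 1" "280 * r \<le> 1"
  proof -
    have "r * (280 * (C + 1)) \<le> 1" using r(4) \<open>C \<ge> 0\<close> by (subst (asm) pos_le_divide_eq) simp_all
    then have "280 * C * r + 280 * r \<le> 1" by (simp add: algebra_simps)
    moreover have "280 * C * r \<ge> 0" using \<open>C \<ge> 0\<close> r(1) by simp
    ultimately show "280 * C * r \<le> 1" "280 * r \<le> 1" using r(1) by linarith+
  qed
  have small: "2 * C' * r < a"
  proof -
    have "r * (2 * C' + 1) \<le> a" using r(5) C' by (subst (asm) pos_le_divide_eq) simp_all
    then show ?thesis using r(1) by (simp add: algebra_simps)
  qed
  define V where "V l t z = vec3 (r * loop_x t) (r * loop_y l t) z" for l t z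
  define G where "G l t z = P (V l t z) * (r * loop_x' t) + Q (V l t z) * (r * loop_y' l t)" for l t z
  have P0: "P 0 = 0" and Q0: "Q 0 = 0"
    using tP[of 0] tQ[of 0] \<open>R > 0\<close> by auto
  have V: "norm (V l t z) \<le> 10 * r" if "t \<in> {-1..1}" "\<bar>l\<bar> \<le> 1" "z \<in> {-r..r}" for l t z
  proof -
    have "norm (V l t z) \<le> \<bar>r * loop_x t\<bar> + \<bar>r * loop_y l t\<bar> + \<bar>z\<bar>"
      unfolding V_def by (rule norm_vec3_le)
    also have "\<dots> \<le> r * 2 + r * 3 + r"
      unfolding abs_mult using loop_bounds[OF that(1,2)] r(1) that(3) by (intro add_mono mult_mono) auto
    also have "\<dots> \<le> 10 * r" using r(1) by simp
    finally show ?thesis .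
  qed
  have VB: "V l t z \<in> cball 0 R" if "t \<in> {-1..1}" "\<bar>l\<bar> \<le> 1" "z \<in> {-r..r}" for l t z
    using V[OF that] r(3) by simp
  have PV: "\<bar>P (V l t z)\<bar> \<le> C * (10 * r)" "\<bar>Q (V l t z)\<bar> \<le> C * (10 * r)"
    if "t \<in> {-1..1}" "\<bar>l\<bar> \<le> 1" "z \<in> {-r..r}" for l t z
    using lipP[of 0 "V l t z"] lipQ[of 0 "V l t z"] VB[OF that] mult_left_mono[OF V[OF that] \<open>C \<ge> 0\<close>] P0 Q0 \<open>R > 0\<close>
    by auto
  have x': "\<bar>r * loop_x' t\<bar> \<le> r * 4" and y': "\<bar>r * loop_y' l t\<bar> \<le> r * 10" if "t \<in> {-1..1}" "\<bar>l\<bar> \<le> 1" for t l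
    using loop_bounds[OF that] r(1) by (simp_all add: abs_mult)
  have Gb: "\<bar>G l t z\<bar> \<le> 140 * C * r * r" if "t \<in> {-1..1}" "\<bar>l\<bar> \<le> 1" "z \<in> {-r..r}" for l t z
  proof -
    have "\<bar>G l t z\<bar> \<le> \<bar>P (V l t z)\<bar> * \<bar>r * loop_x' t\<bar> + \<bar>Q (V l t z)\<bar> * \<bar>r * loop_y' l t\<bar>"
      unfolding G_def by (rule abs_sum_of_products_le)
    also have "\<dots> \<le> (C * (10 * r)) * (r * 4) + (C * (10 * r)) * (r * 10)"
      using PV[OF that] x'[OF that(1,2)] y'[OF that(1,2)] \<open>C \<ge> 0\<close> r(1) by (intro add_mono mult_mono) auto
    finally show ?thesis by simp
  qed
  have Gb2: "140 * C * r * r \<le> r / 2"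
    using mult_right_mono[OF rC(1), of "r / 2"] r(1) by simp
  have Vdiff: "norm (V l t z - V m t z') \<le> r * \<bar>l - m\<bar> + \<bar>z - z'\<bar>" if "t \<in> {-1..1}" for l m t z z'
  proof -
    have "V l t z - V m t z' = vec3 0 (r * (loop_y l t - loop_y m t)) (z - z')"
      by (simp add: V_def vec3_diff algebra_simps)
    also have "norm \<dots> \<le> \<bar>r * (loop_y l t - loop_y m t)\<bar> + \<bar>z - z'\<bar>"
      using norm_vec3_le[of 0] by auto
    also have "\<dots> \<le> r * \<bar>l - m\<bar> + \<bar>z - z'\<bar>"
      using loop_y_diff(1)[OF that] r(1) by (simp add: abs_mult)
    finally show ?thesis .
  qed
  have Glip: "\<bar>G l t z - G l t z'\<bar> \<le> 1/4 * \<bar>z - z'\<bar>"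
    if "t \<in> {-1..1}" "\<bar>l\<bar> \<le> 1" "z \<in> {-r..r}" "z' \<in> {-r..r}" for l t z z'
  proof -
    have VB': "V l t z \<in> cball 0 R" "V l t z' \<in> cball 0 R"
      using VB that by blast+
    have n: "C * norm (V l t z - V l t z') \<le> C * \<bar>z - z'\<bar>"
      using Vdiff[OF that(1), of l z l z'] \<open>C \<ge> 0\<close> by (intro mult_left_mono) auto
    have "G l t z - G l t z' = (P (V l t z) - P (V l t z')) * (r * loop_x' t) + (Q (V l t z) - Q (V l t z')) * (r * loop_y' l t)"
      by (simp add: G_def algebra_simps)
    also have "\<bar>\<dots>\<bar> \<le> \<bar>P (V l t z) - P (V l t z')\<bar> * \<bar>r * loop_x' t\<bar> + \<bar>Q (V l t z) - Q (V l t z')\<bar> * \<bar>r * loop_y' l t\<bar>"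
      by (rule abs_sum_of_products_le)
    also have "\<dots> \<le> (C * \<bar>z - z'\<bar>) * (r * 4) + (C * \<bar>z - z'\<bar>) * (r * 10)"
      using order_trans[OF lipP[OF VB'(2,1)] n] order_trans[OF lipQ[OF VB'(2,1)] n]
        x'[OF that(1,2)] y'[OF that(1,2)] \<open>C \<ge> 0\<close> r(1) by (intro add_mono mult_mono) auto
    also have "\<dots> = (14 * C * r) * \<bar>z - z'\<bar>" by (simp add: algebra_simps)
    also have "\<dots> \<le> 1/4 * \<bar>z - z'\<bar>"
      using rC(1) by (intro mult_right_mono) auto
    finally show ?thesis .
  qed
  have Gl: "\<bar>G l t z - G m t z\<bar> \<le> 34 * C * r * r * \<bar>l - m\<bar>"
    if "t \<in> {-1..1}" "\<bar>l\<bar> \<le> 1" "\<bar>m\<bar> \<le> 1" "z \<in> {-r..r}" for l m t z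
  proof -
    have VB': "V l t z \<in> cball 0 R" "V m t z \<in> cball 0 R"
      using VB that by blast+
    have n: "C * norm (V l t z - V m t z) \<le> C * (r * \<bar>l - m\<bar>)"
      using Vdiff[OF that(1), of l z m z] \<open>C \<ge> 0\<close> by (intro mult_left_mono) auto
    have y'd: "\<bar>r * (loop_y' l t - loop_y' m t)\<bar> \<le> r * (2 * \<bar>l - m\<bar>)"
      unfolding abs_mult using r(1) by (intro mult_mono loop_y_diff(2)[OF that(1)]) simp_all
    have "G l t z - G m t z = (P (V l t z) - P (V m t z)) * (r * loop_x' t) + (Q (V l t z) - Q (V m t z)) * (r * loop_y' l t)
          + Q (V m t z) * (r * (loop_y' l t - loop_y' m t))"
      by (simp add: G_def algebra_simps)
    also have "\<bar>\<dots>\<bar> \<le> \<bar>P (V l t z) - P (V m t z)\<bar> * \<bar>r * loop_x' t\<bar> + \<bar>Q (V l t z) - Q (V m t z)\<bar> * \<bar>r * loop_y' l t\<bar>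
          + \<bar>Q (V m t z)\<bar> * \<bar>r * (loop_y' l t - loop_y' m t)\<bar>"
      unfolding abs_mult[symmetric] by (rule order_trans[OF abs_triangle_ineq add_right_mono[OF abs_triangle_ineq]])
    also have "\<dots> \<le> (C * (r * \<bar>l - m\<bar>)) * (r * 4) + (C * (r * \<bar>l - m\<bar>)) * (r * 10) + (C * (10 * r)) * (r * (2 * \<bar>l - m\<bar>))"
      by (intro add_mono mult_mono order_trans[OF lipP[OF VB'(2,1)] n] order_trans[OF lipQ[OF VB'(2,1)] n]
          PV(2)[OF that(1,3,4)] y'd x'[OF that(1,2)] y'[OF that(1,2)])
        (use \<open>C \<ge> 0\<close> r(1) in simp_all)
    also have "\<dots> = 34 * C * r * r * \<bar>l - m\<bar>" by simp
    finally show ?thesis .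
  qed
  note contP = lipschitz_on_continuous_on[OF P] and contQ = lipschitz_on_continuous_on[OF Q]
  have "\<exists>z. z (-1) = 0 \<and> (\<forall>t\<in>{-1..1}. \<bar>z t\<bar> \<le> r \<and> (z has_vector_derivative G l t (z t)) (at t within {-1..1}))"
    if l: "\<bar>l\<bar> \<le> 1" for l
  proof (rule picard_lindelof_scalar)
    have cV: "continuous_on ({-1..1} \<times> {-r..r}) (\<lambda>x. V l (fst x) (snd x))"
      unfolding V_def loop_x_def loop_y_def by (intro continuous_intros)
    have sub: "(\<lambda>x. V l (fst x) (snd x)) ` ({-1..1} \<times> {-r..r}) \<subseteq> cball 0 R"
    proof (rule image_subsetI)
      fix x :: "real \<times> real" assume "x \<in> {-1..1} \<times> {-r..r}"
      then show "V l (fst x) (snd x) \<in> cball 0 R"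
        by (intro VB l) (simp_all add: mem_Times_iff)
    qed
    show "continuous_on ({-1..1} \<times> {-r..r}) (\<lambda>(t, z). G l t z)"
      unfolding G_def case_prod_unfold loop_x'_def loop_y'_def
      by (intro continuous_on_add continuous_on_mult continuous_on_compose2[OF contP cV sub]
          continuous_on_compose2[OF contQ cV sub] continuous_on_diff continuous_on_const
          continuous_on_fst continuous_on_power continuous_on_id)
    show "\<bar>G l t z\<bar> \<le> r / 2" if "t \<in> {-1..1}" "z \<in> {-r..r}" for t z
      using Gb[OF that(1) l that(2)] Gb2 by linarith
  qed (use r(1) Glip l in auto)
  then have "\<forall>l. \<exists>z. \<bar>l\<bar> \<le> 1 \<longrightarrow> z (-1) = 0 \<and> (\<forall>t\<in>{-1..1}. \<bar>z t\<bar> \<le> r \<and> (z has_vector_derivative G l t (z t)) (at t within {-1..1}))"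
    by blast
  from choice[OF this] obtain z where zz: "\<And>l. \<bar>l\<bar> \<le> 1 \<Longrightarrow> z l (-1) = 0 \<and> (\<forall>t\<in>{-1..1}. \<bar>z l t\<bar> \<le> r \<and> (z l has_vector_derivative G l t (z l t)) (at t within {-1..1}))"
    by blast
  have z: "\<And>l. \<bar>l\<bar> \<le> 1 \<Longrightarrow> z l (-1) = 0"
    "\<And>l t. \<bar>l\<bar> \<le> 1 \<Longrightarrow> t \<in> {-1..1} \<Longrightarrow> z l t \<in> {-r..r}"
    "\<And>l t. \<bar>l\<bar> \<le> 1 \<Longrightarrow> t \<in> {-1..1} \<Longrightarrow> (z l has_vector_derivative G l t (z l t)) (at t within {-1..1})"
    using zz by (blast, force simp: abs_le_iff, blast)
  have zl: "\<bar>z l 1 - z m 1\<bar> \<le> 4 * (34 * C * r * r * \<bar>l - m\<bar>)" if "\<bar>l\<bar> \<le> 1" "\<bar>m\<bar> \<le> 1" for l m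
    by (rule ode_solutions_close[where \<delta> = r and ?G1.0 = "G l" and ?G2.0 = "G m"])
       (use z that Glip Gl in auto)
  have "continuous_on {-1..1} (\<lambda>l. z l 1)"
    by (rule lipschitz_on_continuous_on[where L = "4 * (34 * C * r * r)"])
       (use zl \<open>C \<ge> 0\<close> r(1) in \<open>auto simp: lipschitz_on_def dist_real_def mult.assoc\<close>)
  then have cont: "continuous_on {-1..1} (\<lambda>l. k * z l 1)"
    by (intro continuous_intros)
  \<comment> \<open>r^2 M is the height gained to leading order, a primitive of the quadratic part of the equation\<close>
  have height: "\<bar>z l 1 - r\<^sup>2 * (k * (8/15 * l))\<bar> \<le> 2 * C' * r^3" if l: "\<bar>l\<bar> \<le> 1" for l
  proof -
    define M where "M t = p1 * (loop_x t * loop_x t) / 2 + q2 * (loop_y l t * loop_y l t) / 2 + q1 * (loop_x t * loop_y l t) + k * loop_area l t" for t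
    define M' where "M' t = (p1 * loop_x t + p2 * loop_y l t) * loop_x' t + (q1 * loop_x t + q2 * loop_y l t) * loop_y' l t" for t
    have M: "(M has_real_derivative M' t) (at t within {-1..1})" for t
    proof -
      have "(M has_real_derivative
          p1 * (loop_x' t * loop_x t + loop_x' t * loop_x t) / 2
        + q2 * (loop_y' l t * loop_y l t + loop_y' l t * loop_y l t) / 2
        + q1 * (loop_x' t * loop_y l t + loop_y' l t * loop_x t)
        + k * (loop_y l t * loop_x' t)) (at t within {-1..1})"
        unfolding M_def[abs_def]
        by (intro DERIV_add DERIV_cdivide DERIV_cmult DERIV_mult loop_derivatives loop_area_derivative)
      then show ?thesis
        by (rule DERIV_cong) (simp add: M'_def k_def field_simps)
    qed
    have d: "((\<lambda>t. z l t - r\<^sup>2 * M t) has_vector_derivative G l t (z l t) - r\<^sup>2 * M' t) (at t within {-1..1})"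
      if "t \<in> {-1..1}" for t
      using M by (intro derivative_intros z(3) l that has_vector_derivative_mult_right)
        (simp add: has_real_derivative_iff_has_vector_derivative)
    have zq: "\<bar>z l t\<bar> \<le> 280 * C * r * r" if t: "t \<in> {-1..1}" for t
    proof -
      have "\<bar>z l t - z l (-1)\<bar> \<le> 140 * C * r * r * \<bar>t - (-1)\<bar>"
        by (rule interval_derivative_bound[OF z(3)[OF l] Gb[OF _ l z(2)[OF l]]]) (use t in auto)
      also have "\<dots> \<le> 140 * C * r * r * 2"
        using t \<open>C \<ge> 0\<close> r(1) by (intro mult_left_mono) auto
      finally show ?thesis using z(1)[OF l] by simp
    qed
    have b: "\<bar>G l t (z l t) - r\<^sup>2 * M' t\<bar> \<le> C' * r^3" if t: "t \<in> {-1..1}" for t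
    proof -
      let ?V = "V l t (z l t)"
      have VB': "?V \<in> cball 0 R" by (rule VB[OF t l z(2)[OF l t]])
      have nV: "C * (norm ?V)\<^sup>2 \<le> C * (10 * r)\<^sup>2"
        by (intro mult_left_mono power_mono V[OF t l z(2)[OF l t]] norm_ge_zero \<open>C \<ge> 0\<close>)
      have nV': "C * (10 * r)\<^sup>2 = 100 * C * r * r"
        by (simp add: power2_eq_square)
      have Vn: "?V $ 1 = r * loop_x t" "?V $ 2 = r * loop_y l t" "?V $ 3 = z l t"
        by (simp_all add: V_def)
      let ?eP = "P ?V - (p1 * (r * loop_x t) + p2 * (r * loop_y l t) + p3 * z l t)"
      let ?eQ = "Q ?V - (q1 * (r * loop_x t) + q2 * (r * loop_y l t) + q3 * z l t)"
      have eP: "\<bar>?eP\<bar> \<le> 100 * C * r * r"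
        using order_trans[OF tP[OF VB'] nV] unfolding Vn nV' .
      have eQ: "\<bar>?eQ\<bar> \<le> 100 * C * r * r"
        using order_trans[OF tQ[OF VB'] nV] unfolding Vn nV' .
      have z3: "\<bar>p3 * z l t\<bar> \<le> C * (280 * C * r * r)" "\<bar>q3 * z l t\<bar> \<le> C * (280 * C * r * r)"
        unfolding abs_mult using \<open>C \<ge> 0\<close> by (intro mult_mono zq[OF t] p3 q3; simp)+
      have A1: "\<bar>?eP + p3 * z l t\<bar> \<le> 100 * C * r * r + C * (280 * C * r * r)"
        by (rule order_trans[OF abs_triangle_ineq add_mono[OF eP z3(1)]])
      have A2: "\<bar>?eQ + q3 * z l t\<bar> \<le> 100 * C * r * r + C * (280 * C * r * r)"
        by (rule order_trans[OF abs_triangle_ineq add_mono[OF eQ z3(2)]])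
      have nn: "0 \<le> 100 * C * r * r + C * (280 * C * r * r)"
        using \<open>C \<ge> 0\<close> r(1) by simp
      have expand: "p * (r * a) + q * (r * b) - r\<^sup>2 * ((p1 * x + p2 * y) * a + (q1 * x + q2 * y) * b)
          = ((p - (p1 * (r * x) + p2 * (r * y) + p3 * w)) + p3 * w) * (r * a)
          + ((q - (q1 * (r * x) + q2 * (r * y) + q3 * w)) + q3 * w) * (r * b)" for p q a b x y w
        by (simp add: algebra_simps power2_eq_square)
      have eq: "G l t (z l t) - r\<^sup>2 * M' t = (?eP + p3 * z l t) * (r * loop_x' t) + (?eQ + q3 * z l t) * (r * loop_y' l t)"
        unfolding G_def M'_def by (rule expand)
      have "\<bar>G l t (z l t) - r\<^sup>2 * M' t\<bar> \<le> \<bar>?eP + p3 * z l t\<bar> * \<bar>r * loop_x' t\<bar> + \<bar>?eQ + q3 * z l t\<bar> * \<bar>r * loop_y' l t\<bar>"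
        unfolding eq by (rule abs_sum_of_products_le)
      also have "\<dots> \<le> (100 * C * r * r + C * (280 * C * r * r)) * (r * 4) + (100 * C * r * r + C * (280 * C * r * r)) * (r * 10)"
        by (rule add_mono[OF mult_mono[OF A1 x'[OF t l] nn abs_ge_zero] mult_mono[OF A2 y'[OF t l] nn abs_ge_zero]])
      also have "\<dots> = C' * r^3"
        by (simp add: C'_def algebra_simps power3_eq_cube)
      finally show ?thesis .
    qed
    have "\<bar>(z l 1 - r\<^sup>2 * M 1) - (z l (-1) - r\<^sup>2 * M (-1))\<bar> \<le> C' * r^3 * \<bar>1 - (-1)\<bar>"
      by (rule interval_derivative_bound[OF d b]) simp_all
    also have "\<dots> = 2 * C' * r^3" by simp
    finally have bd: "\<bar>(z l 1 - r\<^sup>2 * M 1) - (z l (-1) - r\<^sup>2 * M (-1))\<bar> \<le> 2 * C' * r^3" .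
    have "(z l 1 - r\<^sup>2 * M 1) - (z l (-1) - r\<^sup>2 * M (-1)) = z l 1 - r\<^sup>2 * (M 1 - M (-1))"
      unfolding z(1)[OF l] right_diff_distrib by simp
    also have "M 1 - M (-1) = k * (loop_area l 1 - loop_area l (-1))"
      by (simp add: M_def loop_ends right_diff_distrib)
    finally show ?thesis
      using bd unfolding loop_area_total by (simp only:)
  qed
  have err: "2 * C' * r^3 < r\<^sup>2 * a"
    using mult_strict_left_mono[OF small, of "r\<^sup>2"] r(1) by (simp add: power2_eq_square power3_eq_cube algebra_simps)
  have kk: "\<bar>k\<bar> * a = k * (k * (8/15))" by (simp add: a_def flip: abs_mult)
  have up: "0 \<le> k * z 1 1" and down: "k * z (-1) 1 \<le> 0"
  proof -
    have upper: "0 \<le> k * u" if "- (k * (u - r\<^sup>2 * (k * (8/15 * 1)))) \<le> r\<^sup>2 * (k * (k * (8/15)))" for u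
      using that by (simp add: algebra_simps)
    have lower: "k * u \<le> 0" if "k * (u - r\<^sup>2 * (k * (8/15 * (-1)))) \<le> r\<^sup>2 * (k * (k * (8/15)))" for u
      using that by (simp add: algebra_simps)
    have "\<bar>k * (z 1 1 - r\<^sup>2 * (k * (8/15 * 1)))\<bar> \<le> \<bar>k\<bar> * (r\<^sup>2 * a)"
      unfolding abs_mult using height[of 1] err by (intro mult_left_mono) auto
    also have "\<bar>k\<bar> * (r\<^sup>2 * a) = r\<^sup>2 * (k * (k * (8/15)))"
      unfolding kk[symmetric] by simp
    finally show "0 \<le> k * z 1 1" by (rule abs_le_D2[THEN upper])
    have "\<bar>k * (z (-1) 1 - r\<^sup>2 * (k * (8/15 * (-1))))\<bar> \<le> \<bar>k\<bar> * (r\<^sup>2 * a)"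
      unfolding abs_mult using height[of "-1"] err by (intro mult_left_mono) auto
    also have "\<bar>k\<bar> * (r\<^sup>2 * a) = r\<^sup>2 * (k * (k * (8/15)))"
      unfolding kk[symmetric] by simp
    finally show "k * z (-1) 1 \<le> 0" by (rule abs_le_D1[THEN lower])
  qed
  obtain l where l: "-1 \<le> l" "l \<le> 1" "k * z l 1 = 0"
    using IVT'[of "\<lambda>l. k * z l 1" "-1" 0 1] up down cont by auto
  have l1: "\<bar>l\<bar> \<le> 1" using l by auto
  show thesis
  proof (rule that[of r l "z l"])
    show "z l 1 = 0" using l k by simp
    show "10 * r \<le> R" using r(3) by simp
    show "\<forall>t\<in>{-1..1}. \<bar>z l t\<bar> \<le> r"
      using zz[OF l1] by blast
    show "\<forall>t\<in>{-1..1}. (z l has_vector_derivative P (vec3 (r * loop_x t) (r * loop_y l t) (z l t)) * (r * loop_x' t)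
      + Q (vec3 (r * loop_x t) (r * loop_y l t) (z l t)) * (r * loop_y' l t)) (at t within {-1..1})"
      using z(3)[OF l1] unfolding G_def V_def by (rule ballI)
  qed (use r l1 z(1)[OF l1] in auto)
qed

lemma Ck_on_vec3: "Ck_on k S f \<Longrightarrow> Ck_on k S g \<Longrightarrow> Ck_on k S h \<Longrightarrow> Ck_on k S (\<lambda>x. vec3 (f x) (g x) (h x))"
  unfolding vec3_def by (intro Ck_on_add Ck_on_scaleR Ck_on_const)

lemma Ck_on_loop: "Ck_on k S loop_x" "Ck_on k S (loop_y l)" "Ck_on k S loop_x'" "Ck_on k S (loop_y' l)"
  unfolding loop_x_def[abs_def] loop_y_def[abs_def] loop_x'_def[abs_def] loop_y'_def[abs_def]
  by (intro Ck_on_add Ck_on_diff Ck_on_mult Ck_on_power Ck_on_const Ck_on_bounded_linear bounded_linear_ident)+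

text \<open>Replacing H by its value at s costs an error of second order both in the trapezoid and in the increment of the
primitive F of H u'.\<close>

lemma trapezoid_error:
  fixes H u F :: "real \<Rightarrow> real"
  assumes st: "s \<le> t" and u: "\<And>y. y \<in> {s..t} \<Longrightarrow> (u has_real_derivative u' y) (at y within {s..t})"
    and F: "\<And>y. y \<in> {s..t} \<Longrightarrow> (F has_real_derivative H y * u' y) (at y within {s..t})"
    and H: "\<And>y. y \<in> {s..t} \<Longrightarrow> \<bar>H y - H s\<bar> \<le> L * (y - s)" and U: "\<And>y. y \<in> {s..t} \<Longrightarrow> \<bar>u' y\<bar> \<le> U"
    and "L \<ge> 0"
  shows "\<bar>trapezoid H u s t - (F t - F s)\<bar> \<le> 2 * L * U * (t - s)\<^sup>2"
proof -
  have mem: "s \<in> {s..t}" "t \<in> {s..t}" using st by auto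
  have U0: "U \<ge> 0" using U[OF mem(1)] by linarith
  have "\<bar>(F t - H s * u t) - (F s - H s * u s)\<bar> \<le> (L * (t - s) * U) * \<bar>t - s\<bar>"
  proof (rule interval_derivative_bound[where f' = "\<lambda>y. (H y - H s) * u' y", OF _ _ mem])
    fix y assume y: "y \<in> {s..t}"
    have "((\<lambda>y. F y - H s * u y) has_real_derivative H y * u' y - H s * u' y) (at y within {s..t})"
      by (intro DERIV_diff F[OF y] DERIV_cmult u[OF y])
    then show "((\<lambda>y. F y - H s * u y) has_vector_derivative (H y - H s) * u' y) (at y within {s..t})"
      by (simp add: has_real_derivative_iff_has_vector_derivative left_diff_distrib)
    have "L * (y - s) \<le> L * (t - s)" using y \<open>L \<ge> 0\<close> by (intro mult_left_mono) auto
    then show "\<bar>(H y - H s) * u' y\<bar> \<le> L * (t - s) * U"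
      unfolding abs_mult using H[OF y] U[OF y] st \<open>L \<ge> 0\<close> by (intro mult_mono) auto
  qed
  then have 1: "\<bar>(F t - F s) - H s * (u t - u s)\<bar> \<le> L * U * (t - s)\<^sup>2"
    using st by (simp add: algebra_simps power2_eq_square)
  have "\<bar>u t - u s\<bar> \<le> U * \<bar>t - s\<bar>"
    by (rule interval_derivative_bound[OF u[unfolded has_real_derivative_iff_has_vector_derivative] U mem])
  then have "\<bar>(H t - H s) * (u t - u s)\<bar> \<le> (L * (t - s)) * (U * (t - s))"
    unfolding abs_mult using H[OF mem(2)] st \<open>L \<ge> 0\<close> by (intro mult_mono) auto
  also have "(L * (t - s)) * (U * (t - s)) = L * U * (t - s)\<^sup>2"
    by (simp add: power2_eq_square)
  finally have "\<bar>(H t - H s) * (u t - u s)\<bar> \<le> L * U * (t - s)\<^sup>2" .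
  moreover have "\<bar>(H t - H s) * (u t - u s) / 2\<bar> \<le> \<bar>(H t - H s) * (u t - u s)\<bar>"
    by simp
  ultimately have 2: "\<bar>(H t - H s) * (u t - u s) / 2\<bar> \<le> L * U * (t - s)\<^sup>2"
    by (rule order_trans[rotated])
  have eq: "trapezoid H u s t - (F t - F s) = (H t - H s) * (u t - u s) / 2 - ((F t - F s) - H s * (u t - u s))"
    by (simp add: trapezoid_def field_simps)
  show ?thesis
    unfolding eq using 1 2 abs_triangle_ineq4[of "(H t - H s) * (u t - u s) / 2" "(F t - F s) - H s * (u t - u s)"] by simp
qed

lemma loop_trapezoid_error:
  assumes "s \<in> {-1..1}" "t \<in> {-1..1}" "s \<le> t" "\<bar>l\<bar> \<le> 1"
  shows "\<bar>trapezoid (\<lambda>y. loop_x y * loop_y l y) loop_x s t - (loop_moment l t - loop_moment l s)\<bar> \<le> 256 * (t - s)\<^sup>2"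
proof -
  have sub: "{s..t} \<subseteq> {-1..1}" using assms by auto
  have lip: "\<bar>loop_x y * loop_y l y - loop_x s * loop_y l s\<bar> \<le> 32 * \<bar>y - s\<bar>" if "y \<in> {s..t}" for y
  proof (rule interval_derivative_bound[where a = s and b = t and f' = "\<lambda>y. loop_x' y * loop_y l y + loop_y' l y * loop_x y"])
    fix y assume "y \<in> {s..t}"
    show "((\<lambda>y. loop_x y * loop_y l y) has_vector_derivative loop_x' y * loop_y l y + loop_y' l y * loop_x y) (at y within {s..t})"
      unfolding has_real_derivative_iff_has_vector_derivative[symmetric] by (intro DERIV_mult loop_derivatives)
    have y1: "y \<in> {-1..1}" using \<open>y \<in> {s..t}\<close> sub by blast
    have "\<bar>loop_x' y * loop_y l y + loop_y' l y * loop_x y\<bar> \<le> \<bar>loop_x' y\<bar> * \<bar>loop_y l y\<bar> + \<bar>loop_y' l y\<bar> * \<bar>loop_x y\<bar>"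
      by (rule abs_sum_of_products_le)
    also have "\<dots> \<le> 4 * 3 + 10 * 2"
      by (intro add_mono mult_mono loop_bounds[OF y1 assms(4)]) auto
    finally show "\<bar>loop_x' y * loop_y l y + loop_y' l y * loop_x y\<bar> \<le> 32" by simp
  qed (use that assms in auto)
  have "\<bar>trapezoid (\<lambda>y. loop_x y * loop_y l y) loop_x s t - (loop_moment l t - loop_moment l s)\<bar> \<le> 2 * 32 * 4 * (t - s)\<^sup>2"
  proof (rule trapezoid_error[OF assms(3)])
    show "\<bar>loop_x y * loop_y l y - loop_x s * loop_y l s\<bar> \<le> 32 * (y - s)" if "y \<in> {s..t}" for y
      using lip[OF that] that by simp
    show "\<bar>loop_x' y\<bar> \<le> 4" if "y \<in> {s..t}" for y
      using loop_bounds(3)[of y l] that sub assms(4) by blast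
  qed (rule loop_derivatives loop_moment_derivative | simp)+
  then show ?thesis by simp
qed

lemma telescoping_sum_error:
  fixes e \<phi> :: "nat \<Rightarrow> real"
  assumes "\<And>i. i < n \<Longrightarrow> \<bar>e i - (\<phi> (Suc i) - \<phi> i)\<bar> \<le> B"
  shows "\<bar>(\<Sum>i<n. e i) - (\<phi> n - \<phi> 0)\<bar> \<le> real n * B"
proof -
  have "(\<Sum>i<n. e i) - (\<phi> n - \<phi> 0) = (\<Sum>i<n. e i - (\<phi> (Suc i) - \<phi> i))"
    using sum_lessThan_telescope[of \<phi> n] by (simp add: sum_subtractf)
  also have "\<bar>\<dots>\<bar> \<le> (\<Sum>i<n. B)"
    by (rule order_trans[OF sum_abs sum_mono]) (use assms in auto)
  finally show ?thesis by simp
qed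

section \<open>Tangent vectors and the metric in a chart\<close>

lemma atlasD:
  assumes "smooth_atlas A" "c \<in> A"
  shows "open (fst c)" "open (snd c ` fst c)" "homeomorphism (fst c) (snd c ` fst c) (snd c) (chart_inv c)"
  using assms unfolding smooth_atlas_def by auto

lemma transition_smooth:
  assumes "smooth_atlas A" "c \<in> A" "c' \<in> A"
  shows "smooth_on (snd c ` (fst c \<inter> fst c')) (transition c c')"
  using assms unfolding smooth_atlas_def by blast

lemma chart_inv_chart: "smooth_atlas A \<Longrightarrow> c \<in> A \<Longrightarrow> q \<in> fst c \<Longrightarrow> chart_inv c (snd c q) = q"
  using atlasD(3) homeomorphism_apply1 by blast

lemma chart_continuous: "smooth_atlas A \<Longrightarrow> c \<in> A \<Longrightarrow> continuous_on (fst c) (snd c)"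
  using atlasD(3) homeomorphism_cont1 by blast

lemma chart_image_open:
  assumes "smooth_atlas A" "c \<in> A" "open W"
  shows "open (snd c ` (fst c \<inter> W))"
proof -
  have "openin (top_of_set (snd c ` fst c)) (snd c ` (fst c \<inter> W))"
    using homeomorphism_imp_open_map[OF atlasD(3)[OF assms(1,2)]] openin_open_Int[OF assms(3)] by blast
  then show ?thesis
    using openin_open_eq[OF atlasD(2)[OF assms(1,2)]] by blast
qed

lemma exists_chart_at:
  assumes "smooth_atlas A" obtains c where "c \<in> charts_at A p"
proof -
  have "p \<in> (\<Union>c\<in>A. fst c)" using assms unfolding smooth_atlas_def by simp
  then show thesis using that unfolding charts_at_def by blast
qed

lemma transition_has_derivative:
  assumes A: "smooth_atlas A" and c: "c \<in> charts_at A q" and c': "c' \<in> charts_at A q"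
  shows "(transition c c' has_derivative frechet_derivative (transition c c') (at (snd c q))) (at (snd c q))"
proof (rule Ck_on_open_derivative(1)[where k = 0])
  have "c \<in> A" "c' \<in> A" "q \<in> fst c" "q \<in> fst c'" using c c' by (auto simp: charts_at_def)
  then show "Ck_on (Suc 0) (snd c ` (fst c \<inter> fst c')) (transition c c')"
    by (intro smooth_onD transition_smooth[OF A])
  show "open (snd c ` (fst c \<inter> fst c'))"
    using \<open>c \<in> A\<close> \<open>c' \<in> A\<close> by (intro chart_image_open[OF A] atlasD(1)[OF A])
  show "snd c q \<in> snd c ` (fst c \<inter> fst c')"
    using \<open>q \<in> fst c\<close> \<open>q \<in> fst c'\<close> by blast
qed

lemma tangent_spaceD:
  assumes "v \<in> tangent_space A q"
  shows "c \<notin> charts_at A q \<Longrightarrow> v c = 0"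
    and "c \<in> charts_at A q \<Longrightarrow> c' \<in> charts_at A q \<Longrightarrow>
      v c' = frechet_derivative (transition c c') (at (snd c q)) (v c)"
  using assms unfolding tangent_space_def by blast+

lemma tangent_vector_determined:
  assumes A: "smooth_atlas A" and c: "c \<in> charts_at A q" and v: "v \<in> tangent_space A q"
  shows "tvec A c q (v c) = v"
proof
  fix c' show "tvec A c q (v c) c' = v c'"
  proof (cases "c' \<in> charts_at A q")
    case True
    then show ?thesis using tangent_spaceD(2)[OF v c True] by (simp only: tvec_def if_True)
  next
    case False
    then show ?thesis using tangent_spaceD(1)[OF v False] by (simp only: tvec_def if_False)
  qed
qed

text \<open>This turns the independence of a frame as a family of coordinate vectors into independence in one chart.\<close>

lemma tangent_vector_eq_0:
  assumes A: "smooth_atlas A" and c: "c \<in> charts_at A q" and v: "v \<in> tangent_space A q" and "v c = 0"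
  shows "v = (\<lambda>_. 0)"
proof
  fix c'
  show "v c' = 0"
  proof (cases "c' \<in> charts_at A q")
    case True
    then have "v c' = frechet_derivative (transition c c') (at (snd c q)) 0"
      using tangent_spaceD(2)[OF v c True] \<open>v c = 0\<close> by simp
    then show ?thesis
      using linear_0 has_derivative_linear[OF transition_has_derivative[OF A c True]] by auto
  qed (rule tangent_spaceD(1)[OF v])
qed

definition quad_form :: "real \<Rightarrow> real \<Rightarrow> real \<Rightarrow> real \<Rightarrow> real \<Rightarrow> real" where
  "quad_form e f h a b = e * a\<^sup>2 + 2 * f * (a * b) + h * b\<^sup>2"

text \<open>The determinant divided by the trace is a lower bound for the smaller eigenvalue.\<close>

lemma quad_form_lower:
  assumes "e + h > 0"
  shows "(e * h - f\<^sup>2) / (e + h) * (a\<^sup>2 + b\<^sup>2) \<le> quad_form e f h a b"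
proof -
  have "(e + h) * quad_form e f h a b - (e * h - f\<^sup>2) * (a\<^sup>2 + b\<^sup>2) = (e * a + f * b)\<^sup>2 + (f * a + h * b)\<^sup>2"
    by (simp add: quad_form_def power2_eq_square algebra_simps)
  then have "(e * h - f\<^sup>2) * (a\<^sup>2 + b\<^sup>2) \<le> quad_form e f h a b * (e + h)"
    using zero_le_power2[of "e * a + f * b"] zero_le_power2[of "f * a + h * b"]
      mult.commute[of "e + h" "quad_form e f h a b"] by linarith
  then show ?thesis
    using assms by (simp add: pos_divide_le_eq)
qed

lemma quad_form_upper:
  "quad_form e f h a b \<le> (\<bar>e\<bar> + \<bar>f\<bar> + \<bar>h\<bar>) * (a\<^sup>2 + b\<^sup>2)"
proof -
  have "\<bar>2 * (a * b)\<bar> \<le> a\<^sup>2 + b\<^sup>2"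
    using zero_le_power2[of "a - b"] zero_le_power2[of "a + b"]
    by (simp add: abs_le_iff power2_diff power2_sum mult.assoc)
  then have "\<bar>f\<bar> * \<bar>2 * (a * b)\<bar> \<le> \<bar>f\<bar> * (a\<^sup>2 + b\<^sup>2)"
    by (rule mult_left_mono) simp
  then have "f * (2 * (a * b)) \<le> \<bar>f\<bar> * (a\<^sup>2 + b\<^sup>2)"
    using abs_ge_self[of "f * (2 * (a * b))"] by (simp only: abs_mult) 
  moreover have "e * a\<^sup>2 \<le> \<bar>e\<bar> * (a\<^sup>2 + b\<^sup>2)" "h * b\<^sup>2 \<le> \<bar>h\<bar> * (a\<^sup>2 + b\<^sup>2)"
    by (intro mult_mono; simp)+
  ultimately show ?thesis
    by (simp add: quad_form_def distrib_right mult.assoc mult.left_commute)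
qed

lemma quad_form_pinched:
  fixes p :: "'a::t2_space"
  assumes N: "open N" "p \<in> N" and "continuous_on N e" "continuous_on N f" "continuous_on N h"
    and pos: "e p > 0" "h p > 0" "e p * h p - (f p)\<^sup>2 > 0"
  shows "\<exists>N' k K. open N' \<and> p \<in> N' \<and> N' \<subseteq> N \<and> k > 0 \<and> K > 0 \<and>
      (\<forall>q\<in>N'. \<forall>a b. k * (a\<^sup>2 + b\<^sup>2) \<le> quad_form (e q) (f q) (h q) a b \<and> quad_form (e q) (f q) (h q) a b \<le> K * (a\<^sup>2 + b\<^sup>2))"
proof -
  define \<kappa> where "\<kappa> q = (e q * h q - (f q)\<^sup>2) / (e q + h q)" for q
  define \<mu> where "\<mu> q = \<bar>e q\<bar> + \<bar>f q\<bar> + \<bar>h q\<bar>" for q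
  have kp: "\<kappa> p > 0" using pos by (simp add: \<kappa>_def)
  have t: "(e \<longlongrightarrow> e p) (at p)" "(f \<longlongrightarrow> f p) (at p)" "(h \<longlongrightarrow> h p) (at p)"
    using assms(3-5) N(2) unfolding continuous_on_eq_continuous_at[OF N(1)] isCont_def by blast+
  have "((\<lambda>q. e q + h q) \<longlongrightarrow> e p + h p) (at p)" by (intro tendsto_intros t)
  then have 1: "eventually (\<lambda>q. 0 < e q + h q) (at p)"
    by (rule order_tendstoD) (use pos in simp)
  have "(\<kappa> \<longlongrightarrow> \<kappa> p) (at p)" unfolding \<kappa>_def by (intro tendsto_intros t) (use pos in auto)
  then have 2: "eventually (\<lambda>q. \<kappa> p / 2 < \<kappa> q) (at p)"
    by (rule order_tendstoD) (use kp in simp)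
  have "(\<mu> \<longlongrightarrow> \<mu> p) (at p)" unfolding \<mu>_def by (intro tendsto_intros t)
  then have 3: "eventually (\<lambda>q. \<mu> q < \<mu> p + 1) (at p)"
    by (rule order_tendstoD) simp
  obtain U where U: "open U" "p \<in> U" "\<And>q. q \<in> U \<Longrightarrow> q \<noteq> p \<Longrightarrow> 0 < e q + h q \<and> \<kappa> p / 2 < \<kappa> q \<and> \<mu> q < \<mu> p + 1"
    using eventually_conj[OF 1 eventually_conj[OF 2 3]] unfolding eventually_at_topological by blast
  then have U': "0 < e q + h q \<and> \<kappa> p / 2 < \<kappa> q \<and> \<mu> q < \<mu> p + 1" if "q \<in> U" for q
    using that pos kp by (cases "q = p") auto
  have "\<kappa> p / 2 * (a\<^sup>2 + b\<^sup>2) \<le> quad_form (e q) (f q) (h q) a b"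
    and "quad_form (e q) (f q) (h q) a b \<le> (\<mu> p + 1) * (a\<^sup>2 + b\<^sup>2)" if "q \<in> U" for q a b
  proof -
    have "\<kappa> p / 2 * (a\<^sup>2 + b\<^sup>2) \<le> \<kappa> q * (a\<^sup>2 + b\<^sup>2)"
      using U'[OF that] by (intro mult_right_mono) auto
    also have "\<dots> \<le> quad_form (e q) (f q) (h q) a b"
      unfolding \<kappa>_def by (rule quad_form_lower) (use U'[OF that] in auto)
    finally show "\<kappa> p / 2 * (a\<^sup>2 + b\<^sup>2) \<le> quad_form (e q) (f q) (h q) a b" .
    have "quad_form (e q) (f q) (h q) a b \<le> \<mu> q * (a\<^sup>2 + b\<^sup>2)"
      unfolding \<mu>_def by (rule quad_form_upper)
    also have "\<dots> \<le> (\<mu> p + 1) * (a\<^sup>2 + b\<^sup>2)"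
      using U'[OF that] by (intro mult_right_mono) auto
    finally show "quad_form (e q) (f q) (h q) a b \<le> (\<mu> p + 1) * (a\<^sup>2 + b\<^sup>2)" .
  qed
  moreover have "\<mu> p + 1 > 0" by (simp add: \<mu>_def add_nonneg_pos)
  ultimately show ?thesis
    using U N kp by (intro exI[of _ "U \<inter> N"] exI[of _ "\<kappa> p / 2"] exI[of _ "\<mu> p + 1"]) auto
qed

text \<open>A local frame X, Y of the distribution on a set inside the chart c, together with those consequences of
its smoothness that the comparison of the metric with the Euclidean norm in the chart uses: its coordinates and
Gram matrix are continuous, and both the metric and the coordinates are nondegenerate on the span of X and Y.\<close>

definition frame_near ::
   "'a::topological_space chart set \<Rightarrow> ('a \<Rightarrow> 'a tvector set) \<Rightarrow> ('a \<Rightarrow> 'a tvector \<Rightarrow> 'a tvector \<Rightarrow> real) \<Rightarrow>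
    'a chart \<Rightarrow> 'a set \<Rightarrow> ('a \<Rightarrow> 'a tvector) \<Rightarrow> ('a \<Rightarrow> 'a tvector) \<Rightarrow> bool" where
  "frame_near A \<xi> g c N X Y \<longleftrightarrow> open N \<and> N \<subseteq> fst c \<and> c \<in> A \<and>
     continuous_on N (\<lambda>q. X q c) \<and> continuous_on N (\<lambda>q. Y q c) \<and>
     continuous_on N (\<lambda>q. g q (X q) (X q)) \<and> continuous_on N (\<lambda>q. g q (X q) (Y q)) \<and>
     continuous_on N (\<lambda>q. g q (Y q) (Y q)) \<and>
     (\<forall>q\<in>N. \<xi> q = {lincomb a (X q) b (Y q) | a b. True} \<and>
        (\<forall>a b. a *\<^sub>R X q c + b *\<^sub>R Y q c = 0 \<longrightarrow> a = 0 \<and> b = 0) \<and>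
        (\<forall>a b. g q (lincomb a (X q) b (Y q)) (lincomb a (X q) b (Y q)) =
           quad_form (g q (X q) (X q)) (g q (X q) (Y q)) (g q (Y q) (Y q)) a b) \<and>
        (\<forall>a b. a \<noteq> 0 \<or> b \<noteq> 0 \<longrightarrow>
           0 < quad_form (g q (X q) (X q)) (g q (X q) (Y q)) (g q (Y q) (Y q)) a b))"

lemma frame_near_exists:
  fixes A :: "'a::{t2_space,second_countable_topology} chart set"
  assumes A: "smooth_atlas A" and xi: "smooth_rank2_distribution A \<xi>" and g: "sub_riemannian_metric A \<xi> g"
    and c: "c \<in> charts_at A p"
  obtains N X Y where "p \<in> N" "frame_near A \<xi> g c N X Y"
proof -
  from xi have "\<exists>W X Y. open W \<and> p \<in> W \<and> smooth_vector_field A W X \<and> smooth_vector_field A W Y \<and>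
        (\<forall>q\<in>W. (\<forall>a b. lincomb a (X q) b (Y q) = (\<lambda>_. 0) \<longrightarrow> a = 0 \<and> b = 0) \<and>
                \<xi> q = {lincomb a (X q) b (Y q) | a b. True})"
    unfolding smooth_rank2_distribution_def by (rule spec)
  then obtain W X Y where W: "open W" "p \<in> W" and X: "smooth_vector_field A W X" and Y: "smooth_vector_field A W Y"
    and frame: "\<forall>q\<in>W. (\<forall>a b. lincomb a (X q) b (Y q) = (\<lambda>_. 0) \<longrightarrow> a = 0 \<and> b = 0) \<and>
                \<xi> q = {lincomb a (X q) b (Y q) | a b. True}"
    by (elim exE conjE)
  have ind: "a = 0 \<and> b = 0" if "q \<in> W" "lincomb a (X q) b (Y q) = (\<lambda>_. 0)" for q a b
    using bspec[OF frame that(1)] that(2) by blast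
  have span: "\<xi> q = {lincomb a (X q) b (Y q) | a b. True}" if "q \<in> W" for q
    using bspec[OF frame that] by (rule conjunct2)
  have cA: "c \<in> A" and pc: "p \<in> fst c" using c by (auto simp: charts_at_def)
  define N where "N = fst c \<inter> W"
  have pull: "continuous_on N f" if "continuous_on (snd c ` N) F" "\<And>q. q \<in> N \<Longrightarrow> F (snd c q) = f q"
    for f :: "'a \<Rightarrow> 'b::topological_space" and F
  proof -
    have "continuous_on N (\<lambda>q. F (snd c q))"
    proof (rule continuous_on_compose2[OF that(1)])
      show "continuous_on N (snd c)"
        by (rule continuous_on_subset[OF chart_continuous[OF A cA]]) (simp add: N_def)
    qed simp
    then show ?thesis using that(2) by (rule continuous_on_eq)
  qed
  have inv: "chart_inv c (snd c q) = q" if "q \<in> N" for q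
    using chart_inv_chart[OF A cA] that by (auto simp: N_def)
  have fieldc: "continuous_on N (\<lambda>q. Z q c)" if "smooth_vector_field A W Z" for Z
    by (rule pull[of "\<lambda>x. Z (chart_inv c x) c"])
      (use that cA in \<open>simp_all add: smooth_vector_field_def N_def smooth_on_imp_continuous inv[unfolded N_def]\<close>)
  have inxi: "X q \<in> \<xi> q" "Y q \<in> \<xi> q" if "q \<in> W" for q
  proof -
    have "lincomb 1 (X q) 0 (Y q) = X q" "lincomb 0 (X q) 1 (Y q) = Y q" by (auto simp: lincomb_def)
    then show "X q \<in> \<xi> q" "Y q \<in> \<xi> q" unfolding span[OF that] by (blast intro: sym)+
  qed
  note g' = g[unfolded sub_riemannian_metric_def]
  note G1 = g'[THEN conjunct1] and G2 = g'[THEN conjunct2, THEN conjunct1]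
    and G3 = g'[THEN conjunct2, THEN conjunct2, THEN conjunct1] and G4 = g'[THEN conjunct2, THEN conjunct2, THEN conjunct2]
  have smooth: "continuous_on N (\<lambda>q. g q (Z q) (Z' q))"
    if "smooth_vector_field A W Z" "smooth_vector_field A W Z'" "\<And>q. q \<in> W \<Longrightarrow> Z q \<in> \<xi> q" "\<And>q. q \<in> W \<Longrightarrow> Z' q \<in> \<xi> q" for Z Z'
  proof (rule pull)
    have "smooth_fun A W (\<lambda>q. g q (Z q) (Z' q))"
      by (rule G4[THEN spec, THEN spec, THEN spec, THEN mp]) (intro conjI ballI W that)
    then show "continuous_on (snd c ` N) ((\<lambda>q. g q (Z q) (Z' q)) \<circ> chart_inv c)"
      using bspec[OF _ cA] unfolding smooth_fun_def N_def by (intro smooth_on_imp_continuous) fast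
  qed (simp add: inv)
  have sym: "g q u v = g q v u" if "u \<in> \<xi> q" "v \<in> \<xi> q" for q u v
    using G1 that by blast
  have lin: "g q (lincomb a u b v) w = a * g q u w + b * g q v w" if "u \<in> \<xi> q" "v \<in> \<xi> q" "w \<in> \<xi> q" for q u v w a b
    using G2 that by blast
  have pos: "0 < g q u u" if "u \<in> \<xi> q" "u \<noteq> (\<lambda>_. 0)" for q u
    using G3 that by blast
  have lcxi: "lincomb a (X q) b (Y q) \<in> \<xi> q" if "q \<in> W" for q a b
    unfolding span[OF that] by blast
  have quad: "g q (lincomb a (X q) b (Y q)) (lincomb a (X q) b (Y q)) =
           quad_form (g q (X q) (X q)) (g q (X q) (Y q)) (g q (Y q) (Y q)) a b" if q: "q \<in> W" for q a b
  proof -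
    let ?l = "lincomb a (X q) b (Y q)"
    have "g q (X q) ?l = a * g q (X q) (X q) + b * g q (X q) (Y q)" "g q (Y q) ?l = a * g q (X q) (Y q) + b * g q (Y q) (Y q)"
      unfolding sym[OF inxi(1)[OF q] lcxi[OF q]] sym[OF inxi(2)[OF q] lcxi[OF q]]
        lin[OF inxi[OF q] inxi(1)[OF q]] lin[OF inxi[OF q] inxi(2)[OF q]] sym[OF inxi(2,1)[OF q]] by simp_all
    then show ?thesis
      unfolding lin[OF inxi[OF q] lcxi[OF q]] by (simp add: quad_form_def power2_eq_square algebra_simps)
  qed
  have "frame_near A \<xi> g c N X Y"
    unfolding frame_near_def
  proof (intro conjI ballI allI impI)
    show "open N" unfolding N_def using W atlasD(1)[OF A cA] by blast
    fix q assume "q \<in> N"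
    then have q: "q \<in> W" "q \<in> fst c" by (auto simp: N_def)
    show "\<xi> q = {lincomb a (X q) b (Y q) | a b. True}" by (rule span[OF q(1)])
    have tan: "X q \<in> tangent_space A q" "Y q \<in> tangent_space A q"
      using X Y q by (auto simp: smooth_vector_field_def)
    have cq: "c \<in> charts_at A q" using cA q by (simp add: charts_at_def)
    have lct: "lincomb a (X q) b (Y q) \<in> tangent_space A q" for a b
      unfolding tangent_space_def
    proof (intro CollectI conjI allI impI ballI)
      fix d show "d \<notin> charts_at A q \<Longrightarrow> lincomb a (X q) b (Y q) d = 0"
        using tangent_spaceD(1)[OF tan(1), of d] tangent_spaceD(1)[OF tan(2), of d] by (simp add: lincomb_def)
    next
      fix d d' assume d: "d \<in> charts_at A q" "d' \<in> charts_at A q"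
      have "linear (frechet_derivative (transition d d') (at (snd d q)))"
        using has_derivative_linear[OF transition_has_derivative[OF A d]] .
      then show "lincomb a (X q) b (Y q) d' = frechet_derivative (transition d d') (at (snd d q)) (lincomb a (X q) b (Y q) d)"
        unfolding lincomb_def
        by (simp only: linear_add linear_cmul tangent_spaceD(2)[OF tan(1) d] tangent_spaceD(2)[OF tan(2) d])
    qed
    show "a = 0" "b = 0" if "a *\<^sub>R X q c + b *\<^sub>R Y q c = 0" for a b
    proof -
      have "lincomb a (X q) b (Y q) = (\<lambda>_. 0)"
        by (rule tangent_vector_eq_0[OF A cq lct]) (simp add: lincomb_def that)
      then show "a = 0" "b = 0" using ind[OF q(1)] by blast+
    qed
    show "g q (lincomb a (X q) b (Y q)) (lincomb a (X q) b (Y q)) =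
           quad_form (g q (X q) (X q)) (g q (X q) (Y q)) (g q (Y q) (Y q)) a b" for a b
      by (rule quad[OF q(1)])
    show "0 < quad_form (g q (X q) (X q)) (g q (X q) (Y q)) (g q (Y q) (Y q)) a b" if "a \<noteq> 0 \<or> b \<noteq> 0" for a b
      unfolding quad[OF q(1), symmetric] by (rule pos[OF lcxi[OF q(1)]]) (use ind[OF q(1)] that in blast)
  next
    show "N \<subseteq> fst c" by (simp add: N_def)
    show "continuous_on N (\<lambda>q. g q (X q) (X q))" "continuous_on N (\<lambda>q. g q (X q) (Y q))"
      "continuous_on N (\<lambda>q. g q (Y q) (Y q))"
      by (rule smooth[OF X X] smooth[OF X Y] smooth[OF Y Y]; rule inxi; assumption)+
  qed (fact cA fieldc[OF X] fieldc[OF Y])+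
  then show thesis using that[of N X Y] W pc by (simp add: N_def)
qed

lemma frame_near_quad:
  assumes "frame_near A \<xi> g c N X Y" "q \<in> N" "v \<in> \<xi> q"
  obtains a b where "v c = a *\<^sub>R X q c + b *\<^sub>R Y q c"
    "g q v v = quad_form (g q (X q) (X q)) (g q (X q) (Y q)) (g q (Y q) (Y q)) a b"
proof -
  have fr: "\<xi> q = {lincomb a (X q) b (Y q) | a b. True}"
    "\<And>a b. g q (lincomb a (X q) b (Y q)) (lincomb a (X q) b (Y q)) =
           quad_form (g q (X q) (X q)) (g q (X q) (Y q)) (g q (Y q) (Y q)) a b"
    using assms(1,2) unfolding frame_near_def by fast+
  obtain a b where v: "v = lincomb a (X q) b (Y q)"
    using assms(3) unfolding fr(1) by blast
  show thesis
    by (rule that[of a b]) (simp_all only: v fr(2), simp add: lincomb_def)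
qed

lemma norm_lincomb_square:
  fixes x y :: "'v::real_inner"
  shows "(norm (a *\<^sub>R x + b *\<^sub>R y))\<^sup>2 = quad_form (x \<bullet> x) (x \<bullet> y) (y \<bullet> y) a b"
  unfolding power2_norm_eq_inner quad_form_def
  by (simp add: inner_add_left inner_add_right power2_eq_square inner_commute[of y x] algebra_simps)

lemma quad_form_pos_imp:
  assumes "\<And>a b. a \<noteq> 0 \<or> b \<noteq> 0 \<Longrightarrow> 0 < quad_form e f h a b"
  shows "e > 0" "h > 0" "e * h - f\<^sup>2 > 0"
proof -
  show "e > 0" using assms[of 1 0] by (simp add: quad_form_def)
  show "h > 0" using assms[of 0 1] by (simp add: quad_form_def)
  \<comment> \<open>the vector (f, - e) is orthogonal to (1, 0) for the quadratic form\<close>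
  have "0 < quad_form e f h f (- e)"
    using assms[of f "-e"] \<open>e > 0\<close> by simp
  also have "quad_form e f h f (- e) = e * (e * h - f\<^sup>2)"
    by (simp add: quad_form_def power2_eq_square algebra_simps)
  finally show "e * h - f\<^sup>2 > 0"
    using \<open>e > 0\<close> by (simp add: zero_less_mult_iff)
qed

lemma frame_near_gram:
  assumes fr: "frame_near A \<xi> g c N X Y" and q: "q \<in> N"
  shows "0 < X q c \<bullet> X q c" "0 < Y q c \<bullet> Y q c" "(X q c \<bullet> X q c) * (Y q c \<bullet> Y q c) - (X q c \<bullet> Y q c)\<^sup>2 > 0"
proof -
  have ind: "a = 0 \<and> b = 0" if "a *\<^sub>R X q c + b *\<^sub>R Y q c = 0" for a b
    using fr q that unfolding frame_near_def by fast
  have "0 < quad_form (X q c \<bullet> X q c) (X q c \<bullet> Y q c) (Y q c \<bullet> Y q c) a b" if "a \<noteq> 0 \<or> b \<noteq> 0" for a b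
    unfolding norm_lincomb_square[symmetric] using ind[of a b] that by auto
  from quad_form_pos_imp[OF this]
  show "0 < X q c \<bullet> X q c" "0 < Y q c \<bullet> Y q c" "(X q c \<bullet> X q c) * (Y q c \<bullet> Y q c) - (X q c \<bullet> Y q c)\<^sup>2 > 0"
    by blast+
qed

lemma frame_near_metric_pos:
  assumes fr: "frame_near A \<xi> g c N X Y" and q: "q \<in> N"
  shows "0 < g q (X q) (X q)" "0 < g q (Y q) (Y q)" "g q (X q) (X q) * g q (Y q) (Y q) - (g q (X q) (Y q))\<^sup>2 > 0"
proof -
  have "0 < quad_form (g q (X q) (X q)) (g q (X q) (Y q)) (g q (Y q) (Y q)) a b" if "a \<noteq> 0 \<or> b \<noteq> 0" for a b
    using fr q that unfolding frame_near_def by fast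
  from quad_form_pos_imp[OF this]
  show "0 < g q (X q) (X q)" "0 < g q (Y q) (Y q)" "g q (X q) (X q) * g q (Y q) (Y q) - (g q (X q) (Y q))\<^sup>2 > 0"
    by blast+
qed

lemma sqrt_le_mult_sqrt:
  assumes "u \<le> K * s" "k * s \<le> w" "k > 0" "K \<ge> 0"
  shows "sqrt u \<le> sqrt (K / k) * sqrt w"
proof -
  have "s \<le> w / k" using assms(2,3) by (simp add: field_simps)
  then have "K * s \<le> K * (w / k)" using assms(4) by (rule mult_left_mono)
  then have "u \<le> (K / k) * w" using assms(1) by simp
  then show ?thesis using real_sqrt_le_mono by (fastforce simp flip: real_sqrt_mult)
qed

text \<open>In the coefficients a, b of v = a X + b Y, both g v v and the squared norm of v c are positive definite
quadratic forms with continuous coefficients, and so near p both lie between multiples of a^2 + b^2.\<close>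

lemma metric_comparable_to_chart_norm:
  fixes A :: "'a::{t2_space,second_countable_topology} chart set"
  assumes A: "smooth_atlas A" and xi: "smooth_rank2_distribution A \<xi>" and g: "sub_riemannian_metric A \<xi> g"
    and c: "c \<in> charts_at A p"
  obtains N K where "open N" "p \<in> N" "N \<subseteq> fst c" "K > 0"
    "\<forall>q\<in>N. \<forall>v\<in>\<xi> q. norm (v c) \<le> K * sqrt (g q v v) \<and> sqrt (g q v v) \<le> K * norm (v c)"
proof -
  obtain N X Y where p: "p \<in> N" and fr: "frame_near A \<xi> g c N X Y"
    using frame_near_exists[OF A xi g c] .
  note fr' = fr[unfolded frame_near_def]
  have N: "open N" "N \<subseteq> fst c" using fr' by fast+
  have cX: "continuous_on N (\<lambda>q. X q c)" and cY: "continuous_on N (\<lambda>q. Y q c)"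
    and cg: "continuous_on N (\<lambda>q. g q (X q) (X q))" "continuous_on N (\<lambda>q. g q (X q) (Y q))"
     "continuous_on N (\<lambda>q. g q (Y q) (Y q))"
    using fr' by fast+
  obtain N1 k1 K1 where N1: "open N1" "p \<in> N1" "N1 \<subseteq> N" "k1 > 0" "K1 > 0"
    and q1: "\<And>q a b. q \<in> N1 \<Longrightarrow> k1 * (a\<^sup>2 + b\<^sup>2) \<le> quad_form (g q (X q) (X q)) (g q (X q) (Y q)) (g q (Y q) (Y q)) a b"
      "\<And>q a b. q \<in> N1 \<Longrightarrow> quad_form (g q (X q) (X q)) (g q (X q) (Y q)) (g q (Y q) (Y q)) a b \<le> K1 * (a\<^sup>2 + b\<^sup>2)"
    using quad_form_pinched[OF N(1) p cg frame_near_metric_pos[OF fr p]] by blast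
  obtain N2 k2 K2 where N2: "open N2" "p \<in> N2" "N2 \<subseteq> N" "k2 > 0" "K2 > 0"
    and q2: "\<And>q a b. q \<in> N2 \<Longrightarrow> k2 * (a\<^sup>2 + b\<^sup>2) \<le> quad_form (X q c \<bullet> X q c) (X q c \<bullet> Y q c) (Y q c \<bullet> Y q c) a b"
      "\<And>q a b. q \<in> N2 \<Longrightarrow> quad_form (X q c \<bullet> X q c) (X q c \<bullet> Y q c) (Y q c \<bullet> Y q c) a b \<le> K2 * (a\<^sup>2 + b\<^sup>2)"
    using quad_form_pinched[OF N(1) p continuous_on_inner[OF cX cX] continuous_on_inner[OF cX cY] continuous_on_inner[OF cY cY] frame_near_gram[OF fr p]] by blast
  let ?K = "max (sqrt (K2 / k1)) (sqrt (K1 / k2))"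
  have norm_sqrt: "norm u = sqrt ((norm u)\<^sup>2)" for u :: "real^3" by simp
  show thesis
  proof (rule that[of "N1 \<inter> N2" ?K])
    show "?K > 0" using N1 N2 by (simp add: less_max_iff_disj)
    have "norm (v c) \<le> ?K * sqrt (g q v v) \<and> sqrt (g q v v) \<le> ?K * norm (v c)"
      if q: "q \<in> N1 \<inter> N2" and v: "v \<in> \<xi> q" for q v
    proof
      have qN: "q \<in> N" "q \<in> N1" "q \<in> N2" using N1 q by auto
    obtain a b where ab: "v c = a *\<^sub>R X q c + b *\<^sub>R Y q c"
      "g q v v = quad_form (g q (X q) (X q)) (g q (X q) (Y q)) (g q (Y q) (Y q)) a b"
      using frame_near_quad[OF fr qN(1) v] .
    have "sqrt ((norm (v c))\<^sup>2) \<le> sqrt (K2 / k1) * sqrt (g q v v)"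
      unfolding ab norm_lincomb_square
      by (rule sqrt_le_mult_sqrt[OF q2(2)[OF qN(3)] q1(1)[OF qN(2)]]) (use N1 N2 in auto)
    moreover have "0 \<le> sqrt (g q v v)"
      unfolding ab using order_trans[OF _ q1(1)[OF qN(2), of a b]] N1(4) by simp
    ultimately show "norm (v c) \<le> ?K * sqrt (g q v v)"
      using mult_right_mono[of "sqrt (K2 / k1)" ?K "sqrt (g q v v)"] by simp
    have "sqrt (g q v v) \<le> sqrt (K1 / k2) * sqrt ((norm (v c))\<^sup>2)"
      unfolding ab norm_lincomb_square
      by (rule sqrt_le_mult_sqrt[OF q1(2)[OF qN(2)] q2(1)[OF qN(3)]]) (use N1 N2 in auto)
    then show "sqrt (g q v v) \<le> ?K * norm (v c)"
      using mult_right_mono[of "sqrt (K1 / k2)" ?K "norm (v c)"] by simp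
    qed
    then show "\<forall>q\<in>N1 \<inter> N2. \<forall>v\<in>\<xi> q. norm (v c) \<le> ?K * sqrt (g q v v) \<and> sqrt (g q v v) \<le> ?K * norm (v c)"
      by blast
  qed (use N N1 N2 in auto)
qed

text \<open>The coefficients of v t in a local frame are continuous, since Cramer's rule for the Gram matrix of X and Y
expresses them by inner products in the chart.\<close>

lemma metric_continuous_along:
  fixes A :: "'a::{t2_space,second_countable_topology} chart set"
  assumes A: "smooth_atlas A" and xi: "smooth_rank2_distribution A \<xi>" and g: "sub_riemannian_metric A \<xi> g"
    and \<gamma>: "continuous_on J \<gamma>" and v: "\<And>t. t \<in> J \<Longrightarrow> v t \<in> \<xi> (\<gamma> t)"
    and vc: "\<And>c. c \<in> A \<Longrightarrow> continuous_on (J \<inter> \<gamma> -` fst c) (\<lambda>t. v t c)"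
  shows "continuous_on J (\<lambda>t::real. g (\<gamma> t) (v t) (v t))"
  unfolding continuous_on_eq_continuous_within
proof
  fix t assume t: "t \<in> J"
  obtain c where c: "c \<in> charts_at A (\<gamma> t)" by (rule exists_chart_at[OF A])
  obtain N X Y where p: "\<gamma> t \<in> N" and fr: "frame_near A \<xi> g c N X Y"
    using frame_near_exists[OF A xi g c] .
  note fr' = fr[unfolded frame_near_def]
  have N: "open N" "N \<subseteq> fst c" using fr' by fast+
  define S where "S = J \<inter> \<gamma> -` N"
  have cA: "c \<in> A" using c by (simp add: charts_at_def)
  have \<gamma>S: "continuous_on S \<gamma>" "\<gamma> ` S \<subseteq> N" using \<gamma> by (auto simp: S_def intro: continuous_on_subset)
  have comp: "continuous_on S (\<lambda>t. f (\<gamma> t))" if "continuous_on N f" for f :: "'a \<Rightarrow> 'b::topological_space"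
    by (rule continuous_on_compose2[OF that \<gamma>S])
  have cX: "continuous_on S (\<lambda>t. X (\<gamma> t) c)" and cY: "continuous_on S (\<lambda>t. Y (\<gamma> t) c)"
    and cg: "continuous_on S (\<lambda>t. g (\<gamma> t) (X (\<gamma> t)) (X (\<gamma> t)))" "continuous_on S (\<lambda>t. g (\<gamma> t) (X (\<gamma> t)) (Y (\<gamma> t)))"
     "continuous_on S (\<lambda>t. g (\<gamma> t) (Y (\<gamma> t)) (Y (\<gamma> t)))"
    by (rule comp, use fr' in fast)+
  have cv: "continuous_on S (\<lambda>t. v t c)"
    by (rule continuous_on_subset[OF vc[OF cA]]) (use N in \<open>auto simp: S_def\<close>)
  let ?xx = "\<lambda>t. X (\<gamma> t) c \<bullet> X (\<gamma> t) c" and ?xy = "\<lambda>t. X (\<gamma> t) c \<bullet> Y (\<gamma> t) c" and ?yy = "\<lambda>t. Y (\<gamma> t) c \<bullet> Y (\<gamma> t) c"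
  let ?\<Delta> = "\<lambda>t. ?xx t * ?yy t - (?xy t)\<^sup>2"
  let ?a = "\<lambda>t. ((v t c \<bullet> X (\<gamma> t) c) * ?yy t - (v t c \<bullet> Y (\<gamma> t) c) * ?xy t) / ?\<Delta> t"
  let ?b = "\<lambda>t. ((v t c \<bullet> Y (\<gamma> t) c) * ?xx t - (v t c \<bullet> X (\<gamma> t) c) * ?xy t) / ?\<Delta> t"
  let ?q = "\<lambda>t. quad_form (g (\<gamma> t) (X (\<gamma> t)) (X (\<gamma> t))) (g (\<gamma> t) (X (\<gamma> t)) (Y (\<gamma> t))) (g (\<gamma> t) (Y (\<gamma> t)) (Y (\<gamma> t))) (?a t) (?b t)"
  have \<Delta>: "?\<Delta> s > 0" if "s \<in> S" for s
    using frame_near_gram(3)[OF fr, of "\<gamma> s"] that by (simp add: S_def)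
  have eq: "?q s = g (\<gamma> s) (v s) (v s)" if s: "s \<in> S" for s
  proof -
    have sN: "\<gamma> s \<in> N" and sJ: "s \<in> J" using s by (auto simp: S_def)
    obtain a b where ab: "v s c = a *\<^sub>R X (\<gamma> s) c + b *\<^sub>R Y (\<gamma> s) c"
      "g (\<gamma> s) (v s) (v s) = quad_form (g (\<gamma> s) (X (\<gamma> s)) (X (\<gamma> s))) (g (\<gamma> s) (X (\<gamma> s)) (Y (\<gamma> s))) (g (\<gamma> s) (Y (\<gamma> s)) (Y (\<gamma> s))) a b"
      using frame_near_quad[OF fr sN v[OF sJ]] .
    have vx: "v s c \<bullet> X (\<gamma> s) c = a * ?xx s + b * ?xy s" and vy: "v s c \<bullet> Y (\<gamma> s) c = a * ?xy s + b * ?yy s"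
      unfolding ab(1) by (simp_all add: inner_add_left inner_commute[of "Y (\<gamma> s) c" "X (\<gamma> s) c"])
    have "(a * ?xx s + b * ?xy s) * ?yy s - (a * ?xy s + b * ?yy s) * ?xy s = a * ?\<Delta> s"
      "(a * ?xy s + b * ?yy s) * ?xx s - (a * ?xx s + b * ?xy s) * ?xy s = b * ?\<Delta> s"
      by (simp_all add: algebra_simps power2_eq_square)
    then have "?a s = a" "?b s = b"
      unfolding vx vy using \<Delta>[OF s] by simp_all
    then show ?thesis unfolding ab(2) by simp
  qed
  have "continuous_on S ?q"
    unfolding quad_form_def
    by (intro continuous_on_add continuous_on_mult continuous_on_power continuous_on_divide continuous_on_diff
        continuous_on_inner cX cY cg cv continuous_on_const ballI) (use \<Delta> in force)+
  then have "continuous_on S (\<lambda>t. g (\<gamma> t) (v t) (v t))"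
    using eq by (rule continuous_on_eq)
  moreover have tS: "t \<in> S" using t p by (simp add: S_def)
  ultimately have "continuous (at t within S) (\<lambda>t. g (\<gamma> t) (v t) (v t))"
    by (simp add: continuous_on_eq_continuous_within)
  moreover obtain U where U: "open U" "J \<inter> \<gamma> -` N = J \<inter> U"
    using \<gamma> N(1) by (metis continuous_on_open_invariant inf_commute)
  have "at t within S = at t within J"
    by (rule at_within_nhd[of t U]) (use U tS in \<open>auto simp: S_def\<close>)
  ultimately show "continuous (at t within J) (\<lambda>t. g (\<gamma> t) (v t) (v t))" by simp
qed

section \<open>The Carnot--Caratheodory distance in a chart\<close>

text \<open>Smoothness of a curve in a chart speaks of derivatives within the part of the interval that is mapped
into the chart domain, velocities of derivatives within the whole interval.\<close>

lemma at_within_relatively_open: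
  assumes "continuous_on J \<gamma>" "open N" "t \<in> J" "\<gamma> t \<in> N"
  shows "at t within (J \<inter> \<gamma> -` N) = at t within J"
proof -
  obtain U where U: "open U" "J \<inter> \<gamma> -` N = J \<inter> U"
    using assms(1,2) by (metis continuous_on_open_invariant inf_commute)
  show ?thesis
    by (rule at_within_nhd[of t U]) (use U assms in auto)
qed

lemma smooth_curve_velocity:
  assumes A: "smooth_atlas A" and \<gamma>: "smooth_curve A {a..b} \<gamma>" and "a < b" and c: "c \<in> A"
  shows "t \<in> {a..b} \<Longrightarrow> \<gamma> t \<in> fst c \<Longrightarrow>
      (snd c \<circ> \<gamma> has_vector_derivative velocity A {a..b} \<gamma> t c) (at t within {a..b})"
    and "continuous_on ({a..b} \<inter> \<gamma> -` fst c) (\<lambda>t. velocity A {a..b} \<gamma> t c)"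
proof -
  let ?S = "{a..b} \<inter> \<gamma> -` fst c"
  have cont: "continuous_on {a..b} \<gamma>" and "smooth_on ?S (snd c \<circ> \<gamma>)"
    using \<gamma> c by (auto simp: smooth_curve_def)
  then have "Ck_on (Suc 0) ?S (snd c \<circ> \<gamma>)" by (intro smooth_onD)
  then obtain f' where f': "\<And>t. t \<in> ?S \<Longrightarrow> (snd c \<circ> \<gamma> has_derivative f' t) (at t within ?S)"
    "\<And>v. continuous_on ?S (\<lambda>t. f' t v)"
    unfolding Ck_on.simps by blast
  have d: "(snd c \<circ> \<gamma> has_vector_derivative f' t 1) (at t within {a..b})" if "t \<in> ?S" for t
  proof -
    have "f' t v = v *\<^sub>R f' t 1" for v
      using linear_cmul[OF has_derivative_linear[OF f'(1)[OF that]], of v 1] by simp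
    then have "f' t = (\<lambda>v. v *\<^sub>R f' t 1)" by blast
    moreover have "(snd c \<circ> \<gamma> has_derivative f' t) (at t within {a..b})"
      using f'(1)[OF that] at_within_relatively_open[OF cont atlasD(1)[OF A c]] that by simp
    ultimately show ?thesis by (simp add: has_vector_derivative_def)
  qed
  have vel: "velocity A {a..b} \<gamma> t c = f' t 1" if "t \<in> ?S" for t
  proof -
    have "vector_derivative (snd c \<circ> \<gamma>) (at t within cbox a b) = f' t 1"
      by (rule vector_derivative_within_cbox) (use that \<open>a < b\<close> d[OF that] in auto)
    then show ?thesis
      using that c by (simp add: velocity_def charts_at_def)
  qed
  show "t \<in> {a..b} \<Longrightarrow> \<gamma> t \<in> fst c \<Longrightarrow>
      (snd c \<circ> \<gamma> has_vector_derivative velocity A {a..b} \<gamma> t c) (at t within {a..b})"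
    using d[of t] vel[of t] by simp
  show "continuous_on ?S (\<lambda>t. velocity A {a..b} \<gamma> t c)"
    by (rule continuous_on_eq[OF f'(2)[of 1]]) (simp add: vel)
qed

text \<open>Away from the break points the velocity within [0, 1] agrees with the velocity within the smooth piece, whose
speed is continuous up to the ends of the piece.  At the break points the velocity within [0, 1] need not be
horizontal; there \<sigma> is 0 instead of the speed.\<close>

lemma horizontal_curve_regular:
  fixes A :: "'a::{t2_space,second_countable_topology} chart set"
  assumes A: "smooth_atlas A" and xi: "smooth_rank2_distribution A \<xi>" and g: "sub_riemannian_metric A \<xi> g"
    and "horizontal_curve A \<xi> \<gamma>"
  obtains F \<sigma> where "finite F" "continuous_on {0..1} \<gamma>" "\<sigma> integrable_on {0..1}"
    "integral {0..1} \<sigma> = curve_length A g \<gamma>" "\<And>t. t \<in> {0..1} \<Longrightarrow> 0 \<le> \<sigma> t"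
    "\<And>t. t \<in> {0<..<1} - F \<Longrightarrow> \<exists>v\<in>\<xi> (\<gamma> t). \<sigma> t = sqrt (g (\<gamma> t) v v) \<and>
        (\<forall>c\<in>charts_at A (\<gamma> t). (snd c \<circ> \<gamma> has_vector_derivative v c) (at t))"
proof -
  obtain n \<tau> where \<tau>: "\<tau> 0 = 0" "\<tau> n = 1" "\<And>i. i < n \<Longrightarrow> \<tau> i < \<tau> (Suc i)"
    and sm: "\<And>i. i < n \<Longrightarrow> smooth_curve A {\<tau> i..\<tau> (Suc i)} \<gamma>"
    and hor: "\<And>i t. i < n \<Longrightarrow> t \<in> {\<tau> i..\<tau> (Suc i)} \<Longrightarrow> velocity A {\<tau> i..\<tau> (Suc i)} \<gamma> t \<in> \<xi> (\<gamma> t)"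
    using assms(4) unfolding horizontal_curve_def by blast
  have mono: "\<tau> i \<le> \<tau> (i + k)" if "i + k \<le> n" for i k
    using that
  proof (induction k)
    case (Suc k)
    then have "\<tau> i \<le> \<tau> (i + k)" "\<tau> (i + k) < \<tau> (Suc (i + k))" using \<tau>(3)[of "i + k"] by simp_all
    then show ?case by simp
  qed simp
  have lo: "0 \<le> \<tau> i" and hi: "\<tau> i \<le> 1" if "i \<le> n" for i
    using mono[of 0 i] mono[of i "n - i"] that \<tau> by auto
  define F where "F = \<tau> ` {..n}"
  define v where "v = velocity A {0..1} \<gamma>"
  define s where "s t = sqrt (g (\<gamma> t) (v t) (v t))" for t
  have piece: "v t = velocity A {\<tau> i..\<tau> (Suc i)} \<gamma> t" if "i < n" "t \<in> {\<tau> i<..<\<tau> (Suc i)}" for i t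
  proof -
    have "0 < t" "t < 1" "\<tau> i < t" "t < \<tau> (Suc i)"
      using that lo[of i] hi[of "Suc i"] by auto
    then have "at t within {0..1} = at t" "at t within {\<tau> i..\<tau> (Suc i)} = at t"
      using at_within_Icc_at[of 0 t 1] at_within_Icc_at[of "\<tau> i" t "\<tau> (Suc i)"] by blast+
    then show ?thesis
      unfolding v_def velocity_def by (simp only:)
  qed
  have int_piece: "s integrable_on {\<tau> i..\<tau> (Suc i)}" if i: "i < n" for i
  proof -
    let ?J = "{\<tau> i..\<tau> (Suc i)}"
    have "continuous_on ?J (\<lambda>t. g (\<gamma> t) (velocity A ?J \<gamma> t) (velocity A ?J \<gamma> t))"
    proof (rule metric_continuous_along[OF A xi g])
      show "continuous_on ?J \<gamma>" using sm[OF i] by (simp add: smooth_curve_def)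
      show "continuous_on (?J \<inter> \<gamma> -` fst c) (\<lambda>t. velocity A ?J \<gamma> t c)" if "c \<in> A" for c
        by (rule smooth_curve_velocity(2)[OF A sm[OF i] \<tau>(3)[OF i] that])
    qed (rule hor[OF i])
    then have "(\<lambda>t. sqrt (g (\<gamma> t) (velocity A ?J \<gamma> t) (velocity A ?J \<gamma> t))) integrable_on ?J"
      by (intro integrable_continuous_real continuous_on_real_sqrt)
    then show ?thesis
      by (rule integrable_spike_finite[where S = "{\<tau> i, \<tau> (Suc i)}", rotated 2])
        (auto simp: s_def piece[OF i])
  qed
  have "continuous_on {0..\<tau> m} \<gamma> \<and> s integrable_on {0..\<tau> m} \<and>
      (\<forall>t\<in>{0<..<\<tau> m} - F. \<exists>i<m. t \<in> {\<tau> i<..<\<tau> (Suc i)})" if "m \<le> n" for m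
    using that
  proof (induction m)
    case 0
    then show ?case using integrable_on_refl[of s 0] by (simp add: \<tau>)
  next
    case (Suc m)
    then have m: "m < n" "0 \<le> \<tau> m" "\<tau> m \<le> \<tau> (Suc m)" and IH: "continuous_on {0..\<tau> m} \<gamma>" "s integrable_on {0..\<tau> m}"
      "\<And>t. t \<in> {0<..<\<tau> m} - F \<Longrightarrow> \<exists>i<m. t \<in> {\<tau> i<..<\<tau> (Suc i)}"
      using lo[of m] \<tau>(3)[of m] by auto
    have un: "{0..\<tau> (Suc m)} = {0..\<tau> m} \<union> {\<tau> m..\<tau> (Suc m)}" using m by auto
    have "continuous_on {0..\<tau> (Suc m)} \<gamma>"
      unfolding un using sm[OF m(1)] by (intro continuous_on_closed_Un IH(1)) (auto simp: smooth_curve_def)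
    moreover have "s integrable_on {0..\<tau> (Suc m)}"
      using Henstock_Kurzweil_Integration.integrable_combine[OF m(2,3) IH(2) int_piece[OF m(1)]] .
    moreover have "\<exists>i<Suc m. t \<in> {\<tau> i<..<\<tau> (Suc i)}" if "t \<in> {0<..<\<tau> (Suc m)} - F" for t
    proof (cases "t < \<tau> m")
      case True
      then have "t \<in> {0<..<\<tau> m} - F" using that by auto
      then obtain i where "i < m" "t \<in> {\<tau> i<..<\<tau> (Suc i)}" using IH(3) by blast
      then show ?thesis by (intro exI[of _ i]) auto
    next
      case False
      moreover have "t \<noteq> \<tau> m" using that m(1) by (auto simp: F_def)
      ultimately show ?thesis using that by (intro exI[of _ m]) auto
    qed
    ultimately show ?case by blast
  qed
  from this[of n] have all: "continuous_on {0..1} \<gamma>" "s integrable_on {0..1}"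
      "\<And>t. t \<in> {0<..<1} - F \<Longrightarrow> \<exists>i<n. t \<in> {\<tau> i<..<\<tau> (Suc i)}"
    by (auto simp: \<tau>)
  have F: "finite F" "0 \<in> F" "1 \<in> F"
    unfolding F_def using image_eqI[of 0 \<tau> 0 "{..n}"] image_eqI[of 1 \<tau> n "{..n}"] \<tau>(1,2) by simp_all
  have hv: "v t \<in> \<xi> (\<gamma> t)" "\<forall>c\<in>charts_at A (\<gamma> t). (snd c \<circ> \<gamma> has_vector_derivative v t c) (at t)"
    if "t \<in> {0<..<1} - F" for t
  proof -
    obtain i where i: "i < n" "t \<in> {\<tau> i<..<\<tau> (Suc i)}" using all(3)[OF \<open>t \<in> {0<..<1} - F\<close>] by blast
    show "v t \<in> \<xi> (\<gamma> t)"
      unfolding piece[OF i] using i by (intro hor) auto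
    show "\<forall>c\<in>charts_at A (\<gamma> t). (snd c \<circ> \<gamma> has_vector_derivative v t c) (at t)"
    proof
      fix c assume "c \<in> charts_at A (\<gamma> t)"
      then have "(snd c \<circ> \<gamma> has_vector_derivative v t c) (at t within {\<tau> i..\<tau> (Suc i)})"
        unfolding piece[OF i] using i by (intro smooth_curve_velocity(1)[OF A sm \<tau>(3)]) (auto simp: charts_at_def)
      then show "(snd c \<circ> \<gamma> has_vector_derivative v t c) (at t)"
        using i(2) at_within_Icc_at[of "\<tau> i" t "\<tau> (Suc i)"] by simp
    qed
  qed
  have nonneg: "0 \<le> s t" if "t \<in> {0<..<1} - F" for t
  proof -
    obtain c where c: "c \<in> charts_at A (\<gamma> t)" by (rule exists_chart_at[OF A])
    obtain N K where N: "open N" "\<gamma> t \<in> N" "N \<subseteq> fst c" "K > 0"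
      and K: "\<forall>q\<in>N. \<forall>v\<in>\<xi> q. norm (v c) \<le> K * sqrt (g q v v) \<and> sqrt (g q v v) \<le> K * norm (v c)"
      using metric_comparable_to_chart_norm[OF A xi g c] .
    have "0 \<le> K * s t"
      unfolding s_def using K N(2) hv(1)[OF that] by (blast intro: order_trans[OF norm_ge_zero])
    then show ?thesis using \<open>K > 0\<close> by (simp add: zero_le_mult_iff)
  qed
  define \<sigma> where "\<sigma> t = (if t \<in> F then 0 else s t)" for t
  have \<sigma>: "(\<sigma> has_integral integral {0..1} s) {0..1}"
    by (rule has_integral_spike_finite[OF F(1) _ integrable_integral[OF all(2)]]) (simp add: \<sigma>_def)
  show thesis
  proof (rule that[of F \<sigma>])
    show "integral {0..1} \<sigma> = curve_length A g \<gamma>"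
      using integral_unique[OF \<sigma>] by (simp add: curve_length_def s_def[abs_def] v_def)
    show "0 \<le> \<sigma> t" if "t \<in> {0..1}" for t
    proof (cases "t \<in> F")
      case False
      then have "t \<in> {0<..<1} - F" using that F by (auto simp: less_le)
      then show ?thesis using nonneg by (simp add: \<sigma>_def)
    qed (simp add: \<sigma>_def)
    show "\<exists>v\<in>\<xi> (\<gamma> t). \<sigma> t = sqrt (g (\<gamma> t) v v) \<and>
        (\<forall>c\<in>charts_at A (\<gamma> t). (snd c \<circ> \<gamma> has_vector_derivative v c) (at t))" if "t \<in> {0<..<1} - F" for t
      using hv[OF that] that by (intro bexI[of _ "v t"]) (auto simp: \<sigma>_def s_def)
  qed (use F(1) all(1) \<sigma> in \<open>auto intro: has_integral_integrable\<close>)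
qed

lemma norm_diff_le_integral:
  fixes f :: "real \<Rightarrow> 'v::banach"
  assumes "finite F" "a \<le> b" "continuous_on {a..b} f" "\<sigma> integrable_on {a..b}" "\<And>t. t \<in> {a..b} \<Longrightarrow> 0 \<le> \<sigma> t"
    and "\<And>t. t \<in> {a<..<b} - F \<Longrightarrow> \<exists>w. (f has_vector_derivative w) (at t) \<and> norm w \<le> \<sigma> t"
  shows "norm (f b - f a) \<le> integral {a..b} \<sigma>"
proof -
  have "\<forall>t. \<exists>w. t \<in> {a<..<b} - F \<longrightarrow> (f has_vector_derivative w) (at t) \<and> norm w \<le> \<sigma> t"
    using assms(6) by blast
  from choice[OF this] obtain w where
    w: "\<And>t. t \<in> {a<..<b} - F \<Longrightarrow> (f has_vector_derivative w t) (at t) \<and> norm (w t) \<le> \<sigma> t"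
    by blast
  define w' where "w' t = (if t \<in> {a<..<b} - F then w t else 0)" for t
  have "(w' has_integral f b - f a) {a..b}"
    by (rule fundamental_theorem_of_calculus_interior_strong[OF assms(1,2) _ assms(3)]) (use w in \<open>simp add: w'_def\<close>)
  then have w': "w' integrable_on {a..b}" "integral {a..b} w' = f b - f a"
    by (rule has_integral_integrable, rule integral_unique)
  have "norm (integral {a..b} w') \<le> integral {a..b} \<sigma>"
  proof (rule integral_norm_bound_integral[OF w'(1) assms(4)])
    show "norm (w' t) \<le> \<sigma> t" if "t \<in> {a..b}" for t
      using w[of t] assms(5)[OF that] by (simp add: w'_def)
  qed
  then show ?thesis by (simp only: w'(2))
qed

text \<open>The first time at which the curve leaves N would be a limit of times at which it is in the closed set
norm (\<psi> q) \<le> s, which is part of N; so the length bound keeps the curve in N.  For the last claim, the function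
z - P x - Q y with P and Q frozen at the start has derivative (P - P(start)) x' + (Q - Q(start)) y' along the
curve, where the coefficients are bounded by C times the length.\<close>

lemma horizontal_curve_estimate:
  fixes \<gamma> :: "real \<Rightarrow> 'a::t2_space" and \<psi> :: "'a \<Rightarrow> real^3"
  assumes \<gamma>: "continuous_on {0..1} \<gamma>" and "finite F"
    and \<sigma>: "\<sigma> integrable_on {0..1}" "\<And>t. t \<in> {0..1} \<Longrightarrow> 0 \<le> \<sigma> t" and "K \<ge> 0"
    and deriv: "\<And>t. t \<in> {0<..<1} - F \<Longrightarrow> \<gamma> t \<in> N \<Longrightarrow> \<exists>w. (\<psi> \<circ> \<gamma> has_vector_derivative w) (at t) \<and>
          norm w \<le> K * \<sigma> t \<and> w$3 = P (\<psi> (\<gamma> t)) * w$1 + Q (\<psi> (\<gamma> t)) * w$2"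
    and N: "open N" "continuous_on N \<psi>" "closed {q\<in>N. norm (\<psi> q) \<le> s}"
    and start: "\<gamma> 0 \<in> N" "norm (\<psi> (\<gamma> 0)) + K * integral {0..1} \<sigma> \<le> s"
    and P: "C-lipschitz_on (cball 0 s) P" and Q: "C-lipschitz_on (cball 0 s) Q"
  shows "\<gamma> 1 \<in> N" "norm (\<psi> (\<gamma> 1) - \<psi> (\<gamma> 0)) \<le> K * integral {0..1} \<sigma>"
    "\<bar>\<psi> (\<gamma> 1) $ 3 - \<psi> (\<gamma> 0) $ 3 - P (\<psi> (\<gamma> 0)) * (\<psi> (\<gamma> 1) $ 1 - \<psi> (\<gamma> 0) $ 1) - Q (\<psi> (\<gamma> 0)) * (\<psi> (\<gamma> 1) $ 2 - \<psi> (\<gamma> 0) $ 2)\<bar>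
       \<le> 2 * C * (K * integral {0..1} \<sigma>)\<^sup>2"
proof -
  have "C \<ge> 0" by (rule lipschitz_on_nonneg[OF P])
  note lipP = lipschitz_on_real_bound[OF P] and lipQ = lipschitz_on_real_bound[OF Q]
  define len where "len = K * integral {0..1} \<sigma>"
  have len0: "0 \<le> len"
    unfolding len_def using \<sigma> \<open>K \<ge> 0\<close> by (intro mult_nonneg_nonneg integral_nonneg) auto
  have sub: "\<sigma> integrable_on {0..T}" "integral {0..T} \<sigma> \<le> integral {0..1} \<sigma>" if "T \<in> {0..1}" for T
  proof -
    show i: "\<sigma> integrable_on {0..T}"
      using integrable_on_subinterval[OF \<sigma>(1)] that by auto
    show "integral {0..T} \<sigma> \<le> integral {0..1} \<sigma>"
      using that \<sigma> i by (intro integral_subset_le) auto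
  qed
  have cont: "continuous_on {0..T} (\<psi> \<circ> \<gamma>)" if "T \<in> {0..1}" "\<And>t. t \<in> {0..T} \<Longrightarrow> \<gamma> t \<in> N" for T
    by (rule continuous_on_compose[OF continuous_on_subset[OF \<gamma>] continuous_on_subset[OF N(2)]]) (use that in auto)
  have near: "norm (\<psi> (\<gamma> T) - \<psi> (\<gamma> 0)) \<le> len" if T: "T \<in> {0..1}" and inN: "\<And>t. t \<in> {0..T} \<Longrightarrow> \<gamma> t \<in> N" for T
  proof -
    have "norm ((\<psi> \<circ> \<gamma>) T - (\<psi> \<circ> \<gamma>) 0) \<le> integral {0..T} (\<lambda>t. K * \<sigma> t)"
    proof (rule norm_diff_le_integral[OF \<open>finite F\<close> _ cont[OF T inN]])
      show "\<exists>w. (\<psi> \<circ> \<gamma> has_vector_derivative w) (at t) \<and> norm w \<le> K * \<sigma> t" if "t \<in> {0<..<T} - F" for t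
        using deriv[of t] that T inN[of t] by auto
    qed (use T sub \<sigma>(2) \<open>K \<ge> 0\<close> in \<open>auto intro: integrable_on_mult_right\<close>)
    also have "\<dots> \<le> len"
      unfolding len_def using sub(2)[OF T] \<open>K \<ge> 0\<close> by (simp add: mult_left_mono)
    finally show ?thesis by simp
  qed
  have inK: "norm (\<psi> (\<gamma> T)) \<le> s" if T: "T \<in> {0..1}" and inN: "\<And>t. t \<in> {0..T} \<Longrightarrow> \<gamma> t \<in> N" for T
    using near[OF that] start(2) norm_triangle_ineq[of "\<psi> (\<gamma> T) - \<psi> (\<gamma> 0)" "\<psi> (\<gamma> 0)"] by (simp add: len_def)
  have all: "\<gamma> t \<in> N" if "t \<in> {0..1}" for t
  proof (rule ccontr)
    assume "\<gamma> t \<notin> N"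
    define B where "B = {0..1} \<inter> \<gamma> -` (- N)"
    have B: "closed B" "B \<noteq> {}" "bdd_below B"
      using continuous_closed_preimage[OF \<gamma>, of "- N"] N(1) \<open>\<gamma> t \<notin> N\<close> that
      by (auto simp: B_def intro: bdd_belowI[of _ 0])
    define T where "T = Inf B"
    have T: "T \<in> B" unfolding T_def by (rule closed_contains_Inf[OF B(2,3,1)])
    have T01: "T \<in> {0..1}" "\<gamma> T \<notin> N" using T by (auto simp: B_def)
    have "T \<noteq> 0" using T01(2) start(1) by auto
    then have T0: "0 < T" using T01(1) by auto
    have before: "\<gamma> u \<in> N" if "u \<in> {0..<T}" for u
    proof (rule ccontr)
      assume "\<gamma> u \<notin> N"
      then have "u \<in> B" using that T01 by (auto simp: B_def)
      then have "T \<le> u" unfolding T_def using B(3) by (rule cInf_lower)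
      then show False using that by simp
    qed
    let ?C = "{q\<in>N. norm (\<psi> q) \<le> s}"
    have "closed ({0..T} \<inter> \<gamma> -` ?C)"
      by (rule continuous_closed_preimage[OF continuous_on_subset[OF \<gamma>] _ N(3)]) (use T01 in auto)
    moreover have "{0..<T} \<subseteq> {0..T} \<inter> \<gamma> -` ?C"
    proof
      fix u assume u: "u \<in> {0..<T}"
      have "norm (\<psi> (\<gamma> u)) \<le> s"
        by (rule inK) (use u T01 before in auto)
      then show "u \<in> {0..T} \<inter> \<gamma> -` ?C" using u before[OF u] by auto
    qed
    ultimately have "closure {0..<T} \<subseteq> {0..T} \<inter> \<gamma> -` ?C"
      by (rule closure_minimal[rotated])
    moreover have "T \<in> closure {0..<T}" using T0 by simp
    ultimately have "T \<in> {0..T} \<inter> \<gamma> -` ?C" by (rule subsetD)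
    then show False using T01(2) by auto
  qed
  show "\<gamma> 1 \<in> N" by (rule all) simp
  show "norm (\<psi> (\<gamma> 1) - \<psi> (\<gamma> 0)) \<le> K * integral {0..1} \<sigma>"
    using near[of 1] all by (simp add: len_def)
  define L where "L w = w$3 - P (\<psi> (\<gamma> 0)) * w$1 - Q (\<psi> (\<gamma> 0)) * w$2" for w :: "real^3"
  have L: "bounded_linear L"
    unfolding L_def[abs_def]
    by (intro bounded_linear_sub bounded_linear_vec_nth bounded_linear_const_mult)
  have "norm ((L \<circ> (\<psi> \<circ> \<gamma>)) 1 - (L \<circ> (\<psi> \<circ> \<gamma>)) 0) \<le> integral {0..1} (\<lambda>t. 2 * C * len * K * \<sigma> t)"
  proof (rule norm_diff_le_integral[OF \<open>finite F\<close>])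
    show "continuous_on {0..1} (L \<circ> (\<psi> \<circ> \<gamma>))"
      by (rule continuous_on_compose[OF cont linear_continuous_on[OF L]]) (use all in auto)
    fix t :: real assume t: "t \<in> {0<..<1} - F"
    have tN: "\<gamma> t \<in> N" using all t by auto
    obtain w where w: "(\<psi> \<circ> \<gamma> has_vector_derivative w) (at t)" "norm w \<le> K * \<sigma> t"
      "w$3 = P (\<psi> (\<gamma> t)) * w$1 + Q (\<psi> (\<gamma> t)) * w$2"
      using deriv[OF t tN] by blast
    have d: "(L \<circ> (\<psi> \<circ> \<gamma>) has_vector_derivative L w) (at t)"
      using bounded_linear.has_vector_derivative[OF L w(1)] by (simp add: o_def)
    have tt: "norm (\<psi> (\<gamma> t) - \<psi> (\<gamma> 0)) \<le> len" "\<psi> (\<gamma> t) \<in> cball 0 s" "\<psi> (\<gamma> 0) \<in> cball 0 s"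
      using near[of t] inK[of t] inK[of 0] all t by auto
    have p: "\<bar>P (\<psi> (\<gamma> t)) - P (\<psi> (\<gamma> 0))\<bar> \<le> C * len" "\<bar>Q (\<psi> (\<gamma> t)) - Q (\<psi> (\<gamma> 0))\<bar> \<le> C * len"
      using lipP[OF tt(3,2)] lipQ[OF tt(3,2)] mult_left_mono[OF tt(1) \<open>C \<ge> 0\<close>] by linarith+
    have wi: "\<bar>w$i\<bar> \<le> K * \<sigma> t" for i
      using component_le_norm_cart w(2) order_trans by blast
    have "L w = (P (\<psi> (\<gamma> t)) - P (\<psi> (\<gamma> 0))) * w$1 + (Q (\<psi> (\<gamma> t)) - Q (\<psi> (\<gamma> 0))) * w$2"
      by (simp add: L_def w(3) algebra_simps)
    then have "\<bar>L w\<bar> \<le> \<bar>(P (\<psi> (\<gamma> t)) - P (\<psi> (\<gamma> 0))) * w$1\<bar> + \<bar>(Q (\<psi> (\<gamma> t)) - Q (\<psi> (\<gamma> 0))) * w$2\<bar>"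
      by simp
    also have "\<dots> \<le> (C * len) * (K * \<sigma> t) + (C * len) * (K * \<sigma> t)"
      unfolding abs_mult using \<open>C \<ge> 0\<close> len0 by (intro add_mono mult_mono p wi) auto
    finally show "\<exists>w. (L \<circ> (\<psi> \<circ> \<gamma>) has_vector_derivative w) (at t) \<and> norm w \<le> 2 * C * len * K * \<sigma> t"
      using d by (intro exI[of _ "L w"]) (simp add: algebra_simps)
  qed (use \<sigma> \<open>C \<ge> 0\<close> \<open>K \<ge> 0\<close> len0 in \<open>auto intro: integrable_on_mult_right\<close>)
  also have "\<dots> = 2 * C * len\<^sup>2"
    by (simp add: len_def power2_eq_square)
  finally show "\<bar>\<psi> (\<gamma> 1) $ 3 - \<psi> (\<gamma> 0) $ 3 - P (\<psi> (\<gamma> 0)) * (\<psi> (\<gamma> 1) $ 1 - \<psi> (\<gamma> 0) $ 1) - Q (\<psi> (\<gamma> 0)) * (\<psi> (\<gamma> 1) $ 2 - \<psi> (\<gamma> 0) $ 2)\<bar>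
       \<le> 2 * C * (K * integral {0..1} \<sigma>)\<^sup>2"
    by (simp add: L_def len_def algebra_simps)
qed

lemma smooth_curve_from_chart:
  fixes A :: "'a::{t2_space,second_countable_topology} chart set"
  assumes A: "smooth_atlas A" and c: "c \<in> A"
    and z: "smooth_on {0..1} \<zeta>" "\<And>t. t \<in> {0..1} \<Longrightarrow> \<zeta> t \<in> snd c ` fst c"
    and \<gamma>: "\<And>t. t \<in> {0..1} \<Longrightarrow> \<gamma> t = chart_inv c (\<zeta> t)"
  shows "smooth_curve A {0..1} \<gamma>"
  unfolding smooth_curve_def
proof (intro conjI ballI)
  have in_c: "\<gamma> t \<in> fst c" "snd c (\<gamma> t) = \<zeta> t" if "t \<in> {0..1}" for t
    using z(2)[OF that] by (auto simp: \<gamma>[OF that] inv_into_into f_inv_into_f)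
  have "continuous_on {0..1} (\<lambda>t. chart_inv c (\<zeta> t))"
    by (rule continuous_on_compose2[OF homeomorphism_cont2[OF atlasD(3)[OF A c]] smooth_on_imp_continuous[OF z(1)]])
      (use z(2) in auto)
  then show "continuous_on {0..1} \<gamma>"
    by (rule continuous_on_eq) (simp add: \<gamma>)
  fix c' assume c': "c' \<in> A"
  let ?S = "{0..1} \<inter> \<gamma> -` fst c'"
  show "smooth_on ?S (snd c' \<circ> \<gamma>)"
    unfolding smooth_on_def
  proof
    fix k
    have "Ck_on k ?S (\<lambda>t. transition c c' (\<zeta> t))"
    proof (rule Ck_on_compose[where X = \<zeta> and F = "transition c c'"])
      show "\<zeta> ` ?S \<subseteq> snd c ` (fst c \<inter> fst c')"
        using in_c by (force simp: image_iff)
      show "Ck_on k ?S \<zeta>"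
        by (rule Ck_on_subset[OF smooth_onD[OF z(1)]]) simp
      show "Ck_on k (snd c ` (fst c \<inter> fst c')) (transition c c')"
        by (rule smooth_onD[OF transition_smooth[OF A c c']])
    qed
    then show "Ck_on k ?S (snd c' \<circ> \<gamma>)"
      by (rule Ck_on_cong) (simp add: transition_def \<gamma>)
  qed
qed

text \<open>The chain rule for the coordinate change between two charts.\<close>

lemma velocity_in_tangent_space:
  fixes A :: "'a::{t2_space,second_countable_topology} chart set"
  assumes A: "smooth_atlas A" and \<gamma>: "smooth_curve A {a..b} \<gamma>" and "a < b" and t: "t \<in> {a..b}"
  shows "velocity A {a..b} \<gamma> t \<in> tangent_space A (\<gamma> t)"
  unfolding tangent_space_def
proof (intro CollectI conjI allI impI ballI)
  show "c \<notin> charts_at A (\<gamma> t) \<Longrightarrow> velocity A {a..b} \<gamma> t c = 0" for c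
    by (simp add: velocity_def)
  fix c c' assume c: "c \<in> charts_at A (\<gamma> t)" and c': "c' \<in> charts_at A (\<gamma> t)"
  let ?v = "velocity A {a..b} \<gamma> t" and ?S = "{a..b} \<inter> \<gamma> -` (fst c \<inter> fst c')"
  let ?D = "frechet_derivative (transition c c') (at (snd c (\<gamma> t)))"
  have cA: "c \<in> A" "\<gamma> t \<in> fst c" and c'A: "c' \<in> A" "\<gamma> t \<in> fst c'" using c c' by (auto simp: charts_at_def)
  have cont: "continuous_on {a..b} \<gamma>" using \<gamma> by (simp add: smooth_curve_def)
  have op: "open (fst c \<inter> fst c')" using atlasD(1)[OF A] cA c'A by blast
  have w: "at t within ?S = at t within {a..b}"
    by (rule at_within_relatively_open[OF cont op t]) (use cA c'A in auto)
  have "(snd c \<circ> \<gamma> has_derivative (\<lambda>h. h *\<^sub>R ?v c)) (at t within ?S)"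
    using smooth_curve_velocity(1)[OF A \<gamma> \<open>a < b\<close> cA(1) t cA(2)] unfolding w has_vector_derivative_def .
  moreover have "(transition c c' has_derivative ?D) (at ((snd c \<circ> \<gamma>) t))"
    using transition_has_derivative[OF A c c'] by simp
  ultimately have "(transition c c' \<circ> (snd c \<circ> \<gamma>) has_derivative ?D \<circ> (\<lambda>h. h *\<^sub>R ?v c)) (at t within ?S)"
    by (intro diff_chain_within) (auto intro: has_derivative_at_withinI)
  moreover have "?D \<circ> (\<lambda>h. h *\<^sub>R ?v c) = (\<lambda>h. h *\<^sub>R ?D (?v c))"
    using linear_cmul[OF has_derivative_linear[OF transition_has_derivative[OF A c c']]] by auto
  ultimately have "(transition c c' \<circ> (snd c \<circ> \<gamma>) has_derivative (\<lambda>h. h *\<^sub>R ?D (?v c))) (at t within ?S)"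
    by simp
  then have "(snd c' \<circ> \<gamma> has_derivative (\<lambda>h. h *\<^sub>R ?D (?v c))) (at t within ?S)"
    by (rule has_derivative_transform[rotated 2])
      (use t cA c'A in \<open>auto simp: transition_def chart_inv_chart[OF A cA(1)]\<close>)
  then have "(snd c' \<circ> \<gamma> has_vector_derivative ?D (?v c)) (at t within {a..b})"
    unfolding w has_vector_derivative_def .
  moreover have "(snd c' \<circ> \<gamma> has_vector_derivative ?v c') (at t within {a..b})"
    by (rule smooth_curve_velocity(1)[OF A \<gamma> \<open>a < b\<close> c'A(1) t c'A(2)])
  ultimately show "?v c' = ?D (?v c)"
    using vector_derivative_unique_within_closed_interval[OF \<open>a < b\<close>, of t "snd c' \<circ> \<gamma>"] t by (simp add: cbox_interval)
qed

lemma cc_dist_le_of_speed: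
  fixes A :: "'a::{t2_space,second_countable_topology} chart set"
  assumes \<gamma>: "smooth_curve A {0..1} \<gamma>"
    and hor: "\<And>t. t \<in> {0..1} \<Longrightarrow> velocity A {0..1} \<gamma> t \<in> \<xi> (\<gamma> t)"
    and sp: "\<And>t. t \<in> {0..1} \<Longrightarrow> sqrt (g (\<gamma> t) (velocity A {0..1} \<gamma> t) (velocity A {0..1} \<gamma> t)) \<le> L" and "L \<ge> 0"
  shows "cc_dist A \<xi> g (\<gamma> 0) (\<gamma> 1) \<le> ennreal L"
proof -
  have "horizontal_curve A \<xi> \<gamma>"
    unfolding horizontal_curve_def
    by (intro exI[of _ 1] exI[of _ real]) (use \<gamma> hor in auto)
  then have "cc_dist A \<xi> g (\<gamma> 0) (\<gamma> 1) \<le> ennreal (curve_length A g \<gamma>)"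
    unfolding cc_dist_def by (intro INF_lower) simp
  also have "curve_length A g \<gamma> \<le> L"
  proof (cases "(\<lambda>t. sqrt (g (\<gamma> t) (velocity A {0..1} \<gamma> t) (velocity A {0..1} \<gamma> t))) integrable_on {0..1}")
    case True
    then have "curve_length A g \<gamma> \<le> integral {0..1} (\<lambda>_::real. L)"
      unfolding curve_length_def by (intro integral_le) (use sp in auto)
    then show ?thesis by simp
  next
    case False
    then show ?thesis unfolding curve_length_def using \<open>L \<ge> 0\<close> by (simp add: not_integrable_integral)
  qed
  finally show ?thesis by (simp add: ennreal_leI)
qed

text \<open>The part of the curve between the times s and t, reparametrised affinely to [0, 1], is horizontal.  For t < s it is
run backwards.\<close>

lemma horizontal_chart_curve_lipschitz:
  fixes A :: "'a::{t2_space,second_countable_topology} chart set"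
  assumes A: "smooth_atlas A" and c: "c \<in> A"
    and z: "smooth_on {-1..1} \<zeta>" "\<And>t. t \<in> {-1..1} \<Longrightarrow> (\<zeta> has_vector_derivative \<zeta>' t) (at t within {-1..1})"
    and inc: "\<And>t. t \<in> {-1..1} \<Longrightarrow> \<zeta> t \<in> snd c ` fst c"
    and N: "\<And>t. t \<in> {-1..1} \<Longrightarrow> chart_inv c (\<zeta> t) \<in> N" and "K \<ge> 0"
    and comp: "\<And>q v. q \<in> N \<Longrightarrow> v \<in> \<xi> q \<Longrightarrow> sqrt (g q v v) \<le> K * norm (v c)"
    and hor: "\<And>t s v. t \<in> {-1..1} \<Longrightarrow> v \<in> tangent_space A (chart_inv c (\<zeta> t)) \<Longrightarrow> v c = s *\<^sub>R \<zeta>' t \<Longrightarrow> v \<in> \<xi> (chart_inv c (\<zeta> t))"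
    and bd: "\<And>t. t \<in> {-1..1} \<Longrightarrow> norm (\<zeta>' t) \<le> D"
    and st: "s \<in> {-1..1}" "t \<in> {-1..1}"
  shows "cc_dist A \<xi> g (chart_inv c (\<zeta> s)) (chart_inv c (\<zeta> t)) \<le> ennreal (K * D * \<bar>s - t\<bar>)"
proof -
  define r where "r u = s + u * (t - s)" for u
  have r: "r u \<in> {-1..1}" if "u \<in> {0..1}" for u
  proof -
    have "r u = (1 - u) * s + u * t" by (simp add: r_def algebra_simps)
    moreover have "(1 - u) * s \<le> (1 - u) * 1" "(1 - u) * (-1) \<le> (1 - u) * s" "u * t \<le> u * 1" "u * (-1) \<le> u * t"
      using that st by (intro mult_left_mono; simp)+
    ultimately show ?thesis by simp
  qed
  define \<eta> where "\<eta> u = \<zeta> (r u)" for u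
  define \<beta> where "\<beta> u = chart_inv c (\<eta> u)" for u
  have smr: "Ck_on k {0..1} r" for k
    unfolding r_def[abs_def] by (intro Ck_on_add Ck_on_const Ck_on_mult Ck_on_bounded_linear bounded_linear_ident)
  have sm: "smooth_on {0..1} \<eta>"
    unfolding smooth_on_def \<eta>_def[abs_def]
    by (intro allI Ck_on_compose[where X = r and F = \<zeta>, OF _ smr smooth_onD[OF z(1)]]) (use r in auto)
  have curve: "smooth_curve A {0..1} \<beta>"
    by (rule smooth_curve_from_chart[OF A c sm]) (use inc r in \<open>auto simp: \<eta>_def \<beta>_def\<close>)
  have in_c: "\<beta> u \<in> fst c" "snd c (\<beta> u) = \<eta> u" if "u \<in> {0..1}" for u
    using inc[OF r[OF that]] by (auto simp: \<beta>_def \<eta>_def inv_into_into f_inv_into_f)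
  have vc: "velocity A {0..1} \<beta> u c = (t - s) *\<^sub>R \<zeta>' (r u)" if u: "u \<in> {0..1}" for u
  proof -
    have "(r has_vector_derivative (t - s)) (at u within {0..1})"
      unfolding r_def[abs_def] by (auto intro!: derivative_eq_intros simp: has_real_derivative_iff_has_vector_derivative[symmetric])
    moreover have "(\<zeta> has_vector_derivative \<zeta>' (r u)) (at (r u) within r ` {0..1})"
      by (rule has_vector_derivative_within_subset[OF z(2)[OF r[OF u]]]) (use r in auto)
    ultimately have "(\<zeta> \<circ> r has_vector_derivative (t - s) *\<^sub>R \<zeta>' (r u)) (at u within {0..1})"
      by (rule vector_diff_chain_within)
    then have "(snd c \<circ> \<beta> has_vector_derivative (t - s) *\<^sub>R \<zeta>' (r u)) (at u within {0..1})"
      by (rule has_vector_derivative_transform[rotated 2]) (use u in_c in \<open>auto simp: \<eta>_def\<close>)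
    moreover have "(snd c \<circ> \<beta> has_vector_derivative velocity A {0..1} \<beta> u c) (at u within {0..1})"
      by (rule smooth_curve_velocity(1)[OF A curve _ c u]) (use in_c u in auto)
    ultimately show ?thesis
      using vector_derivative_unique_within_closed_interval[of 0 1 u "snd c \<circ> \<beta>"] u by (simp add: cbox_interval)
  qed
  have hv: "velocity A {0..1} \<beta> u \<in> \<xi> (\<beta> u)" if u: "u \<in> {0..1}" for u
    using hor[OF r[OF u], of "velocity A {0..1} \<beta> u" "t - s"] vc[OF u] velocity_in_tangent_space[OF A curve _ u] by (simp add: \<beta>_def \<eta>_def)
  have "cc_dist A \<xi> g (\<beta> 0) (\<beta> 1) \<le> ennreal (K * D * \<bar>s - t\<bar>)"
  proof (rule cc_dist_le_of_speed[OF curve hv])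
    have "0 \<le> D" using bd[OF st(1)] norm_ge_zero order_trans by blast
    then show "0 \<le> K * D * \<bar>s - t\<bar>" using \<open>K \<ge> 0\<close> by simp
    fix u :: real assume u: "u \<in> {0..1}"
    have "sqrt (g (\<beta> u) (velocity A {0..1} \<beta> u) (velocity A {0..1} \<beta> u)) \<le> K * norm (velocity A {0..1} \<beta> u c)"
      by (rule comp[OF _ hv[OF u]]) (use N[OF r[OF u]] in \<open>simp add: \<beta>_def \<eta>_def\<close>)
    also have "\<dots> = K * \<bar>s - t\<bar> * norm (\<zeta>' (r u))"
      unfolding vc[OF u] by (simp add: abs_minus_commute)
    also have "\<dots> \<le> K * \<bar>s - t\<bar> * D"
      using bd[OF r[OF u]] \<open>K \<ge> 0\<close> by (intro mult_left_mono) auto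
    finally show "sqrt (g (\<beta> u) (velocity A {0..1} \<beta> u) (velocity A {0..1} \<beta> u)) \<le> K * D * \<bar>s - t\<bar>"
      by (simp add: algebra_simps)
  qed
  then show ?thesis by (simp add: \<beta>_def \<eta>_def r_def)
qed

section \<open>Normal form of a contact form\<close>

lemma vec3_expand: "(w::real^3) = w$1 *\<^sub>R axis 1 1 + w$2 *\<^sub>R axis 2 1 + w$3 *\<^sub>R axis 3 1"
  by (simp add: vec_eq_iff forall_3 axis_def)

lemma linear_expand:
  assumes "linear (f :: real^3 \<Rightarrow> 'b::real_vector)"
  shows "f w = w$1 *\<^sub>R f (axis 1 1) + w$2 *\<^sub>R f (axis 2 1) + w$3 *\<^sub>R f (axis 3 1)"
  by (subst vec3_expand) (simp only: linear_add[OF assms] linear_cmul[OF assms])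

text \<open>Rotate the third axis to the gradient of \<beta>.\<close>

lemma orthonormal_frame_adapted:
  fixes \<beta> :: "real^3 \<Rightarrow> real"
  assumes \<beta>: "linear \<beta>" and "\<beta> u \<noteq> 0"
  obtains F :: "real^3 \<Rightarrow> real^3" where "orthogonal_transformation F" "\<beta> (F (axis 1 1)) = 0" "\<beta> (F (axis 2 1)) = 0" "\<beta> (F (axis 3 1)) \<noteq> 0"
proof -
  define n :: "real^3" where "n = \<beta> (axis 1 1) *\<^sub>R axis 1 1 + \<beta> (axis 2 1) *\<^sub>R axis 2 1 + \<beta> (axis 3 1) *\<^sub>R axis 3 1"
  have n: "\<beta> w = n \<bullet> w" for w
    by (subst linear_expand[OF \<beta>]) (simp add: n_def inner_add_left inner_axis' mult.commute)
  have "n \<noteq> 0" using n[of u] assms(2) by auto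
  then have norm: "norm (n /\<^sub>R norm n) = 1" by simp
  have "norm (axis 3 1 :: real^3) = 1" by (simp add: norm_axis_1)
  from orthogonal_transformation_exists_1[OF this norm]
  obtain F :: "real^3 \<Rightarrow> real^3" where F: "orthogonal_transformation F" "F (axis 3 1) = n /\<^sub>R norm n" .
  have "\<beta> (F (axis i 1)) = norm n * (axis 3 1 \<bullet> (axis i 1 :: real^3))" for i
  proof -
    have "n = norm n *\<^sub>R F (axis 3 1)" using \<open>n \<noteq> 0\<close> F(2) by simp
    then have "\<beta> (F (axis i 1)) = norm n * (F (axis 3 1) \<bullet> F (axis i 1))"
      by (metis n inner_scaleR_left)
    then show ?thesis using F(1) by (simp add: orthogonal_transformation_def)
  qed
  then show thesis
    using that[OF F(1)] \<open>n \<noteq> 0\<close> by (simp add: inner_axis_axis)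
qed

text \<open>In the rotated frame f i = F (axis i 1) the form at v has coefficients b i v, where b 1 and b 2 vanish at 0 and
b 3 does not.  Solving for the third coordinate gives P = - b 1 / b 3 and Q = - b 2 / b 3.  At 0 only the
derivatives of the numerators count, so that the derivatives of Q in the x-direction and of P in the y-direction
differ by the exterior derivative on f 1 and f 2.  If this were 0 then the wedge product would be 0 on all
triples, as \<beta> x0 vanishes on f 1 and f 2.\<close>

lemma contact_normal_form:
  fixes \<beta> :: "real^3 \<Rightarrow> real^3 \<Rightarrow> real"
  assumes G: "open G" "x0 \<in> G" and lin: "\<And>x. x \<in> G \<Longrightarrow> linear (\<beta> x)"
    and sm: "\<And>u. smooth_on G (\<lambda>x. \<beta> x u)"
    and contact: "wedge (\<beta> x0) (ext_deriv \<beta> x0) u0 v0 w0 \<noteq> 0"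
  obtains F :: "real^3 \<Rightarrow> real^3" and P Q S where "orthogonal_transformation F" "open S" "0 \<in> S" "\<forall>v\<in>S. x0 + F v \<in> G"
    "\<forall>v\<in>S. \<forall>w. \<beta> (x0 + F v) (F w) = 0 \<longleftrightarrow> w$3 = P v * w$1 + Q v * w$2"
    "P 0 = 0" "Q 0 = 0" "smooth_on S P" "smooth_on S Q"
    "frechet_derivative Q (at 0) (axis 1 1) \<noteq> frechet_derivative P (at 0) (axis 2 1)"
proof -
  have "\<exists>u. \<beta> x0 u \<noteq> 0"
  proof (rule ccontr)
    assume "\<nexists>u. \<beta> x0 u \<noteq> 0"
    then show False using contact by (simp add: wedge_def)
  qed
  then obtain u where "\<beta> x0 u \<noteq> 0" by blast
  then obtain F :: "real^3 \<Rightarrow> real^3" where F: "orthogonal_transformation F" and F0: "\<beta> x0 (F (axis 1 1)) = 0" "\<beta> x0 (F (axis 2 1)) = 0" "\<beta> x0 (F (axis 3 1)) \<noteq> 0"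
    using orthonormal_frame_adapted[OF lin[OF G(2)]] by blast
  have linF: "linear F" using F by (rule orthogonal_transformation_linear)
  have blF: "bounded_linear F" using linF by (rule linear_conv_bounded_linear[THEN iffD1])
  define f where "f i = F (axis i 1)" for i :: 3
  define b where "b i v = \<beta> (x0 + F v) (f i)" for i v
  define S0 where "S0 = (\<lambda>v. x0 + F v) -` G"
  have contF: "continuous_on UNIV (\<lambda>v. x0 + F v)"
    by (intro continuous_intros linear_continuous_on blF)
  have S0: "open S0" unfolding S0_def using contF G(1) by (rule open_vimage[rotated])
  have S0x: "x0 + F v \<in> G" if "v \<in> S0" for v using that by (simp add: S0_def)
  have ck: "Ck_on k S0 (b i)" for k i
    unfolding b_def[abs_def]
  proof (rule Ck_on_compose[where X = "\<lambda>v. x0 + F v" and F = "\<lambda>x. \<beta> x (f i)", OF _ _ smooth_onD[OF sm]])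
    show "Ck_on k S0 (\<lambda>v. x0 + F v)"
      by (rule Ck_on_add[OF Ck_on_const Ck_on_bounded_linear[OF blF]])
  qed (auto simp: S0_def)
  define S where "S = S0 \<inter> b 3 -` (- {0})"
  have S: "open S"
    unfolding S_def by (rule continuous_open_preimage[OF Ck_on_continuous[OF ck] S0]) auto
  have F00: "F 0 = 0" using linear_0[OF linF] .
  have b0: "b 1 0 = 0" "b 2 0 = 0" "b 3 0 \<noteq> 0"
    using F0 by (simp_all add: b_def f_def F00)
  have S0S: "S \<subseteq> S0" by (auto simp: S_def)
  have 0: "0 \<in> S0" "0 \<in> S" using G(2) b0 by (auto simp: S_def S0_def F00)
  have nz: "b 3 v \<noteq> 0" if "v \<in> S" for v using that by (simp add: S_def)
  define P where "P v = - b 1 v * (1 / b 3 v)" for v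
  define Q where "Q v = - b 2 v * (1 / b 3 v)" for v
  have ckPQ: "Ck_on k S P" "Ck_on k S Q" for k
    unfolding P_def[abs_def] Q_def[abs_def]
    by (intro Ck_on_mult Ck_on_uminus Ck_on_inverse Ck_on_subset[OF ck S0S] nz; assumption)+
  have expand: "\<beta> (x0 + F v) (F w) = w$1 * b 1 v + w$2 * b 2 v + w$3 * b 3 v" if "v \<in> S0" for v w
  proof -
    have "linear (\<lambda>w. \<beta> (x0 + F v) (F w))"
      using linear_compose[OF linF lin[OF S0x[OF that]]] by (simp add: o_def)
    from linear_expand[OF this, of w] show ?thesis by (simp add: b_def f_def)
  qed
  define d where "d i = frechet_derivative (\<lambda>y. \<beta> y (f i)) (at x0)" for i
  have d: "((\<lambda>y. \<beta> y (f i)) has_derivative d i) (at x0)" for i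
    unfolding d_def by (rule Ck_on_open_derivative(1)[OF smooth_onD[OF sm, where k = "Suc 0"] G])
  have dlin: "d i (F h) = h$1 * d i (f 1) + h$2 * d i (f 2) + h$3 * d i (f 3)" for i h
  proof -
    have "linear (\<lambda>h. d i (F h))"
      using linear_compose[OF linF has_derivative_linear[OF d]] by (simp add: o_def)
    from linear_expand[OF this, of h] show ?thesis by (simp add: f_def)
  qed
  have db: "(b i has_derivative (\<lambda>h. d i (F h))) (at 0)" for i
  proof -
    have 1: "((\<lambda>v. x0 + F v) has_derivative F) (at 0)"
      using has_derivative_add[OF has_derivative_const[of x0] bounded_linear_imp_has_derivative[OF blF]] by simp
    have 2: "((\<lambda>y. \<beta> y (f i)) has_derivative d i) (at ((\<lambda>v. x0 + F v) 0))"
      using d[of i] by (simp add: F00)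
    from diff_chain_at[OF 1 2] show ?thesis
      by (simp add: o_def b_def[abs_def])
  qed
  have d1b3: "\<exists>D. ((\<lambda>v. 1 / b 3 v) has_derivative D) (at 0)"
    using Deriv.has_derivative_inverse[OF b0(3) db] unfolding inverse_eq_divide by blast
  then obtain D where D: "((\<lambda>v. 1 / b 3 v) has_derivative D) (at 0)" by blast
  have dP: "frechet_derivative P (at 0) h = - d 1 (F h) / b 3 0" for h
  proof -
    have "(P has_derivative (\<lambda>h. (- b 1 0) * D h + (- d 1 (F h)) * (1 / b 3 0))) (at 0)"
      unfolding P_def[abs_def] by (rule has_derivative_mult[OF has_derivative_minus[OF db] D])
    from frechet_derivative_at[OF this, symmetric] show ?thesis using b0 by simp
  qed
  have dQ: "frechet_derivative Q (at 0) h = - d 2 (F h) / b 3 0" for h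
  proof -
    have "(Q has_derivative (\<lambda>h. (- b 2 0) * D h + (- d 2 (F h)) * (1 / b 3 0))) (at 0)"
      unfolding Q_def[abs_def] by (rule has_derivative_mult[OF has_derivative_minus[OF db] D])
    from frechet_derivative_at[OF this, symmetric] show ?thesis using b0 by simp
  qed
  \<comment> \<open>\<beta> y is linear only for y in G, so the derivatives are compared on the open set G\<close>
  have dcomb: "frechet_derivative (\<lambda>y. \<beta> y (F v)) (at x0) h = v$1 * d 1 h + v$2 * d 2 h + v$3 * d 3 h" for v h
  proof -
    have "((\<lambda>y. v$1 * \<beta> y (f 1) + v$2 * \<beta> y (f 2) + v$3 * \<beta> y (f 3)) has_derivative
       (\<lambda>h. v$1 * d 1 h + v$2 * d 2 h + v$3 * d 3 h)) (at x0)"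
      by (intro has_derivative_add has_derivative_mult_right d)
    then have "((\<lambda>y. \<beta> y (F v)) has_derivative (\<lambda>h. v$1 * d 1 h + v$2 * d 2 h + v$3 * d 3 h)) (at x0)"
    proof (rule has_derivative_transform_within_open[OF _ G])
      fix y assume "y \<in> G"
      then have "linear (\<lambda>w. \<beta> y (F w))"
        using linear_compose[OF linF lin] by (simp add: o_def)
      from linear_expand[OF this, of v]
      show "v$1 * \<beta> y (f 1) + v$2 * \<beta> y (f 2) + v$3 * \<beta> y (f 3) = \<beta> y (F v)" by (simp add: f_def)
    qed
    from frechet_derivative_at[OF this, symmetric] show ?thesis by simp
  qed
  have twist: "d 2 (f 1) \<noteq> d 1 (f 2)"
  proof
    assume eq: "d 2 (f 1) = d 1 (f 2)"
    have ext: "ext_deriv \<beta> x0 (F u) (F v) = (u$1 * v$3 - u$3 * v$1) * (d 3 (f 1) - d 1 (f 3))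
        + (u$2 * v$3 - u$3 * v$2) * (d 3 (f 2) - d 2 (f 3))" for u v
      unfolding ext_deriv_def dcomb dlin eq by (simp add: algebra_simps)
    have bet: "\<beta> x0 (F u) = u$3 * b 3 0" for u
      using expand[OF 0(1), of u] b0 by (simp add: F00)
    obtain u v w where uvw: "u0 = F u" "v0 = F v" "w0 = F w"
      using orthogonal_transformation_surj[OF F] by (metis surjD)
    have "wedge (\<beta> x0) (ext_deriv \<beta> x0) u0 v0 w0 = 0"
      unfolding wedge_def uvw ext bet by (simp add: algebra_simps)
    then show False using contact by simp
  qed
  show thesis
  proof (rule that[OF F S 0(2)])
    show "\<forall>v\<in>S. x0 + F v \<in> G" using S0x S0S by blast
    show "\<forall>v\<in>S. \<forall>w. \<beta> (x0 + F v) (F w) = 0 \<longleftrightarrow> w$3 = P v * w$1 + Q v * w$2"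
    proof (intro ballI allI)
      fix v w :: "real^3" assume "v \<in> S"
      then have v: "v \<in> S0" "b 3 v \<noteq> 0" using S0S nz by auto
      have "w$3 = P v * w$1 + Q v * w$2 \<longleftrightarrow> w$3 * b 3 v = - b 1 v * w$1 - b 2 v * w$2"
        unfolding P_def Q_def using v(2) by (simp add: field_simps)
      then show "\<beta> (x0 + F v) (F w) = 0 \<longleftrightarrow> w$3 = P v * w$1 + Q v * w$2"
        unfolding expand[OF v(1)] by (simp add: algebra_simps) linarith
    qed
    show "P 0 = 0" "Q 0 = 0" by (simp_all add: P_def Q_def b0)
    show "smooth_on S P" "smooth_on S Q" using ckPQ by (simp_all add: smooth_on_def)
    show "frechet_derivative Q (at 0) (axis 1 1) \<noteq> frechet_derivative P (at 0) (axis 2 1)"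
      unfolding dP dQ using twist b0 by (simp add: f_def)
  qed
qed

lemma C1_bounded_lipschitz_on:
  fixes f :: "real^3 \<Rightarrow> real"
  assumes ck: "Ck_on (Suc 0) S f" and S: "open S" "cball 0 R \<subseteq> S"
  shows "bounded_lipschitz_on (cball 0 R) f"
proof -
  let ?B = "cball (0::real^3) R"
  let ?D = "\<lambda>x. frechet_derivative f (at x)"
  have bdd: "\<exists>C. \<forall>x\<in>?B. \<bar>h x\<bar> \<le> C" if "continuous_on S h" for h :: "real^3 \<Rightarrow> real"
    using compact_imp_bounded[OF compact_continuous_image[OF continuous_on_subset[OF that S(2)] compact_cball]]
    by (auto simp: bounded_iff)
  obtain C0 where C0: "\<forall>x\<in>?B. \<bar>f x\<bar> \<le> C0"
    using bdd[OF Ck_on_continuous[OF ck]] by blast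
  have "\<forall>i. \<exists>C. \<forall>x\<in>?B. \<bar>?D x (axis i 1)\<bar> \<le> C"
    using bdd Ck_on_continuous[OF Ck_on_open_derivative(2)[OF ck S(1)]] by blast
  from choice[OF this] obtain C where C: "\<And>i x. x \<in> ?B \<Longrightarrow> \<bar>?D x (axis i 1)\<bar> \<le> C i" by blast
  have d: "(f has_derivative ?D x) (at x)" if "x \<in> ?B" for x
    using Ck_on_open_derivative(1)[OF ck S(1)] that S(2) by blast
  have on: "onorm (?D x) \<le> C 1 + C 2 + C 3" if x: "x \<in> ?B" for x
  proof (rule onorm_le)
    fix u
    have "?D x u = u$1 * ?D x (axis 1 1) + u$2 * ?D x (axis 2 1) + u$3 * ?D x (axis 3 1)"
      using linear_expand[OF has_derivative_linear[OF d[OF x]], of u] by simp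
    then have "\<bar>?D x u\<bar> \<le> \<bar>u$1 * ?D x (axis 1 1)\<bar> + \<bar>u$2 * ?D x (axis 2 1)\<bar> + \<bar>u$3 * ?D x (axis 3 1)\<bar>"
      by linarith
    also have "\<dots> \<le> norm u * C 1 + norm u * C 2 + norm u * C 3"
      unfolding abs_mult using C[OF x] component_le_norm_cart[of u] by (intro add_mono mult_mono) auto
    finally show "norm (?D x u) \<le> (C 1 + C 2 + C 3) * norm u" by (simp add: algebra_simps)
  qed
  show ?thesis
  proof (rule bounded_lipschitz_onI[where C = C0 and D = "C 1 + C 2 + C 3"])
    show "\<bar>f v\<bar> \<le> C0" if "v \<in> ?B" for v using C0 that by blast
    show "\<bar>f w - f v\<bar> \<le> (C 1 + C 2 + C 3) * norm (w - v)" if "v \<in> ?B" "w \<in> ?B" for v w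
      using differentiable_bound[OF convex_cball[of 0 R] has_derivative_at_withinI[OF d] on, where x = w and y = v] that by simp
  qed
qed

lemma C2_taylor:
  fixes f :: "real^3 \<Rightarrow> real"
  assumes ck: "Ck_on (Suc (Suc 0)) S f" and S: "open S" "cball 0 R \<subseteq> S"
  shows "\<exists>C\<ge>0. \<forall>v\<in>cball 0 R. \<forall>w\<in>cball 0 R. \<bar>f w - f v - frechet_derivative f (at v) (w - v)\<bar> \<le> C * (norm (w - v))\<^sup>2"
proof -
  let ?B = "cball (0::real^3) R"
  let ?D = "\<lambda>x. frechet_derivative f (at x)"
  have "\<forall>i. \<exists>C\<ge>0. \<forall>v\<in>?B. \<bar>?D v (axis i 1)\<bar> \<le> C \<and> (\<forall>w\<in>?B. \<bar>?D w (axis i 1) - ?D v (axis i 1)\<bar> \<le> C * norm (w - v))"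
    using C1_bounded_lipschitz_on[OF Ck_on_open_derivative(2)[OF ck S(1)] S] unfolding bounded_lipschitz_on_def by blast
  from choice[OF this] obtain C where C: "\<And>i. C i \<ge> 0"
    "\<And>i v w. v \<in> ?B \<Longrightarrow> w \<in> ?B \<Longrightarrow> \<bar>?D w (axis i 1) - ?D v (axis i 1)\<bar> \<le> C i * norm (w - v)" by blast
  have d: "(f has_derivative ?D x) (at x)" if "x \<in> ?B" for x
    using Ck_on_open_derivative(1)[OF Ck_on_SucD[OF ck] S(1)] that S(2) by blast
  have "\<bar>f w - f v - ?D v (w - v)\<bar> \<le> (C 1 + C 2 + C 3) * (norm (w - v))\<^sup>2" if vw: "v \<in> ?B" "w \<in> ?B" for v w
  proof -
    let ?L = "closed_segment v w"
    have LB: "?L \<subseteq> ?B" using vw by (simp add: closed_segment_subset)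
    have on: "onorm (?D x - ?D v) \<le> (C 1 + C 2 + C 3) * norm (w - v)" if x: "x \<in> ?L" for x
    proof (rule onorm_le)
      fix u
      have xB: "x \<in> ?B" using x LB by blast
      have xv: "norm (x - v) \<le> norm (w - v)"
        using segment_bound1[OF x] by (simp add: norm_minus_commute)
      have C': "\<bar>?D x (axis i 1) - ?D v (axis i 1)\<bar> \<le> C i * norm (w - v)" for i
        by (rule order_trans[OF C(2)[OF vw(1) xB] mult_left_mono[OF xv C(1)]])
      have "(?D x - ?D v) u = u$1 * (?D x (axis 1 1) - ?D v (axis 1 1)) + u$2 * (?D x (axis 2 1) - ?D v (axis 2 1)) + u$3 * (?D x (axis 3 1) - ?D v (axis 3 1))"
        using linear_expand[OF has_derivative_linear[OF d[OF xB]], of u] linear_expand[OF has_derivative_linear[OF d[OF vw(1)]], of u]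
        by (simp add: algebra_simps)
      then have "\<bar>(?D x - ?D v) u\<bar> \<le> \<bar>u$1 * (?D x (axis 1 1) - ?D v (axis 1 1))\<bar> + \<bar>u$2 * (?D x (axis 2 1) - ?D v (axis 2 1))\<bar> + \<bar>u$3 * (?D x (axis 3 1) - ?D v (axis 3 1))\<bar>"
        by linarith
      also have "\<dots> \<le> norm u * (C 1 * norm (w - v)) + norm u * (C 2 * norm (w - v)) + norm u * (C 3 * norm (w - v))"
        unfolding abs_mult by (intro add_mono mult_mono C' component_le_norm_cart) auto
      finally show "norm ((?D x - ?D v) u) \<le> (C 1 + C 2 + C 3) * norm (w - v) * norm u" by (simp add: algebra_simps)
    qed
    have "norm (f w - f v - ?D v (w - v)) \<le> norm (w - v) * ((C 1 + C 2 + C 3) * norm (w - v))"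
    proof (rule differentiable_bound_linearization[where S = ?L])
      show "v + t *\<^sub>R (w - v) \<in> ?L" if "t \<in> {0..1}" for t
        using that by (auto simp: in_segment algebra_simps intro!: exI[of _ t])
      show "(f has_derivative ?D x) (at x within ?L)" if "x \<in> ?L" for x
        using d LB that has_derivative_at_withinI by blast
    qed (use on in auto)
    then show ?thesis by (simp add: power2_eq_square algebra_simps)
  qed
  then show ?thesis using C(1) by (intro exI[of _ "C 1 + C 2 + C 3"]) auto
qed

text \<open>The derivative along X = d/dx + P d/dz.\<close>

definition deriv_X :: "(real^3 \<Rightarrow> real) \<Rightarrow> (real^3 \<Rightarrow> real) \<Rightarrow> real^3 \<Rightarrow> real" where
  "deriv_X P f v = frechet_derivative f (at v) (axis 1 1) + P v * frechet_derivative f (at v) (axis 3 1)"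

text \<open>The derivative along Y = d/dy + Q d/dz.\<close>

definition deriv_Y :: "(real^3 \<Rightarrow> real) \<Rightarrow> (real^3 \<Rightarrow> real) \<Rightarrow> real^3 \<Rightarrow> real" where
  "deriv_Y Q f v = frechet_derivative f (at v) (axis 2 1) + Q v * frechet_derivative f (at v) (axis 3 1)"

text \<open>In the Taylor polynomial, dz = P dx + Q dy up to \<epsilon>^2, which adds P and Q times the z-derivative to the
derivatives in x and y.\<close>

lemma C2_horizontal_jet:
  fixes f P Q :: "real^3 \<Rightarrow> real"
  assumes ck: "Ck_on (Suc (Suc 0)) S f" "Ck_on (Suc (Suc 0)) S P" "Ck_on (Suc (Suc 0)) S Q"
    and S: "open S" "cball 0 R \<subseteq> S"
  shows "horizontal_jet P Q (cball 0 R) f (deriv_X P f) (deriv_Y Q f)"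
proof -
  let ?B = "cball (0::real^3) R" and ?D = "\<lambda>v i. frechet_derivative f (at v) (axis i 1)"
  have blD: "bounded_lipschitz_on ?B (\<lambda>v. ?D v i)" for i
    by (rule C1_bounded_lipschitz_on[OF Ck_on_open_derivative(2)[OF ck(1) S(1)] S])
  have bl: "bounded_lipschitz_on ?B f" "bounded_lipschitz_on ?B P" "bounded_lipschitz_on ?B Q"
    using C1_bounded_lipschitz_on[OF Ck_on_SucD S] ck by blast+
  obtain C where C: "C \<ge> 0" "\<And>v w. v \<in> ?B \<Longrightarrow> w \<in> ?B \<Longrightarrow> \<bar>f w - f v - frechet_derivative f (at v) (w - v)\<bar> \<le> C * (norm (w - v))\<^sup>2"
    using C2_taylor[OF ck(1) S] by blast
  obtain M where M: "M \<ge> 0" "\<And>v. v \<in> ?B \<Longrightarrow> \<bar>?D v 3\<bar> \<le> M"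
    using blD[of 3] by (rule bounded_lipschitz_onE) blast
  show ?thesis
    unfolding deriv_X_def[abs_def] deriv_Y_def[abs_def]
  proof (rule horizontal_jetI[where C = "C + M"])
    fix v w \<epsilon> assume *: "v \<in> ?B" "w \<in> ?B" "0 < (\<epsilon>::real)" "\<epsilon> \<le> 1" "horizontally_close P Q \<epsilon> v w"
    let ?z = "w$3 - v$3 - P v * (w$1 - v$1) - Q v * (w$2 - v$2)"
    have hz: "norm (w - v) \<le> \<epsilon>" "\<bar>?z\<bar> \<le> \<epsilon>\<^sup>2" using *(5) by (auto simp: horizontally_close_def)
    have lin: "linear (frechet_derivative f (at v))"
      using Ck_on_open_derivative(1)[OF Ck_on_SucD[OF ck(1)] S(1)] has_derivative_linear *(1) S(2) by blast
    have "frechet_derivative f (at v) (w - v) = (w$1 - v$1) * ?D v 1 + (w$2 - v$2) * ?D v 2 + (w$3 - v$3) * ?D v 3"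
      using linear_expand[OF lin, of "w - v"] by simp
    then have eq: "f w - f v - (?D v 1 + P v * ?D v 3) * (w$1 - v$1) - (?D v 2 + Q v * ?D v 3) * (w$2 - v$2)
       = (f w - f v - frechet_derivative f (at v) (w - v)) + ?D v 3 * ?z"
      by (simp add: algebra_simps)
    have 1: "\<bar>f w - f v - frechet_derivative f (at v) (w - v)\<bar> \<le> C * \<epsilon>\<^sup>2"
      by (rule order_trans[OF C(2)[OF *(1,2)] mult_left_mono[OF power_mono[OF hz(1)] C(1)]]) simp
    have 2: "\<bar>?D v 3 * ?z\<bar> \<le> M * \<epsilon>\<^sup>2"
      unfolding abs_mult by (rule mult_mono[OF M(2)[OF *(1)] hz(2) M(1)]) simp
    show "\<bar>f w - f v - (?D v 1 + P v * ?D v 3) * (w$1 - v$1) - (?D v 2 + Q v * ?D v 3) * (w$2 - v$2)\<bar> \<le> (C + M) * \<epsilon>\<^sup>2"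
      unfolding eq using order_trans[OF abs_triangle_ineq add_mono[OF 1 2]] by (simp only: distrib_right)
  qed (use C(1) M(1) in \<open>auto intro!: bounded_lipschitz_on_add bounded_lipschitz_on_mult bl blD\<close>)
qed

section \<open>Contact coordinates on the manifold\<close>

text \<open>Coordinates on the neighbourhood N of p: the chart c, moved by a rigid motion to take p to 0 and \<xi> at p
to the plane of the first two coordinates.  The set S is the image of N, and \<xi> is given by dz = P dx + Q dy.\<close>

locale contact_coordinates =
  fixes A :: "'a::{t2_space,second_countable_topology} chart set"
    and \<xi> :: "'a \<Rightarrow> 'a tvector set"
    and g :: "'a \<Rightarrow> 'a tvector \<Rightarrow> 'a tvector \<Rightarrow> real"
    and c :: "'a chart" and N :: "'a set" and p :: 'a and F :: "real^3 \<Rightarrow> real^3" and K :: real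
    and S :: "(real^3) set" and P Q :: "real^3 \<Rightarrow> real"
  assumes atlas: "smooth_atlas A" and distribution: "smooth_rank2_distribution A \<xi>"
    and metric: "sub_riemannian_metric A \<xi> g"
    and chart: "c \<in> A" and N: "open N" "N \<subseteq> fst c" "p \<in> N"
    and F: "orthogonal_transformation F" and K: "K > 0"
    and comparable: "\<forall>q\<in>N. \<forall>v\<in>\<xi> q. norm (v c) \<le> K * sqrt (g q v v) \<and> sqrt (g q v v) \<le> K * norm (v c)"
    and S: "open S" "0 \<in> S" "snd c ` N = (\<lambda>v. snd c p + F v) ` S"
    and horizontal: "\<And>q v. q \<in> N \<Longrightarrow> v \<in> \<xi> q \<longleftrightarrow> v \<in> tangent_space A q \<and>
          inv_into UNIV F (v c) $ 3 = P (inv_into UNIV F (snd c q - snd c p)) * inv_into UNIV F (v c) $ 1 + Q (inv_into UNIV F (snd c q - snd c p)) * inv_into UNIV F (v c) $ 2"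
    and PQ: "P 0 = 0" "Q 0 = 0" "smooth_on S P" "smooth_on S Q"
    and twist: "frechet_derivative Q (at 0) (axis 1 1) \<noteq> frechet_derivative P (at 0) (axis 2 1)"
begin

definition coord :: "'a \<Rightarrow> real^3" where "coord q = inv_into UNIV F (snd c q - snd c p)"

definition point :: "real^3 \<Rightarrow> 'a" where "point v = chart_inv c (snd c p + F v)"

lemma F_inverse: "inv_into UNIV F (F v) = v" "F (inv_into UNIV F v) = v" "norm (F v) = norm v" "norm (inv_into UNIV F v) = norm v"
  "bounded_linear F" "bounded_linear (inv_into UNIV F)" "inv_into UNIV F 0 = 0" "F 0 = 0"
proof -
  show 1: "inv_into UNIV F (F v) = v" for v using orthogonal_transformation_inj[OF F] by (rule inv_f_f)
  show 2: "F (inv_into UNIV F v) = v" for v using orthogonal_transformation_surj[OF F] by (rule surj_f_inv_f)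
  show 3: "norm (F v) = norm v" for v using orthogonal_transformation_norm[OF F] .
  show "norm (inv_into UNIV F v) = norm v" using 3[of "inv_into UNIV F v"] 2 by simp
  show "bounded_linear F" using orthogonal_transformation_linear[OF F] by (simp add: linear_conv_bounded_linear)
  show "bounded_linear (inv_into UNIV F)"
    using orthogonal_transformation_linear[OF orthogonal_transformation_inv[OF F]] by (simp add: linear_conv_bounded_linear)
  show "F 0 = 0" using 3[of 0] by simp
  then show "inv_into UNIV F 0 = 0" using 1[of 0] by simp
qed

lemma chart_coord: "snd c q = snd c p + F (coord q)"
  by (simp add: coord_def F_inverse)

lemma point_coord: "q \<in> N \<Longrightarrow> point (coord q) = q"
  using N(2) chart_inv_chart[OF atlas chart] by (auto simp: point_def chart_coord[symmetric])

lemma point_in_N: assumes "v \<in> S" shows "point v \<in> N" "coord (point v) = v"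
proof -
  have "snd c p + F v \<in> snd c ` N" unfolding S(3) using assms by blast
  then obtain q where "snd c p + F v = snd c q" "q \<in> N" by (rule imageE)
  then have q: "q \<in> N" "snd c q = snd c p + F v" by simp_all
  have "point v = q" unfolding point_def q(2)[symmetric] using chart_inv_chart[OF atlas chart] q(1) N(2) by blast
  then show "point v \<in> N" "coord (point v) = v" using q by (auto simp: coord_def F_inverse)
qed

lemma point_0: "point 0 = p"
proof -
  have "coord p = 0" by (simp add: coord_def F_inverse)
  then show ?thesis using point_coord[OF N(3)] by simp
qed

lemma continuous_coord: "continuous_on N coord"
  unfolding coord_def[abs_def]
  by (intro bounded_linear.continuous_on[OF F_inverse(6)] continuous_on_diff continuous_on_const
      continuous_on_subset[OF chart_continuous[OF atlas chart] N(2)])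

lemma point_chart: assumes "v \<in> S" shows "snd c p + F v \<in> snd c ` fst c"
proof -
  have "snd c p + F v \<in> snd c ` N" unfolding S(3) using assms by blast
  then show ?thesis using N(2) by blast
qed

lemma continuous_point: "continuous_on S point"
  unfolding point_def[abs_def]
proof (rule continuous_on_compose2[OF homeomorphism_cont2[OF atlasD(3)[OF atlas chart]]])
  show "continuous_on S (\<lambda>v. snd c p + F v)"
    by (intro continuous_intros linear_continuous_on F_inverse)
qed (use point_chart in blast)

text \<open>It is compact, as a continuous image of a closed ball of the coordinate space, and hence closed in all of M.\<close>

lemma closed_coord_ball:
  assumes "cball 0 s \<subseteq> S" shows "closed {q\<in>N. norm (coord q) \<le> s}"
proof -
  have "{q\<in>N. norm (coord q) \<le> s} = point ` cball 0 s"
  proof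
    show "{q\<in>N. norm (coord q) \<le> s} \<subseteq> point ` cball 0 s"
      using point_coord by (force simp: image_iff)
    show "point ` cball 0 s \<subseteq> {q\<in>N. norm (coord q) \<le> s}"
    proof
      fix q assume "q \<in> point ` cball 0 s"
      then obtain v where v: "v \<in> cball 0 s" "q = point v" by blast
      then show "q \<in> {q\<in>N. norm (coord q) \<le> s}" using point_in_N[of v] assms by auto
    qed
  qed
  then show ?thesis
    using compact_imp_closed[OF compact_continuous_image[OF continuous_on_subset[OF continuous_point assms] compact_cball]] by simp
qed

text \<open>Apply the estimate for horizontal curves to a curve from q to q' of length less than \<epsilon>.\<close>

lemma cc_dist_horizontally_close:
  assumes R: "cball 0 R \<subseteq> S"
    and P: "C-lipschitz_on (cball 0 R) P" and Q: "C-lipschitz_on (cball 0 R) Q"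
    and q: "q \<in> N" and eps: "norm (coord q) + K * \<epsilon> \<le> R" "\<epsilon> > 0" and d: "cc_dist A \<xi> g q q' < ennreal \<epsilon>"
  shows "q' \<in> N" "norm (coord q' - coord q) \<le> K * \<epsilon>"
    "horizontally_close P Q (K * (1 + 2 * C) * \<epsilon>) (coord q) (coord q')"
proof -
  have "C \<ge> 0" by (rule lipschitz_on_nonneg[OF P])
  obtain \<gamma> where \<gamma>: "horizontal_curve A \<xi> \<gamma>" "\<gamma> 0 = q" "\<gamma> 1 = q'" "ennreal (curve_length A g \<gamma>) < ennreal \<epsilon>"
    using d unfolding cc_dist_def INF_less_iff by blast
  have len: "curve_length A g \<gamma> < \<epsilon>"
    using \<gamma>(4) ennreal_leI[of \<epsilon> "curve_length A g \<gamma>"] by (meson not_le)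
  obtain E \<sigma> where E: "finite E" "continuous_on {0..1} \<gamma>" and \<sigma>: "\<sigma> integrable_on {0..1}"
    "integral {0..1} \<sigma> = curve_length A g \<gamma>" "\<And>t. t \<in> {0..1} \<Longrightarrow> 0 \<le> \<sigma> t"
    and v: "\<And>t. t \<in> {0<..<1} - E \<Longrightarrow> \<exists>v\<in>\<xi> (\<gamma> t). \<sigma> t = sqrt (g (\<gamma> t) v v) \<and>
        (\<forall>c\<in>charts_at A (\<gamma> t). (snd c \<circ> \<gamma> has_vector_derivative v c) (at t))"
    using horizontal_curve_regular[OF atlas distribution metric \<gamma>(1)] by blast
  have deriv: "\<exists>w. (coord \<circ> \<gamma> has_vector_derivative w) (at t) \<and> norm w \<le> K * \<sigma> t \<and>
      w$3 = P (coord (\<gamma> t)) * w$1 + Q (coord (\<gamma> t)) * w$2"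
    if t: "t \<in> {0<..<1} - E" and tN: "\<gamma> t \<in> N" for t
  proof -
    obtain v where v: "v \<in> \<xi> (\<gamma> t)" "\<sigma> t = sqrt (g (\<gamma> t) v v)"
      "\<forall>c\<in>charts_at A (\<gamma> t). (snd c \<circ> \<gamma> has_vector_derivative v c) (at t)"
      using v[OF t] by blast
    have "c \<in> charts_at A (\<gamma> t)" using chart N(2) tN by (auto simp: charts_at_def)
    then have "(snd c \<circ> \<gamma> has_vector_derivative v c) (at t)" using v(3) by blast
    then have "((\<lambda>s. (snd c \<circ> \<gamma>) s - snd c p) has_vector_derivative v c) (at t)"
      using has_vector_derivative_diff[OF _ has_vector_derivative_const, of "snd c \<circ> \<gamma>" "v c" "at t" "snd c p"] by simp
    from bounded_linear.has_vector_derivative[OF F_inverse(6) this]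
    have "(coord \<circ> \<gamma> has_vector_derivative inv_into UNIV F (v c)) (at t)"
      by (simp add: coord_def[abs_def] o_def)
    moreover have "norm (inv_into UNIV F (v c)) \<le> K * \<sigma> t"
      unfolding F_inverse(4) v(2) using comparable tN v(1) by blast
    moreover have "inv_into UNIV F (v c) $ 3 = P (coord (\<gamma> t)) * inv_into UNIV F (v c) $ 1 + Q (coord (\<gamma> t)) * inv_into UNIV F (v c) $ 2"
      using v(1) unfolding horizontal[OF tN] coord_def by blast
    ultimately show ?thesis by blast
  qed
  have Kl: "K * integral {0..1} \<sigma> \<le> K * \<epsilon>" "0 \<le> K * integral {0..1} \<sigma>"
    using len K integral_nonneg[OF \<sigma>(1,3)] unfolding \<sigma>(2) by auto
  have start: "\<gamma> 0 \<in> N" "norm (coord (\<gamma> 0)) + K * integral {0..1} \<sigma> \<le> R"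
    using q \<gamma>(2) eps(1) Kl(1) by auto
  note est = horizontal_curve_estimate[where \<psi> = coord and s = R and K = K,
      OF E(2,1) \<sigma>(1,3) less_imp_le[OF K] deriv N(1) continuous_coord closed_coord_ball[OF R] start P Q, unfolded \<gamma>(2,3)]
  show "q' \<in> N" by (rule est(1))
  show n: "norm (coord q' - coord q) \<le> K * \<epsilon>" using est(2) Kl(1) by linarith
  have "K * \<epsilon> \<ge> 0" using K eps(2) by simp
  have 1: "K * \<epsilon> \<le> K * (1 + 2 * C) * \<epsilon>"
    using mult_left_mono[of 1 "1 + 2 * C" "K * \<epsilon>"] \<open>C \<ge> 0\<close> \<open>K * \<epsilon> \<ge> 0\<close> by (simp add: algebra_simps)
  have "2 * C * (K * integral {0..1} \<sigma>)\<^sup>2 \<le> 2 * C * (K * \<epsilon>)\<^sup>2"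
    using \<open>C \<ge> 0\<close> by (intro mult_left_mono[OF power_mono[OF Kl]]) simp
  also have "\<dots> \<le> (1 + 2 * C)\<^sup>2 * (K * \<epsilon>)\<^sup>2"
  proof (rule mult_right_mono)
    show "2 * C \<le> (1 + 2 * C)\<^sup>2"
      using \<open>C \<ge> 0\<close> by (simp add: power2_eq_square algebra_simps)
  qed simp
  also have "\<dots> = (K * (1 + 2 * C) * \<epsilon>)\<^sup>2"
    by (simp add: power_mult_distrib)
  finally show "horizontally_close P Q (K * (1 + 2 * C) * \<epsilon>) (coord q) (coord q')"
    unfolding horizontally_close_def using order_trans[OF n 1] order_trans[OF est(3)] by blast
qed

lemma horizontal_coordinate_curve_lipschitz:
  assumes Z: "smooth_on {-1..1} Z" "\<And>t. t \<in> {-1..1} \<Longrightarrow> (Z has_vector_derivative Z' t) (at t within {-1..1})"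
    and inS: "\<And>t. t \<in> {-1..1} \<Longrightarrow> Z t \<in> S"
    and hor: "\<And>t. t \<in> {-1..1} \<Longrightarrow> Z' t $ 3 = P (Z t) * Z' t $ 1 + Q (Z t) * Z' t $ 2"
    and bd: "\<And>t. t \<in> {-1..1} \<Longrightarrow> norm (Z' t) \<le> D"
    and st: "s \<in> {-1..1}" "t \<in> {-1..1}"
  shows "cc_dist A \<xi> g (point (Z s)) (point (Z t)) \<le> ennreal (K * D * \<bar>s - t\<bar>)"
  unfolding point_def
proof (rule horizontal_chart_curve_lipschitz[OF atlas chart, where N = N and \<zeta>' = "\<lambda>t. F (Z' t)"])
  show "smooth_on {-1..1} (\<lambda>t. snd c p + F (Z t))"
    unfolding smooth_on_def
    by (intro allI Ck_on_add Ck_on_const Ck_on_bounded_linear_compose[OF F_inverse(5)] smooth_onD[OF Z(1)])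
  fix t :: real assume t: "t \<in> {-1..1}"
  show "((\<lambda>t. snd c p + F (Z t)) has_vector_derivative F (Z' t)) (at t within {-1..1})"
    using has_vector_derivative_add[OF has_vector_derivative_const bounded_linear.has_vector_derivative[OF F_inverse(5) Z(2)[OF t]]]
    by simp
  show "snd c p + F (Z t) \<in> snd c ` fst c" by (rule point_chart[OF inS[OF t]])
  show ptN: "chart_inv c (snd c p + F (Z t)) \<in> N" using point_in_N[OF inS[OF t]] by (simp add: point_def)
  show "norm (F (Z' t)) \<le> D" using bd[OF t] by (simp add: F_inverse)
  fix s v assume v: "v \<in> tangent_space A (chart_inv c (snd c p + F (Z t)))" "v c = s *\<^sub>R F (Z' t)"
  have "inv_into UNIV F (v c) = s *\<^sub>R Z' t"
    unfolding v(2) using linear_cmul[OF bounded_linear.linear[OF F_inverse(6)]] by (simp add: F_inverse)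
  moreover have "inv_into UNIV F (snd c (chart_inv c (snd c p + F (Z t))) - snd c p) = Z t"
    using point_in_N(2)[OF inS[OF t]] by (simp add: coord_def point_def)
  ultimately show "v \<in> \<xi> (chart_inv c (snd c p + F (Z t)))"
    unfolding horizontal[OF ptN] using v(1) hor[OF t] by (simp add: algebra_simps)
qed (use K comparable st in auto)

end

text \<open>N is cut down to lie in U, in the domain of a contact form \<alpha>, and where the metric is comparable to the Euclidean
norm.  A vector at q is horizontal exactly when its coordinates are annihilated by the coordinate expression of
\<alpha>, to which the normal form applies.\<close>

lemma contact_coordinates_exist:
  fixes A :: "'a::{t2_space,second_countable_topology} chart set"
  assumes A: "smooth_atlas A" and con: "contact_structure A \<xi>" and met: "sub_riemannian_metric A \<xi> g"
    and U: "open U" "p \<in> U"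
  obtains c N F K S P Q where "contact_coordinates A \<xi> g c N p F K S P Q" "N \<subseteq> U"
proof -
  have dist: "smooth_rank2_distribution A \<xi>" using con by (simp add: contact_structure_def)
  obtain W \<alpha> where W: "open W" "p \<in> W" and \<alpha>: "contact_form A W \<alpha>"
    and ker: "\<forall>q\<in>W. \<xi> q = {v\<in>tangent_space A q. \<alpha> q v = 0}"
    using con unfolding contact_structure_def by meson
  obtain c where c: "c \<in> charts_at A p" by (rule exists_chart_at[OF A])
  then have cA: "c \<in> A" "p \<in> fst c" by (auto simp: charts_at_def)
  obtain N0 K where N0: "open N0" "p \<in> N0" "N0 \<subseteq> fst c" and K: "K > 0"
    "\<forall>q\<in>N0. \<forall>v\<in>\<xi> q. norm (v c) \<le> K * sqrt (g q v v) \<and> sqrt (g q v v) \<le> K * norm (v c)"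
    using metric_comparable_to_chart_norm[OF A dist met c] .
  define M where "M = fst c \<inter> (W \<inter> U \<inter> N0)"
  have M: "open M" "p \<in> M" "M \<subseteq> fst c" "M \<subseteq> W" "M \<subseteq> U" "M \<subseteq> N0"
    using W U N0 cA atlasD(1)[OF A cA(1)] by (auto simp: M_def)
  define G where "G = snd c ` M"
  have G: "open G" unfolding G_def M_def by (rule chart_image_open[OF A cA(1)]) (use W U N0 in auto)
  have GW: "G \<subseteq> snd c ` (fst c \<inter> W)" by (auto simp: G_def M_def)
  have xG: "snd c p \<in> G" using M(2) by (simp add: G_def)
  let ?\<beta> = "form_coord A c \<alpha>"
  have one: "smooth_one_form A W \<alpha>" using \<alpha> by (simp add: contact_form_def)
  have lin: "linear (?\<beta> x)" if "x \<in> G" for x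
    using one cA(1) GW that unfolding smooth_one_form_def by blast
  have sm: "smooth_on G (\<lambda>x. ?\<beta> x u)" for u
  proof -
    have "smooth_on (snd c ` (fst c \<inter> W)) (\<lambda>x. ?\<beta> x u)"
      using one cA(1) unfolding smooth_one_form_def by blast
    then show ?thesis using Ck_on_subset[OF _ GW] unfolding smooth_on_def by blast
  qed
  have "\<exists>u v w. wedge (?\<beta> (snd c p)) (ext_deriv ?\<beta> (snd c p)) u v w \<noteq> 0"
    using \<alpha> cA(1) GW xG unfolding contact_form_def by blast
  then obtain u0 v0 w0 where wedge: "wedge (?\<beta> (snd c p)) (ext_deriv ?\<beta> (snd c p)) u0 v0 w0 \<noteq> 0" by blast
  obtain F :: "real^3 \<Rightarrow> real^3" and P Q S where F: "orthogonal_transformation F" and S: "open S" "0 \<in> S" "\<forall>v\<in>S. snd c p + F v \<in> G"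
    and kerPQ: "\<forall>v\<in>S. \<forall>w. ?\<beta> (snd c p + F v) (F w) = 0 \<longleftrightarrow> w$3 = P v * w$1 + Q v * w$2"
    and PQ: "P 0 = 0" "Q 0 = 0" "smooth_on S P" "smooth_on S Q"
    "frechet_derivative Q (at 0) (axis 1 1) \<noteq> frechet_derivative P (at 0) (axis 2 1)"
    using contact_normal_form[OF G xG lin sm wedge] .
  have invF: "inv_into UNIV F (F v) = v" "F (inv_into UNIV F v) = v" for v
    using orthogonal_transformation_inj[OF F] orthogonal_transformation_surj[OF F] by (auto simp: inv_f_f surj_f_inv_f)
  have F0: "F 0 = 0" using linear_0[OF orthogonal_transformation_linear[OF F]] .
  have continv: "continuous_on UNIV (\<lambda>x. inv_into UNIV F (x - snd c p))"
  proof -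
    have bl: "bounded_linear (inv_into UNIV F)"
      using orthogonal_transformation_linear[OF orthogonal_transformation_inv[OF F]] by (simp add: linear_conv_bounded_linear)
    show ?thesis
      by (rule continuous_on_compose2[OF linear_continuous_on[OF bl, of UNIV]]) (auto intro: continuous_intros)
  qed
  define N where "N = M \<inter> snd c -` ((\<lambda>x. inv_into UNIV F (x - snd c p)) -` S)"
  have "open N"
    unfolding N_def
    by (rule continuous_open_preimage[OF continuous_on_subset[OF chart_continuous[OF A cA(1)] M(3)] M(1)])
      (rule open_vimage[OF S(1) continv])
  moreover have "p \<in> N"
    using M(2) S(2) invF(1)[of 0] by (simp add: N_def F0)
  moreover have "snd c ` N = (\<lambda>v. snd c p + F v) ` S"
  proof
    show "snd c ` N \<subseteq> (\<lambda>v. snd c p + F v) ` S"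
    proof
      fix x assume "x \<in> snd c ` N"
      then have "inv_into UNIV F (x - snd c p) \<in> S" "x = snd c p + F (inv_into UNIV F (x - snd c p))" by (auto simp: N_def invF)
      then show "x \<in> (\<lambda>v. snd c p + F v) ` S" by blast
    qed
    show "(\<lambda>v. snd c p + F v) ` S \<subseteq> snd c ` N"
    proof
      fix x assume "x \<in> (\<lambda>v. snd c p + F v) ` S"
      then obtain v where v: "v \<in> S" "x = snd c p + F v" by blast
      then obtain q where q: "q \<in> M" "x = snd c q" using S(3) unfolding G_def by blast
      have "snd c q - snd c p = F v" using q(2) v(2) add_diff_cancel_left'[of "snd c p" "F v"] by metis
      then have "inv_into UNIV F (snd c q - snd c p) = v" by (simp only: invF)
      then show "x \<in> snd c ` N" using q v(1) by (auto simp: N_def)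
    qed
  qed
  moreover have "v \<in> \<xi> q \<longleftrightarrow> v \<in> tangent_space A q \<and>
          inv_into UNIV F (v c) $ 3 = P (inv_into UNIV F (snd c q - snd c p)) * inv_into UNIV F (v c) $ 1 + Q (inv_into UNIV F (snd c q - snd c p)) * inv_into UNIV F (v c) $ 2"
    if q: "q \<in> N" for q v
  proof -
    have qM: "q \<in> M" and qS: "inv_into UNIV F (snd c q - snd c p) \<in> S" using q by (auto simp: N_def)
    have cq: "c \<in> charts_at A q" using cA qM M(3) by (auto simp: charts_at_def)
    have x: "snd c p + F (inv_into UNIV F (snd c q - snd c p)) = snd c q" by (simp add: invF)
    have "\<alpha> q v = ?\<beta> (snd c q) (v c)" if "v \<in> tangent_space A q"
      unfolding form_coord_def using chart_inv_chart[OF A cA(1)] qM M(3) tangent_vector_determined[OF A cq that] by auto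
    then have "v \<in> \<xi> q \<longleftrightarrow> v \<in> tangent_space A q \<and> ?\<beta> (snd c q) (F (inv_into UNIV F (v c))) = 0"
      using bspec[OF ker, of q] qM M(4) by (auto simp: invF)
    also have "?\<beta> (snd c q) (F (inv_into UNIV F (v c))) = 0 \<longleftrightarrow>
        inv_into UNIV F (v c) $ 3 = P (inv_into UNIV F (snd c q - snd c p)) * inv_into UNIV F (v c) $ 1 + Q (inv_into UNIV F (snd c q - snd c p)) * inv_into UNIV F (v c) $ 2"
      using bspec[OF kerPQ qS] unfolding x by blast
    finally show ?thesis .
  qed
  moreover have "N \<subseteq> M" by (auto simp: N_def)
  ultimately have "contact_coordinates A \<xi> g c N p F K S P Q"
    using A dist met cA(1) F K S PQ M(3,6) by unfold_locales auto
  then show thesis using that \<open>N \<subseteq> M\<close> M(5) by blast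
qed

section \<open>The essential loop\<close>

context contact_coordinates
begin

text \<open>At the origin, where P and Q vanish, XQ - YP is the difference dQ/dx - dP/dy, which is not 0; the bound k
follows by continuity.\<close>

lemma good_ball:
  obtains R k where "R > 0" "k > 0" "cball 0 R \<subseteq> S"
    "\<And>v. v \<in> cball 0 R \<Longrightarrow> k \<le> \<bar>deriv_X P Q v - deriv_Y Q P v\<bar>"
proof -
  let ?D = "\<lambda>v. deriv_X P Q v - deriv_Y Q P v"
  have d: "continuous_on S (\<lambda>v. frechet_derivative P (at v) u)" "continuous_on S (\<lambda>v. frechet_derivative Q (at v) u)" for u
    using Ck_on_open_derivative(2)[OF smooth_onD[OF PQ(3), of "Suc 0"] S(1)]
      Ck_on_open_derivative(2)[OF smooth_onD[OF PQ(4), of "Suc 0"] S(1)] by simp_all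
  have "continuous_on S (\<lambda>v. \<bar>?D v\<bar>)"
    unfolding deriv_X_def deriv_Y_def
    by (intro continuous_on_rabs continuous_on_diff continuous_on_add continuous_on_mult d smooth_on_imp_continuous PQ)
  then have op: "open (S \<inter> (\<lambda>v. \<bar>?D v\<bar>) -` {\<bar>?D 0\<bar> / 2<..})"
    by (rule continuous_open_preimage[OF _ S(1)]) simp
  have D0: "?D 0 \<noteq> 0" using twist PQ(1,2) by (simp add: deriv_X_def deriv_Y_def)
  then have "0 \<in> S \<inter> (\<lambda>v. \<bar>?D v\<bar>) -` {\<bar>?D 0\<bar> / 2<..}" using S(2) by simp
  then obtain R where R: "R > 0" "cball 0 R \<subseteq> S \<inter> (\<lambda>v. \<bar>?D v\<bar>) -` {\<bar>?D 0\<bar> / 2<..}"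
    using op open_contains_cball by blast
  show thesis
  proof (rule that[OF R(1), of "\<bar>?D 0\<bar> / 2"])
    show "cball 0 R \<subseteq> S" using R(2) by blast
    show "\<bar>?D 0\<bar> / 2 \<le> \<bar>?D v\<bar>" if "v \<in> cball 0 R" for v
    proof -
      have "v \<in> (\<lambda>v. \<bar>?D v\<bar>) -` {\<bar>?D 0\<bar> / 2<..}" using R(2) that by blast
      then show ?thesis by (simp only: vimage_eq greaterThan_iff less_imp_le)
    qed
  qed (use D0 in simp)
qed

text \<open>The Rumin form transplanted to the manifold.  The value 0 outside N is consistent because h and f vanish near the
boundary of the coordinate ball.\<close>

definition edge :: "(real^3 \<Rightarrow> real) \<Rightarrow> (real^3 \<Rightarrow> real) \<Rightarrow> 'a \<Rightarrow> 'a \<Rightarrow> real" where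
  "edge h f q q' = (if q \<in> N \<and> q' \<in> N then rumin_edge P Q h f (coord q) (coord q') else 0)"

lemma edge_swap: "edge h f q' q = - edge h f q q'"
  by (simp add: edge_def rumin_edge_swap[of P Q h f "coord q'"])

text \<open>If a vertex lies in the support of h and f, then the whole triangle lies in the coordinate ball and its
vertices are horizontally close; otherwise every edge is 0.\<close>

lemma edge_triangle:
  assumes R: "R > 0" "cball 0 R \<subseteq> S"
    and P: "C-lipschitz_on (cball 0 R) P" and Q: "C-lipschitz_on (cball 0 R) Q"
    and tri: "\<And>\<epsilon> a b c. 0 < \<epsilon> \<Longrightarrow> \<epsilon> \<le> 1 \<Longrightarrow> a \<in> cball 0 R \<Longrightarrow> b \<in> cball 0 R \<Longrightarrow> c \<in> cball 0 R \<Longrightarrow>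
           horizontally_close P Q \<epsilon> a b \<Longrightarrow> horizontally_close P Q \<epsilon> a c \<Longrightarrow> horizontally_close P Q \<epsilon> b c \<Longrightarrow>
           \<bar>rumin_edge P Q h f a b + rumin_edge P Q h f b c + rumin_edge P Q h f c a\<bar> \<le> T * \<epsilon>^3"
    and van: "\<And>v. norm v \<ge> R / 4 \<Longrightarrow> h v = 0 \<and> f v = 0" and "T \<ge> 0"
    and eps: "0 < \<epsilon>" "K * \<epsilon> \<le> R / 4" "K * (1 + 2 * C) * \<epsilon> \<le> 1"
    and close: "\<forall>x\<in>{a,b,c'}. \<forall>y\<in>{a,b,c'}. cc_dist A \<xi> g x y < ennreal \<epsilon>"
  shows "\<bar>edge h f a b + edge h f b c' + edge h f c' a\<bar> \<le> T * (K * (1 + 2 * C))^3 * \<epsilon>^3"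
proof -
  have "C \<ge> 0" by (rule lipschitz_on_nonneg[OF P])
  show ?thesis
  proof (cases "\<exists>x\<in>{a,b,c'}. x \<in> N \<and> norm (coord x) < R / 4")
    case True
    then obtain x where x: "x \<in> {a,b,c'}" "x \<in> N" "norm (coord x) < R / 4" by blast
    have K': "0 < K * (1 + 2 * C) * \<epsilon>" using K \<open>C \<ge> 0\<close> eps(1) by simp
    have near: "y \<in> N \<and> norm (coord y) \<le> R / 2" if y: "y \<in> {a,b,c'}" for y
    proof -
      have d: "cc_dist A \<xi> g x y < ennreal \<epsilon>" using close x(1) y by blast
      have b: "norm (coord x) + K * \<epsilon> \<le> R" using x(3) eps(2) R(1) by simp
      note cl = cc_dist_horizontally_close[OF R(2) P Q x(2) b eps(1) d]
      have "norm (coord y) \<le> norm (coord x) + norm (coord y - coord x)"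
        by (rule norm_triangle_sub)
      then show ?thesis using cl(1,2) x(3) eps(2) by simp
    qed
    have hc: "horizontally_close P Q (K * (1 + 2 * C) * \<epsilon>) (coord y) (coord y')" if y: "y \<in> {a,b,c'}" "y' \<in> {a,b,c'}" for y y'
    proof -
      have d: "cc_dist A \<xi> g y y' < ennreal \<epsilon>" using close y by blast
      have b: "norm (coord y) + K * \<epsilon> \<le> R" using near[OF y(1)] eps(2) R(1) by linarith
      show ?thesis
        using cc_dist_horizontally_close(3)[OF R(2) P Q _ b eps(1) d] near[OF y(1)] by blast
    qed
    have inB: "coord y \<in> cball 0 R" if "y \<in> {a,b,c'}" for y using near[OF that] R(1) by simp
    have "\<bar>rumin_edge P Q h f (coord a) (coord b) + rumin_edge P Q h f (coord b) (coord c') + rumin_edge P Q h f (coord c') (coord a)\<bar>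
        \<le> T * (K * (1 + 2 * C) * \<epsilon>)^3"
      by (rule tri[OF K' eps(3)]; (rule inB hc)?; simp)
    moreover have "a \<in> N" "b \<in> N" "c' \<in> N" using near by simp_all
    ultimately show ?thesis by (simp add: edge_def power_mult_distrib mult.assoc)
  next
    case False
    have "edge h f y y' = 0" if "y \<in> {a,b,c'}" "y' \<in> {a,b,c'}" for y y'
    proof (cases "y \<in> N \<and> y' \<in> N")
      case True
      then have "norm (coord y) \<ge> R / 4" "norm (coord y') \<ge> R / 4"
        using False that by (meson not_le)+
      then show ?thesis using van[of "coord y"] van[of "coord y'"] by (simp add: edge_def rumin_edge_vanishing)
    qed (auto simp: edge_def)
    then have "edge h f a b + edge h f b c' + edge h f c' a = 0" by simp
    moreover have "0 \<le> T * (K * (1 + 2 * C))^3 * \<epsilon>^3"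
      using \<open>T \<ge> 0\<close> K \<open>C \<ge> 0\<close> eps(1) by simp
    ultimately show ?thesis by simp
  qed
qed

lemma first_order_constants:
  fixes f :: "real^3 \<Rightarrow> real"
  assumes f: "smooth_on S f" "f 0 = 0" and R: "R > 0" "cball 0 R \<subseteq> S"
  obtains C where "C-lipschitz_on (cball 0 R) f"
    "\<forall>v\<in>cball 0 R. \<bar>f v - frechet_derivative f (at 0) v\<bar> \<le> C * (norm v)\<^sup>2"
    "\<bar>frechet_derivative f (at 0) (axis 3 1)\<bar> \<le> C"
proof -
  obtain C1 where C1: "C1 \<ge> 0" "\<And>v w. v \<in> cball 0 R \<Longrightarrow> w \<in> cball 0 R \<Longrightarrow> \<bar>f w - f v\<bar> \<le> C1 * norm (w - v)"
    using C1_bounded_lipschitz_on[OF smooth_onD[OF f(1)] S(1) R(2)] by (rule bounded_lipschitz_onE) blast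
  have lip: "C1-lipschitz_on (cball 0 R) f"
    using C1 by (intro lipschitz_onI; simp add: dist_real_def dist_norm)
  obtain C2 where C2: "C2 \<ge> 0" "\<And>v w. v \<in> cball 0 R \<Longrightarrow> w \<in> cball 0 R \<Longrightarrow>
      \<bar>f w - f v - frechet_derivative f (at v) (w - v)\<bar> \<le> C2 * (norm (w - v))\<^sup>2"
    using C2_taylor[OF smooth_onD[OF f(1)] S(1) R(2)] by blast
  define C where "C = C1 + C2 + \<bar>frechet_derivative f (at 0) (axis 3 1)\<bar>"
  have C: "C1 \<le> C" "C2 \<le> C" "\<bar>frechet_derivative f (at 0) (axis 3 1)\<bar> \<le> C"
    using C1(1) C2(1) by (auto simp: C_def)
  show thesis
  proof (rule that[OF lipschitz_on_le[OF lip C(1)] _ C(3)], intro ballI)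
    fix v :: "real^3" assume v: "v \<in> cball 0 R"
    have "\<bar>f v - frechet_derivative f (at 0) v\<bar> \<le> C2 * (norm v)\<^sup>2"
      using C2(2)[of 0 v] v R(1) f(2) by simp
    also have "\<dots> \<le> C * (norm v)\<^sup>2" by (rule mult_right_mono[OF C(2)]) simp
    finally show "\<bar>f v - frechet_derivative f (at 0) v\<bar> \<le> C * (norm v)\<^sup>2" .
  qed
qed

text \<open>Size r \<le> R / 80 keeps the loop, whose points have norm at most 6 r, in the region where the cutoff
function is 1.\<close>

lemma horizontal_loop:
  assumes R: "R > 0" "cball 0 R \<subseteq> S"
  obtains r l z D where "0 < r" "\<bar>l\<bar> \<le> 1" "z (-1) = 0" "z 1 = (0::real)" "D \<ge> 0"
    "\<forall>t\<in>{-1..1}. norm (vec3 (r * loop_x t) (r * loop_y l t) (z t)) \<le> R / 8"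
    "\<forall>s\<in>{-1..1}. \<forall>t\<in>{-1..1}.
        cc_dist A \<xi> g (point (vec3 (r * loop_x s) (r * loop_y l s) (z s))) (point (vec3 (r * loop_x t) (r * loop_y l t) (z t)))
          \<le> ennreal (D * \<bar>s - t\<bar>)"
proof -
  obtain CP where CP: "CP-lipschitz_on (cball 0 R) P" "\<forall>v\<in>cball 0 R. \<bar>P v - frechet_derivative P (at 0) v\<bar> \<le> CP * (norm v)\<^sup>2"
    "\<bar>frechet_derivative P (at 0) (axis 3 1)\<bar> \<le> CP"
    using first_order_constants[OF PQ(3,1) R] .
  obtain CQ where CQ: "CQ-lipschitz_on (cball 0 R) Q" "\<forall>v\<in>cball 0 R. \<bar>Q v - frechet_derivative Q (at 0) v\<bar> \<le> CQ * (norm v)\<^sup>2"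
    "\<bar>frechet_derivative Q (at 0) (axis 3 1)\<bar> \<le> CQ"
    using first_order_constants[OF PQ(4,2) R] .
  define C where "C = max CP CQ"
  have le: "CP \<le> C" "CQ \<le> C" by (auto simp: C_def)
  have lin: "frechet_derivative f (at 0) v = frechet_derivative f (at 0) (axis 1 1) * v$1
      + frechet_derivative f (at 0) (axis 2 1) * v$2 + frechet_derivative f (at 0) (axis 3 1) * v$3"
    if "smooth_on S f" for f :: "real^3 \<Rightarrow> real" and v
    using linear_expand[OF has_derivative_linear[OF Ck_on_open_derivative(1)[OF smooth_onD[OF that, of "Suc 0"] S(1,2)]], of v]
    by (simp add: mult.commute)
  have lip: "C-lipschitz_on (cball 0 R) P" "C-lipschitz_on (cball 0 R) Q"
    by (rule lipschitz_on_le[OF CP(1) le(1)], rule lipschitz_on_le[OF CQ(1) le(2)])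
  have tP: "\<bar>P v - (frechet_derivative P (at 0) (axis 1 1) * v$1 + frechet_derivative P (at 0) (axis 2 1) * v$2
      + frechet_derivative P (at 0) (axis 3 1) * v$3)\<bar> \<le> C * (norm v)\<^sup>2" if "v \<in> cball 0 R" for v
    unfolding lin[OF PQ(3), of v, symmetric] by (rule order_trans[OF bspec[OF CP(2) that] mult_right_mono[OF le(1)]]) simp
  have tQ: "\<bar>Q v - (frechet_derivative Q (at 0) (axis 1 1) * v$1 + frechet_derivative Q (at 0) (axis 2 1) * v$2
      + frechet_derivative Q (at 0) (axis 3 1) * v$3)\<bar> \<le> C * (norm v)\<^sup>2" if "v \<in> cball 0 R" for v
    unfolding lin[OF PQ(4), of v, symmetric] by (rule order_trans[OF bspec[OF CQ(2) that] mult_right_mono[OF le(2)]]) simp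
  have "R / 80 > 0" using R(1) by simp
  from closed_contact_loop_exists[OF R(1) this lip tP tQ
      order_trans[OF CP(3) le(1)] order_trans[OF CQ(3) le(2)] twist[symmetric]]
  obtain r l z where r: "0 < r" "r \<le> R / 80" "10 * r \<le> R" "\<bar>l\<bar> \<le> 1" and z: "z (-1) = 0" "z 1 = (0::real)"
    and zr: "\<forall>t\<in>{-1..1}. \<bar>z t\<bar> \<le> r"
    and dz: "\<forall>t\<in>{-1..1}. (z has_vector_derivative
        P (vec3 (r * loop_x t) (r * loop_y l t) (z t)) * (r * loop_x' t)
      + Q (vec3 (r * loop_x t) (r * loop_y l t) (z t)) * (r * loop_y' l t)) (at t within {-1..1})" .
  define Z where "Z t = vec3 (r * loop_x t) (r * loop_y l t) (z t)" for t
  define G where "G t = P (Z t) * (r * loop_x' t) + Q (Z t) * (r * loop_y' l t)" for t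
  define Z' where "Z' t = vec3 (r * loop_x' t) (r * loop_y' l t) (G t)" for t
  have nZ: "norm (Z t) \<le> R / 8" if t: "t \<in> {-1..1}" for t
  proof -
    have "norm (Z t) \<le> \<bar>r * loop_x t\<bar> + \<bar>r * loop_y l t\<bar> + \<bar>z t\<bar>"
      unfolding Z_def by (rule norm_vec3_le)
    also have "\<dots> \<le> r * 2 + r * 3 + r"
      unfolding abs_mult using loop_bounds[OF t r(4)] r(1) bspec[OF zr t] by (intro add_mono mult_mono) auto
    finally show ?thesis using r(1,2) by simp
  qed
  have ZS: "Z t \<in> S" if "t \<in> {-1..1}" for t
    using nZ[OF that] R by (auto simp: subset_iff)
  have dz': "(z has_vector_derivative G t) (at t within {-1..1})" if "t \<in> {-1..1}" for t
    using bspec[OF dz that] by (simp only: G_def Z_def)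
  have ckZ: "Ck_on k {-1..1} Z" if "Ck_on k {-1..1} z" for k
    unfolding Z_def[abs_def] by (intro Ck_on_vec3 Ck_on_mult Ck_on_const Ck_on_loop that)
  have ckG: "Ck_on k {-1..1} G" if "Ck_on k {-1..1} z" for k
    unfolding G_def[abs_def]
    by (intro Ck_on_add Ck_on_mult Ck_on_const Ck_on_loop
        Ck_on_compose[where X = Z and F = P, OF _ ckZ[OF that] smooth_onD[OF PQ(3)]]
        Ck_on_compose[where X = Z and F = Q, OF _ ckZ[OF that] smooth_onD[OF PQ(4)]]) (use ZS in auto)
  have smz: "smooth_on {-1..1} z"
    by (rule smooth_on_vector_ode[OF dz' ckG])
  have smZ: "smooth_on {-1..1} Z"
    unfolding smooth_on_def using ckZ smooth_onD[OF smz] by blast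
  have "Ck_on 0 {-1..1} Z'"
    unfolding Z'_def[abs_def] by (intro Ck_on_vec3 Ck_on_mult Ck_on_const Ck_on_loop ckG smooth_onD[OF smz])
  then have "bounded (Z' ` {-1..1})"
    by (intro compact_imp_bounded compact_continuous_image) auto
  then obtain B where "\<forall>x\<in>Z' ` {-1..1}. norm x \<le> B"
    unfolding bounded_iff by (rule exE)
  then have B: "norm (Z' t) \<le> B" if "t \<in> {-1..1}" for t
    using that by blast
  have B0: "0 \<le> B" using order_trans[OF norm_ge_zero B[of 0]] by simp
  have dZ: "(Z has_vector_derivative Z' t) (at t within {-1..1})" if t: "t \<in> {-1..1}" for t
  proof -
    have "((\<lambda>t. r * loop_x t) has_vector_derivative r * loop_x' t) (at t within {-1..1})"
      "((\<lambda>t. r * loop_y l t) has_vector_derivative r * loop_y' l t) (at t within {-1..1})"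
      using loop_derivatives by (intro has_vector_derivative_mult_right; simp add: has_real_derivative_iff_has_vector_derivative)+
    from bounded_linear.has_vector_derivative[OF bounded_linear_scaleR_left this(1), of "axis 1 1 :: real^3"]
      bounded_linear.has_vector_derivative[OF bounded_linear_scaleR_left this(2), of "axis 2 1 :: real^3"]
      bounded_linear.has_vector_derivative[OF bounded_linear_scaleR_left dz'[OF t], of "axis 3 1 :: real^3"]
    show ?thesis
      unfolding Z_def[abs_def] Z'_def vec3_def by (intro has_vector_derivative_add)
  qed
  have "cc_dist A \<xi> g (point (Z s)) (point (Z t)) \<le> ennreal (K * B * \<bar>s - t\<bar>)" if "s \<in> {-1..1}" "t \<in> {-1..1}" for s t
    by (rule horizontal_coordinate_curve_lipschitz[OF smZ dZ ZS _ B that]) (simp_all add: Z'_def G_def)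
  then show thesis
    using that[of r l z "K * B"] r z B0 K nZ unfolding Z_def by simp
qed

text \<open>Along the loop the contact form is O(n^{-2}) on each of the n edges, so the edge sum converges to the integral of
h dx = x y dx.  This is nonzero, but a null homotopy would make the edge sum O(1/n).\<close>

lemma essential_loop_exists:
  obtains \<gamma> where "lip_loop (cc_dist A \<xi> g) N p \<gamma>" "\<not> lip_homotopic (cc_dist A \<xi> g) UNIV (\<lambda>_. p) \<gamma>"
proof -
  let ?d = "cc_dist A \<xi> g"
  obtain R k where R: "R > 0" "k > 0" "cball 0 R \<subseteq> S"
    and tw: "\<And>v. v \<in> cball 0 R \<Longrightarrow> k \<le> \<bar>deriv_X P Q v - deriv_Y Q P v\<bar>"
    by (rule good_ball) blast
  obtain CP where CP: "CP-lipschitz_on (cball 0 R) P" by (rule first_order_constants[OF PQ(3,1) R(1,3)])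
  obtain CQ where CQ: "CQ-lipschitz_on (cball 0 R) Q" by (rule first_order_constants[OF PQ(4,2) R(1,3)])
  define C where "C = max CP CQ"
  have lip: "C-lipschitz_on (cball 0 R) P" "C-lipschitz_on (cball 0 R) Q"
    unfolding C_def by (rule lipschitz_on_le[OF CP max.cobounded1], rule lipschitz_on_le[OF CQ max.cobounded2])
  have C: "C \<ge> 0" by (rule lipschitz_on_nonneg[OF lip(1)])
  note jet = C2_horizontal_jet[OF _ smooth_onD[OF PQ(3)] smooth_onD[OF PQ(4)] S(1) R(3)]
  note jP = jet[OF smooth_onD[OF PQ(3)]] and jQ = jet[OF smooth_onD[OF PQ(4)]]
  obtain h f hX hY where jh: "horizontal_jet P Q (cball 0 R) h hX hY" and blf: "bounded_lipschitz_on (cball 0 R) f"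
    and fh: "\<And>v. v \<in> cball 0 R \<Longrightarrow>
       f v * (deriv_X P Q v - deriv_Y Q P v) = hY v"
    and h_in: "\<And>v. norm v \<le> R / 8 \<Longrightarrow> h v = v$1 * v$2"
    and h_out: "\<And>v. norm v \<ge> 2 * (R / 8) \<Longrightarrow> h v = 0 \<and> f v = 0"
    by (rule cutoff_pair_exists[OF _ bounded_cball jP jQ R(2) tw, of "R / 8"]) (use R(1) in auto)
  have van: "h v = 0 \<and> f v = 0" if "norm v \<ge> R / 4" for v using h_out[of v] that by simp
  obtain T where T: "T \<ge> 0" and tri: "\<And>\<epsilon> a b c. 0 < \<epsilon> \<Longrightarrow> \<epsilon> \<le> 1 \<Longrightarrow> a \<in> cball 0 R \<Longrightarrow> b \<in> cball 0 R \<Longrightarrow> c \<in> cball 0 R \<Longrightarrow>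
           horizontally_close P Q \<epsilon> a b \<Longrightarrow> horizontally_close P Q \<epsilon> a c \<Longrightarrow> horizontally_close P Q \<epsilon> b c \<Longrightarrow>
           \<bar>rumin_edge P Q h f a b + rumin_edge P Q h f b c + rumin_edge P Q h f c a\<bar> \<le> T * \<epsilon>^3"
    using rumin_edge_triangle[OF blf jP jQ jh fh] by blast
  obtain a where a: "a \<ge> 0" "\<And>v w \<epsilon>. v \<in> cball 0 R \<Longrightarrow> w \<in> cball 0 R \<Longrightarrow> \<epsilon> > 0 \<Longrightarrow> horizontally_close P Q \<epsilon> v w \<Longrightarrow>
      \<bar>contact_edge P Q v w\<bar> \<le> a * \<epsilon>\<^sup>2"
    using contact_edge_bound[OF horizontal_jet_bounded(1)[OF jP] horizontal_jet_bounded(1)[OF jQ]] by blast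
  obtain M where M: "M \<ge> 0" "\<And>v. v \<in> cball 0 R \<Longrightarrow> \<bar>f v\<bar> \<le> M"
    using blf by (rule bounded_lipschitz_onE) blast
  obtain r l z D where r: "0 < r" "\<bar>l\<bar> \<le> 1" and z: "z (-1) = 0" "z 1 = (0::real)" and D: "D \<ge> 0"
    and small: "\<forall>t\<in>{-1..1}. norm (vec3 (r * loop_x t) (r * loop_y l t) (z t)) \<le> R / 8"
    and speed: "\<forall>s\<in>{-1..1}. \<forall>t\<in>{-1..1}.
        ?d (point (vec3 (r * loop_x s) (r * loop_y l s) (z s))) (point (vec3 (r * loop_x t) (r * loop_y l t) (z t)))
          \<le> ennreal (D * \<bar>s - t\<bar>)"
    using horizontal_loop[OF R(1,3)] .
  define Z where "Z t = vec3 (r * loop_x t) (r * loop_y l t) (z t)" for t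
  define \<gamma> where "\<gamma> u = point (Z (2 * u - 1))" for u
  have ZR: "norm (Z t) \<le> R / 8" "Z t \<in> cball 0 R" "Z t \<in> S" if "t \<in> {-1..1}" for t
  proof -
    show n: "norm (Z t) \<le> R / 8" using small that by (simp add: Z_def)
    show b: "Z t \<in> cball 0 R" using n R(1) by simp
    show "Z t \<in> S" using b R(3) by blast
  qed
  have dZ: "?d (point (Z s)) (point (Z t)) \<le> ennreal (D * \<bar>s - t\<bar>)" if "s \<in> {-1..1}" "t \<in> {-1..1}" for s t
    unfolding Z_def using speed that by blast
  have range: "2 * u - 1 \<in> {-1..1}" if "u \<in> {0..1}" for u :: real using that by simp
  have "vec3 0 0 0 = 0" by (simp add: vec3_def)
  then have ends: "\<gamma> 0 = p" "\<gamma> 1 = p"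
    by (simp_all add: \<gamma>_def Z_def loop_ends z point_0)
  have "lip_path ?d N \<gamma>"
    unfolding lip_path_def lipschitz_map_def
  proof (intro conjI exI[of _ "2 * D"] ballI)
    show "\<gamma> ` {0..1} \<subseteq> N"
      using point_in_N(1) ZR(3) range by (auto simp: \<gamma>_def)
    show "2 * D \<ge> 0" using D by simp
    fix x y :: real assume xy: "x \<in> {0..1}" "y \<in> {0..1}"
    have "\<bar>(2 * x - 1) - (2 * y - 1)\<bar> = \<bar>2 * (x - y)\<bar>" by (simp add: algebra_simps)
    then have "\<bar>(2 * x - 1) - (2 * y - 1)\<bar> = 2 * \<bar>x - y\<bar>" unfolding abs_mult by simp
    then have "?d (\<gamma> x) (\<gamma> y) \<le> ennreal (2 * D * \<bar>x - y\<bar>)"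
      using dZ[OF range[OF xy(1)] range[OF xy(2)]] by (simp add: \<gamma>_def mult.left_commute mult.assoc)
    also have "\<dots> = ennreal (2 * D) * ennreal \<bar>x - y\<bar>" using D by (simp add: ennreal_mult)
    finally show "?d (\<gamma> x) (\<gamma> y) \<le> ennreal (2 * D) * ennreal \<bar>x - y\<bar>" .
  qed
  then have loop: "lip_loop ?d N p \<gamma>" using ends by (simp add: lip_loop_def)
  define \<kappa> where "\<kappa> = K * (1 + 2 * C)"
  have \<kappa>: "\<kappa> > 0" using K C by (simp add: \<kappa>_def)
  have "\<not> lip_homotopic ?d UNIV (\<lambda>_. p) \<gamma>"
  proof
    assume hom: "lip_homotopic ?d UNIV (\<lambda>_. p) \<gamma>"
    \<comment> \<open>triangles that meet the support, of radius R / 4, stay in the ball of radius R / 2\<close>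
    define \<epsilon>0 where "\<epsilon>0 = min (R / (4 * K)) (1 / \<kappa>)"
    have \<epsilon>0: "\<epsilon>0 > 0" using R(1) K \<kappa> by (simp add: \<epsilon>0_def)
    have eps0: "K * \<epsilon> \<le> R / 4" "\<kappa> * \<epsilon> \<le> 1" if "\<epsilon> \<le> \<epsilon>0" for \<epsilon>
    proof -
      have "\<epsilon> \<le> R / (4 * K)" "\<epsilon> \<le> 1 / \<kappa>" using that by (simp_all add: \<epsilon>0_def)
      then show "K * \<epsilon> \<le> R / 4" "\<kappa> * \<epsilon> \<le> 1"
        using K \<kappa> by (simp_all add: pos_le_divide_eq mult.commute mult.left_commute)
    qed
    have "\<exists>B N0. \<forall>n\<ge>N0. \<bar>\<Sum>i<n. edge h f (\<gamma> (real i / real n)) (\<gamma> (real (Suc i) / real n))\<bar> \<le> B / real n"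
    proof (rule lipschitz_nullhomotopy_edge_sum[OF edge_swap _ \<epsilon>0 hom ends])
      fix \<epsilon> and x y w :: 'a assume e: "0 < \<epsilon>" "\<epsilon> \<le> \<epsilon>0"
        and cl: "\<forall>u\<in>{x, y, w}. \<forall>v\<in>{x, y, w}. ?d u v < ennreal \<epsilon>"
      show "\<bar>edge h f x y + edge h f y w + edge h f w x\<bar> \<le> T * \<kappa>^3 * \<epsilon>^3"
        unfolding \<kappa>_def
        by (rule edge_triangle[OF R(1,3) lip tri van T e(1) eps0(1)[OF e(2)] eps0(2)[OF e(2), unfolded \<kappa>_def] cl])
    qed
    then obtain B N0 where B: "\<forall>n\<ge>N0. \<bar>\<Sum>i<n. edge h f (\<gamma> (real i / real n)) (\<gamma> (real (Suc i) / real n))\<bar> \<le> B / real n"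
      by blast
    \<comment> \<open>1024 = 256 * 4, as consecutive parameters in [-1, 1] differ by 2 / n;
      the second summand bounds the contribution of the contact form\<close>
    define b where "b = r^3 * 1024 + M * (a * (\<kappa> * (2 * D + 1))\<^sup>2)"
    define m where "m t = r^3 * loop_moment l t" for t
    have edge_bound: "\<bar>edge h f (\<gamma> (real i / real n)) (\<gamma> (real (Suc i) / real n))
        - (m (2 * (real (Suc i) / real n) - 1) - m (2 * (real i / real n) - 1))\<bar> \<le> b / (real n)\<^sup>2"
      if n: "n > 0" "K * ((2 * D + 1) / real n) \<le> R / 2" and i: "i < n" for n i
    proof -
      define s where "s = 2 * (real i / real n) - 1"
      define t where "t = 2 * (real (Suc i) / real n) - 1"
      have "real i / real n \<in> {0..1}" "real (Suc i) / real n \<in> {0..1}" using i by auto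
      then have st: "s \<in> {-1..1}" "t \<in> {-1..1}" unfolding s_def t_def by (blast intro: range)+
      have ts: "t - s = 2 / real n" by (simp add: s_def t_def add_divide_distrib distrib_left)
      then have st': "s \<le> t" using divide_nonneg_nonneg[of 2 "real n"] by linarith
      define \<epsilon> where "\<epsilon> = (2 * D + 1) / real n"
      have e: "\<epsilon> > 0" using D n(1) by (simp add: \<epsilon>_def)
      have "?d (point (Z s)) (point (Z t)) \<le> ennreal (D * \<bar>s - t\<bar>)" by (rule dZ[OF st])
      also have "\<bar>s - t\<bar> = 2 / real n" using ts st' by linarith
      also have "ennreal (D * (2 / real n)) < ennreal \<epsilon>"
        using e D n(1) by (intro ennreal_lessI) (auto simp: \<epsilon>_def divide_strict_right_mono)
      finally have dst: "?d (point (Z s)) (point (Z t)) < ennreal \<epsilon>" .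
      have coords: "coord (point (Z s)) = Z s" "coord (point (Z t)) = Z t" "point (Z s) \<in> N" "point (Z t) \<in> N"
        using point_in_N ZR(3)[OF st(1)] ZR(3)[OF st(2)] by auto
      have "norm (coord (point (Z s))) + K * \<epsilon> \<le> R"
        using ZR(1)[OF st(1)] n(2) R(1) unfolding coords \<epsilon>_def by linarith
      from cc_dist_horizontally_close(3)[OF R(3) lip coords(3) this e dst]
      have "horizontally_close P Q (\<kappa> * \<epsilon>) (Z s) (Z t)" unfolding coords \<kappa>_def .
      then have ce: "\<bar>contact_edge P Q (Z s) (Z t)\<bar> \<le> a * (\<kappa> * \<epsilon>)\<^sup>2"
        using a(2)[OF ZR(2)[OF st(1)] ZR(2)[OF st(2)]] \<kappa> e by simp
      have "\<bar>(f (Z s) + f (Z t)) / 2\<bar> \<le> M"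
        using M(2)[OF ZR(2)[OF st(1)]] M(2)[OF ZR(2)[OF st(2)]] abs_triangle_ineq[of "f (Z s)" "f (Z t)"] by simp
      then have 1: "\<bar>(f (Z s) + f (Z t)) / 2 * contact_edge P Q (Z s) (Z t)\<bar> \<le> M * (a * (\<kappa> * \<epsilon>)\<^sup>2)"
        unfolding abs_mult using ce M(1) by (intro mult_mono) auto
      have tr: "trapezoid h (\<lambda>v. v$1) (Z s) (Z t) = r^3 * trapezoid (\<lambda>y. loop_x y * loop_y l y) loop_x s t"
        unfolding trapezoid_def h_in[OF ZR(1)[OF st(1)]] h_in[OF ZR(1)[OF st(2)]]
        by (simp add: Z_def power3_eq_cube algebra_simps)
      have 2: "\<bar>trapezoid h (\<lambda>v. v$1) (Z s) (Z t) - (m t - m s)\<bar> \<le> r^3 * (256 * (t - s)\<^sup>2)"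
      proof -
        have "trapezoid h (\<lambda>v. v$1) (Z s) (Z t) - (m t - m s)
          = r^3 * (trapezoid (\<lambda>y. loop_x y * loop_y l y) loop_x s t - (loop_moment l t - loop_moment l s))"
          unfolding tr m_def by (simp add: algebra_simps)
        then show ?thesis
          using loop_trapezoid_error[OF st st' r(2)] r(1) by (simp add: abs_mult)
      qed
      have eq: "edge h f (\<gamma> (real i / real n)) (\<gamma> (real (Suc i) / real n)) = rumin_edge P Q h f (Z s) (Z t)"
        using coords by (simp only: edge_def \<gamma>_def s_def[symmetric] t_def[symmetric] simp_thms if_True)
      have "\<bar>rumin_edge P Q h f (Z s) (Z t) - (m t - m s)\<bar> \<le> r^3 * (256 * (t - s)\<^sup>2) + M * (a * (\<kappa> * \<epsilon>)\<^sup>2)"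
        unfolding rumin_edge_def using add_mono[OF 2 1]
          abs_triangle_ineq4[of "trapezoid h (\<lambda>v. v$1) (Z s) (Z t) - (m t - m s)" "(f (Z s) + f (Z t)) / 2 * contact_edge P Q (Z s) (Z t)"]
        by (simp add: algebra_simps)
      also have "\<dots> = b / (real n)\<^sup>2"
      proof -
        have "(\<kappa> * \<epsilon>)\<^sup>2 = (\<kappa> * (2 * D + 1))\<^sup>2 / (real n)\<^sup>2"
          by (simp only: \<epsilon>_def times_divide_eq_right power_divide)
        moreover have "(t - s)\<^sup>2 = 4 / (real n)\<^sup>2" by (simp add: ts power_divide)
        ultimately show ?thesis by (simp only: b_def add_divide_distrib) simp
      qed
      finally show ?thesis unfolding eq s_def[symmetric] t_def[symmetric] .
    qed
    have total: "m 1 - m (-1) = - (r^3 * (64 / 3465))"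
      unfolding m_def right_diff_distrib[symmetric] loop_moment_total by simp
    define c0 where "c0 = r^3 * (64 / 3465)"
    have c0: "c0 > 0" using r(1) by (simp add: c0_def)
    obtain n :: nat where n: "real n > max (real N0) (max (2 * K * (2 * D + 1) / R) ((\<bar>B\<bar> + \<bar>b\<bar>) / c0))" "n > 0"
    proof -
      obtain n :: nat where "real n > max 1 (max (real N0) (max (2 * K * (2 * D + 1) / R) ((\<bar>B\<bar> + \<bar>b\<bar>) / c0)))"
        using reals_Archimedean2 by blast
      then show thesis using that[of n] by simp
    qed
    have n0: "N0 \<le> n" and nK: "2 * K * (2 * D + 1) / R < real n" and nB: "(\<bar>B\<bar> + \<bar>b\<bar>) / c0 < real n"
      using n(1) by auto
    have "K * ((2 * D + 1) / real n) \<le> R / 2"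
      using nK R(1) n(2) by (simp add: field_simps)
    then have "\<bar>(\<Sum>i<n. edge h f (\<gamma> (real i / real n)) (\<gamma> (real (Suc i) / real n)))
        - (m (2 * (real n / real n) - 1) - m (2 * (real 0 / real n) - 1))\<bar> \<le> real n * (b / (real n)\<^sup>2)"
      using edge_bound n(2) by (intro telescoping_sum_error) blast
    also have "real n * (b / (real n)\<^sup>2) = b / real n"
      by (simp add: power2_eq_square)
    finally have "\<bar>(\<Sum>i<n. edge h f (\<gamma> (real i / real n)) (\<gamma> (real (Suc i) / real n))) + c0\<bar> \<le> b / real n"
      using total n(2) by (simp add: c0_def)
    moreover have "\<bar>\<Sum>i<n. edge h f (\<gamma> (real i / real n)) (\<gamma> (real (Suc i) / real n))\<bar> \<le> B / real n"
      using B n0 by blast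
    ultimately have "c0 \<le> B / real n + b / real n"
      unfolding abs_le_iff by linarith
    also have "\<dots> \<le> (\<bar>B\<bar> + \<bar>b\<bar>) / real n"
      by (simp add: divide_right_mono flip: add_divide_distrib)
    finally have "c0 * real n \<le> \<bar>B\<bar> + \<bar>b\<bar>" using n(2) by (simp add: field_simps)
    moreover have "\<bar>B\<bar> + \<bar>b\<bar> < c0 * real n" using nB c0 by (simp add: field_simps)
    ultimately show False by simp
  qed
  then show thesis using that loop by blast
qed

end

theorem theorem1p5:
  fixes A :: "'a::{t2_space,second_countable_topology} chart set"
    and \<xi> :: "'a \<Rightarrow> 'a tvector set"
    and g :: "'a \<Rightarrow> 'a tvector \<Rightarrow> 'a tvector \<Rightarrow> real"
  assumes "smooth_atlas A"
    and "contact_structure A \<xi>"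
    and "sub_riemannian_metric A \<xi> g"
  shows "\<forall>p U. open U \<and> p \<in> U \<longrightarrow>
    \<not> trivial_map (lip_pi1 (cc_dist A \<xi> g) U p) (lip_pi1 (cc_dist A \<xi> g) UNIV p)
        (lip_pi1_map (cc_dist A \<xi> g) UNIV (\<lambda>x. x))"
proof (intro allI impI notI)
  fix p :: 'a and U assume U: "open U \<and> p \<in> U"
    and trivial: "trivial_map (lip_pi1 (cc_dist A \<xi> g) U p) (lip_pi1 (cc_dist A \<xi> g) UNIV p)
        (lip_pi1_map (cc_dist A \<xi> g) UNIV (\<lambda>x. x))"
  obtain c N F K S P Q where coords: "contact_coordinates A \<xi> g c N p F K S P Q" and "N \<subseteq> U"
    using contact_coordinates_exist[OF assms conjunct1[OF U] conjunct2[OF U]] .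
  obtain \<gamma> where \<gamma>: "lip_loop (cc_dist A \<xi> g) N p \<gamma>" "\<not> lip_homotopic (cc_dist A \<xi> g) UNIV (\<lambda>_. p) \<gamma>"
    using contact_coordinates.essential_loop_exists[OF coords] .
  have "lip_loop (cc_dist A \<xi> g) U p \<gamma>"
    using \<gamma>(1) \<open>N \<subseteq> U\<close> unfolding lip_loop_def lip_path_def lipschitz_map_def by blast
  from trivial_map_imp_nullhomotopic[OF trivial this] \<gamma>(2) show False by blast
qed

end
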